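(* If $U\subset\mathbb{C}$ is a domain whose boundary is a bounded quasiarc, then $U$ is Schwartz equivalent to $\mathbb{C}\setminus\overline{\mathbb{D}}$, where $\mathbb{D}$ is the open unit disc.
   Context: A domain is an open connected subset of $\mathbb{C}$; boundaries are taken in $\mathbb{C}$. Identify $\mathbb{C}$ with $\mathbb{R}^2$. $\mathcal{S}(\mathbb{R}^n)$ is the usual Fréchet space of real-valued Schwartz functions on $\mathbb{R}^n$. For an open $U\subset\mathbb{R}^n$, $\mathcal{S}(U)$ is the closed subspace of those $f\in\mathcal{S}(\mathbb{R}^n)$ such that $f$ and all its partial derivatives vanish at every point of $\mathbb{R}^n\setminus U$, with the induced Fréchet topology; its elements are regarded (by restriction) as smooth functions on $U$. Two open subsets $U,V\subset\mathbb{R}^n$ are called Schwartz equivalent if there exists a $C^\infty$-diffeomorphism $\phi\colon U\to V$ such that $s\mapsto s\circ\phi$ is an isomorphism of Fréchet spaces $\mathcal{S}(V)\to\mathcal{S}(U)$. A closed subset $J^0\subset\mathbb{C}$ is a quasicircle if its closure in the Riemann sphere $\widehat{\mathbb{C}}$ is a Jordan curve and there is $C>0$ such that for all distinct $x,y\in J^0$ the smallest diameter of a connected component of $J^0\setminus\{x,y\}$ is at most $C|x-y|$. A quasiarc is a subset of $\mathbb{C}$ that is contained in some quasicircle and whose closure in $\widehat{\mathbb{C}}$ is homeomorphic to $[0,1]$. *)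

theory Defs
  imports "HOL-Analysis.Analysis"
begin

text \<open>
  Euclidean space \<open>\<real>\<^sup>n\<close> is rendered by a type of class \<open>euclidean_space\<close>; the identification of
  \<open>\<complex>\<close> with \<open>\<real>\<^sup>2\<close> is the library's instance for \<open>complex\<close>, with \<open>Basis = {1, \<i>}\<close>.
  Partial derivatives are indexed by lists of basis vectors instead of multi-indices.
\<close>

definition partial_deriv :: "'a::euclidean_space \<Rightarrow> ('a \<Rightarrow> 'b::real_normed_vector) \<Rightarrow> 'a \<Rightarrow> 'b"
  where "partial_deriv b f = (\<lambda>x. frechet_derivative f (at x) b)"

definition partial_derivs :: "'a::euclidean_space list \<Rightarrow> ('a \<Rightarrow> 'b::real_normed_vector) \<Rightarrow> 'a \<Rightarrow> 'b"
  where "partial_derivs bs f = foldr partial_deriv bs f"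

text \<open>
  For open \<open>U\<close> this is \<open>C\<^sup>\<infinity>\<close> on \<open>U\<close>: all iterated partial derivatives exist and are Frechet
  differentiable, hence continuous.  Only the restriction of \<open>f\<close> to \<open>U\<close> matters.
\<close>

definition smooth_on :: "'a::euclidean_space set \<Rightarrow> ('a \<Rightarrow> 'b::real_normed_vector) \<Rightarrow> bool"
  where "smooth_on U f \<longleftrightarrow> (\<forall>bs\<in>lists Basis. partial_derivs bs f differentiable_on U)"

definition diffeomorphism_on ::
    "'a::euclidean_space set \<Rightarrow> 'b::euclidean_space set \<Rightarrow> ('a \<Rightarrow> 'b) \<Rightarrow> bool"
  where "diffeomorphism_on U V \<phi> \<longleftrightarrow>
    bij_betw \<phi> U V \<and> smooth_on U \<phi> \<and> smooth_on V (inv_into U \<phi>)"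

definition schwartz_functions :: "('a::euclidean_space \<Rightarrow> real) set"
  where "schwartz_functions = {f. smooth_on UNIV f \<and>
    (\<forall>k. \<forall>bs\<in>lists Basis. bounded (range (\<lambda>x. (1 + norm x) ^ k * partial_derivs bs f x)))}"

text \<open>The supremum is meaningful (finite) for Schwartz functions only.\<close>

definition schwartz_seminorm :: "nat \<Rightarrow> 'a::euclidean_space list \<Rightarrow> ('a \<Rightarrow> real) \<Rightarrow> real"
  where "schwartz_seminorm k bs f = (SUP x. (1 + norm x) ^ k * \<bar>partial_derivs bs f x\<bar>)"

text \<open>The locally convex topology defined by the family of seminorms: open seminorm balls
  form a subbase.\<close>

definition schwartz_topology :: "('a::euclidean_space \<Rightarrow> real) topology"
  where "schwartz_topology = topology_generated_by
    {{g \<in> schwartz_functions. schwartz_seminorm k bs (\<lambda>x. g x - f x) < e} | f k bs e.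
       f \<in> schwartz_functions \<and> bs \<in> lists Basis \<and> e > 0}"

definition schwartz_functions_on :: "'a::euclidean_space set \<Rightarrow> ('a \<Rightarrow> real) set"
  where "schwartz_functions_on U = {f \<in> schwartz_functions.
    \<forall>bs\<in>lists Basis. \<forall>x\<in>- U. partial_derivs bs f x = 0}"

definition schwartz_topology_on :: "'a::euclidean_space set \<Rightarrow> ('a \<Rightarrow> real) topology"
  where "schwartz_topology_on U = subtopology schwartz_topology (schwartz_functions_on U)"

definition schwartz_isomorphism ::
    "'a::euclidean_space set \<Rightarrow> 'b::euclidean_space set \<Rightarrow> (('a \<Rightarrow> real) \<Rightarrow> ('b \<Rightarrow> real)) \<Rightarrow> bool"
  where "schwartz_isomorphism V U T \<longleftrightarrow>
    (\<forall>f\<in>schwartz_functions_on V. \<forall>g\<in>schwartz_functions_on V. \<forall>a b.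
       T (\<lambda>x. a * f x + b * g x) = (\<lambda>x. a * T f x + b * T g x)) \<and>
    homeomorphic_map (schwartz_topology_on V) (schwartz_topology_on U) T"

text \<open>
  Elements of \<open>\<S>(U)\<close> are functions on the whole space vanishing outside \<open>U\<close>, so \<open>s \<circ> \<phi>\<close>, which
  lives on \<open>U\<close>, is extended by zero.
\<close>

definition schwartz_pullback ::
    "'a::euclidean_space set \<Rightarrow> ('a \<Rightarrow> 'b::euclidean_space) \<Rightarrow> ('b \<Rightarrow> real) \<Rightarrow> ('a \<Rightarrow> real)"
  where "schwartz_pullback U \<phi> s = (\<lambda>x. if x \<in> U then s (\<phi> x) else 0)"

definition schwartz_equivalent :: "'a::euclidean_space set \<Rightarrow> 'a set \<Rightarrow> bool"
  where "schwartz_equivalent U V \<longleftrightarrow> open U \<and> open V \<and>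
    (\<exists>\<phi>. diffeomorphism_on U V \<phi> \<and> schwartz_isomorphism V U (schwartz_pullback U \<phi>))"

text \<open>The Riemann sphere is the one-point compactification of \<open>\<complex>\<close>, with \<open>None\<close> as the point at
  infinity.\<close>

definition riemann_sphere :: "complex option topology"
  where "riemann_sphere = Alexandroff_compactification euclidean"

definition sphere_closure :: "complex set \<Rightarrow> complex option set"
  where "sphere_closure S = riemann_sphere closure_of (Some ` S)"

text \<open>
  In \<open>quasicircle\<close>, components may be unbounded (of infinite diameter), while \<open>diameter\<close> is
  specified for bounded sets only; the smallest diameter is at most a given real number iff
  some bounded component has at most that diameter.
\<close>

definition quasicircle :: "complex set \<Rightarrow> bool"
  where "quasicircle J \<longleftrightarrow> closed J \<and>
    subtopology riemann_sphere (sphere_closure J) homeomorphic_space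
      top_of_set (sphere (0::complex) 1) \<and>
    (\<exists>C>0. \<forall>x\<in>J. \<forall>y\<in>J. x \<noteq> y \<longrightarrow>
       (\<exists>K\<in>components (J - {x, y}). bounded K \<and> diameter K \<le> C * dist x y))"

definition quasiarc :: "complex set \<Rightarrow> bool"
  where "quasiarc A \<longleftrightarrow> (\<exists>J. quasicircle J \<and> A \<subseteq> J) \<and>
    subtopology riemann_sphere (sphere_closure A) homeomorphic_space
      top_of_set {0..1::real}"

end

(*
The domain is U = - A with A a compact arc.  The equivalence is given by the Riemann map phi of the
complement of A in the Riemann sphere onto the exterior of the unit disc, normalised to fix
infinity, with inverse psi.  A biholomorphic map induces an isomorphism of Schwartz spaces as soon
as the weights (1 + |z|) (1 + 1 / dist z A) and (1 + |w|) (1 + 1 / (|w| - 1)) are polynomially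
equivalent along it: Cauchy's inequality makes the derivatives of phi grow at most polynomially in the
weight, while elements of S(V) decay faster than any power of it by Taylor expansion from the boundary.

That dist (psi w) A is bounded below by a power of |w| - 1 holds for every simply connected domain: a
branch of log (psi - a) is injective modulo 2 pi i, so its image contains no disc of radius
larger than pi and Bloch's theorem bounds its derivative by a multiple of 1 / (|w| - 1).

That |phi z| - 1 is bounded below by a power of dist z A uses the quasiarc condition, through a John
condition: z is joined to infinity by points q with dist q A at least c |q - z|.  A chain of
O(log (1 / dist z A)) balls covers these points, and Harnack's inequality for 1 - 1 / |phi| is applied
in each of them.
*)

theory Submission
  imports Defs "HOL-Complex_Analysis.Complex_Analysis"
begin

section \<open>Schwartz spaces and pullbacks under biholomorphic maps\<close>

text \<open>In a channel between two strands of an arc that meet tangentially, Harnack chains are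
  longer than logarithmic, and \<open>1 - 1 / |phi|\<close> decays faster than any power of the
  distance. The quasiarc condition excludes this in the form of bounded turning: nearby points of
  \<open>A\<close> lie in a connected part of \<open>A\<close> of comparable size. That speaks about
  \<open>A\<close>, whereas Harnack's inequality needs room in the complement. The passage is
  topological: by Borsuk's criterion, a compact set carrying a continuous branch of
  \<open>log (q - z)\<close> does not separate \<open>z\<close> from infinity. On the Schwartz side
  all derivatives must be controlled uniformly in the function. Derivatives of a pullback are
  therefore kept in a class of operators closed under differentiation, with coefficients built from
  real parts of holomorphic functions, to which Cauchy's inequality applies. An arc does not
  separate the plane, whence \<open>U = - A\<close>. The plane model of the complement is obtained
  by inversion at an endpoint of \<open>A\<close>: the rest of \<open>A\<close> stays connected,
  which makes the inverted domain simply connected.\<close>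

lemma partial_derivs_Nil [simp]: "partial_derivs [] f = f"
  and partial_derivs_Cons [simp]: "partial_derivs (b # bs) f = partial_deriv b (partial_derivs bs f)"
  by (simp_all add: partial_derivs_def)

lemma partial_deriv_eqI: "(f has_derivative f') (at x) \<Longrightarrow> partial_deriv b f x = f' b"
  unfolding partial_deriv_def using frechet_derivative_at by metis

lemma partial_deriv_cong_open:
  assumes "open U" "x \<in> U" "\<And>y. y \<in> U \<Longrightarrow> f y = g y"
  shows "partial_deriv b f x = partial_deriv b g x"
proof -
  have "(f has_derivative D) (at x) \<longleftrightarrow> (g has_derivative D) (at x)" for D
    using has_derivative_transform_within_open[of f D x UNIV U g]
      has_derivative_transform_within_open[of g D x UNIV U f] assms by auto
  then show ?thesis
    by (simp add: partial_deriv_def frechet_derivative_def)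
qed

text \<open>The real differential of a holomorphic function is multiplication by
  \<open>deriv f z\<close>, so each direction in \<open>bs\<close> contributes itself as a
  factor.\<close>

lemma partial_derivs_holomorphic:
  assumes "open U" "f holomorphic_on U" "z \<in> U"
  shows "partial_derivs bs f z = prod_list bs * (deriv ^^ length bs) f z"
  using assms(3)
proof (induction bs arbitrary: z)
  case (Cons b bs)
  have "(deriv ^^ length bs) f holomorphic_on U"
    by (simp add: assms holomorphic_higher_deriv)
  then have "((deriv ^^ length bs) f has_field_derivative (deriv ^^ Suc (length bs)) f z) (at z)"
    using assms(1) Cons.prems by (simp add: holomorphic_derivI)
  then have D: "((\<lambda>z. prod_list bs * (deriv ^^ length bs) f z) has_derivative
      (*) (prod_list bs * (deriv ^^ Suc (length bs)) f z)) (at z)"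
    unfolding has_field_derivative_def[symmetric] by (rule DERIV_cmult)
  have "partial_deriv b (partial_derivs bs f) z
      = partial_deriv b (\<lambda>z. prod_list bs * (deriv ^^ length bs) f z) z"
    using Cons.IH by (intro partial_deriv_cong_open[OF assms(1) Cons.prems])
  also have "\<dots> = prod_list bs * (deriv ^^ Suc (length bs)) f z * b"
    by (rule partial_deriv_eqI[OF D])
  finally show ?case by (simp add: algebra_simps)
qed simp

lemma holomorphic_imp_smooth_on:
  assumes "open U" "f holomorphic_on U"
  shows "smooth_on U f"
  unfolding smooth_on_def differentiable_on_def
proof (intro ballI)
  fix bs z assume z: "z \<in> U"
  have "(\<lambda>z. prod_list bs * (deriv ^^ length bs) f z) holomorphic_on U"
    by (intro holomorphic_intros assms)
  then have "(\<lambda>z. prod_list bs * (deriv ^^ length bs) f z) differentiable (at z)"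
    using assms(1) z
    by (meson field_differentiable_imp_differentiable holomorphic_on_imp_differentiable_at)
  then obtain D where "((\<lambda>z. prod_list bs * (deriv ^^ length bs) f z) has_derivative D) (at z)"
    unfolding differentiable_def by blast
  then have "(partial_derivs bs f has_derivative D) (at z)"
    by (rule has_derivative_transform_within_open[OF _ assms(1) z])
      (simp add: partial_derivs_holomorphic[OF assms])
  then have "partial_derivs bs f differentiable (at z)"
    by (rule differentiableI)
  then show "partial_derivs bs f differentiable (at z within U)"
    by (rule differentiable_at_withinI)
qed

lemma smooth_on_UNIV_differentiable:
  "smooth_on UNIV f \<Longrightarrow> bs \<in> lists Basis \<Longrightarrow> partial_derivs bs f differentiable (at x)"
  by (auto simp: smooth_on_def differentiable_on_def)

lemma smooth_on_UNIV_has_derivative: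
  fixes f :: "complex \<Rightarrow> real"
  assumes "smooth_on UNIV f" "bs \<in> lists Basis"
  shows "(partial_derivs bs f has_derivative
    (\<lambda>v. Re v * partial_derivs (1 # bs) f x + Im v * partial_derivs (\<i> # bs) f x)) (at x)"
proof -
  let ?D = "frechet_derivative (partial_derivs bs f) (at x)"
  have D: "(partial_derivs bs f has_derivative ?D) (at x)"
    using smooth_on_UNIV_differentiable[OF assms] frechet_derivative_works by blast
  then interpret linear ?D by (rule has_derivative_linear)
  have "?D v = Re v * ?D 1 + Im v * ?D \<i>" for v
  proof -
    have "?D v = ?D (Re v *\<^sub>R 1 + Im v *\<^sub>R \<i>)"
      by (rule arg_cong[where f = ?D]) (simp add: complex_eq_iff)
    also have "\<dots> = Re v * ?D 1 + Im v * ?D \<i>"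
      by (simp only: add scaleR) simp
    finally show ?thesis .
  qed
  then have "?D = (\<lambda>v. Re v * partial_derivs (1 # bs) f x + Im v * partial_derivs (\<i> # bs) f x)"
    unfolding partial_derivs_Cons partial_deriv_def by (rule ext)
  with D show ?thesis by (simp only:)
qed

lemma partial_derivs_linear:
  assumes "smooth_on UNIV f" "smooth_on UNIV g" "bs \<in> lists Basis"
  shows "partial_derivs bs (\<lambda>x. a * f x + b * g x)
    = (\<lambda>x. a * partial_derivs bs f x + b * partial_derivs bs g x :: real)"
  using assms(3)
proof (induction bs)
  case (Cons c bs)
  show ?case
  proof
    fix x
    have bs: "bs \<in> lists Basis"
      using Cons.hyps by simp
    have "(partial_derivs bs f has_derivative frechet_derivative (partial_derivs bs f) (at x)) (at x)"
      "(partial_derivs bs g has_derivative frechet_derivative (partial_derivs bs g) (at x)) (at x)"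
      unfolding frechet_derivative_works[symmetric]
      by (rule smooth_on_UNIV_differentiable[OF _ bs], rule assms)+
    then have "((\<lambda>x. a * partial_derivs bs f x + b * partial_derivs bs g x) has_derivative
      (\<lambda>v. a * frechet_derivative (partial_derivs bs f) (at x) v
         + b * frechet_derivative (partial_derivs bs g) (at x) v)) (at x)"
      by (intro has_derivative_add has_derivative_mult_right)
    then show "partial_derivs (c # bs) (\<lambda>x. a * f x + b * g x) x
       = a * partial_derivs (c # bs) f x + b * partial_derivs (c # bs) g x"
      using Cons.IH by (simp add: partial_deriv_def[of c "partial_derivs bs _"] partial_deriv_eqI)
  qed
qed simp

section \<open>Seminorms and estimates by finitely many of them\<close>

lemma schwartz_functions_smooth: "f \<in> schwartz_functions \<Longrightarrow> smooth_on UNIV f"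
  by (simp add: schwartz_functions_def)

lemma schwartz_seminorm_bdd_above:
  assumes "f \<in> schwartz_functions" "bs \<in> lists Basis"
  shows "bdd_above (range (\<lambda>x. (1 + norm x) ^ k * \<bar>partial_derivs bs f x\<bar>))"
proof -
  obtain B where "\<And>x. \<bar>(1 + norm x) ^ k * partial_derivs bs f x\<bar> \<le> B"
    using assms unfolding schwartz_functions_def bounded_iff by fastforce
  then show ?thesis
    by (intro bdd_aboveI[where M = B]) (auto simp: abs_mult)
qed

lemma schwartz_seminorm_upper:
  assumes "f \<in> schwartz_functions" "bs \<in> lists Basis"
  shows "(1 + norm x) ^ k * \<bar>partial_derivs bs f x\<bar> \<le> schwartz_seminorm k bs f"
  unfolding schwartz_seminorm_def
  by (rule cSUP_upper[OF UNIV_I schwartz_seminorm_bdd_above[OF assms]])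

lemma schwartz_seminorm_nonneg:
  assumes "f \<in> schwartz_functions" "bs \<in> lists Basis"
  shows "0 \<le> schwartz_seminorm k bs f"
  using schwartz_seminorm_upper[OF assms, of 0 k] by (rule order_trans[rotated]) simp

lemma schwartz_seminorm_least:
  assumes "\<And>x. (1 + norm x) ^ k * \<bar>partial_derivs bs f x\<bar> \<le> B"
  shows "schwartz_seminorm k bs f \<le> B"
  unfolding schwartz_seminorm_def using assms by (intro cSUP_least) auto

lemma schwartz_functions_linear:
  assumes "f \<in> schwartz_functions" "g \<in> schwartz_functions"
  shows "(\<lambda>x. a * f x + b * g x) \<in> schwartz_functions"
proof -
  have sm: "smooth_on UNIV f" "smooth_on UNIV g" using assms by (auto simp: schwartz_functions_smooth)
  have "smooth_on UNIV (\<lambda>x. a * f x + b * g x)"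
    unfolding smooth_on_def
    by (auto simp: partial_derivs_linear[OF sm] differentiable_on_def
        intro!: derivative_intros smooth_on_UNIV_differentiable[OF sm(1)] smooth_on_UNIV_differentiable[OF sm(2)])
  moreover have "bounded (range (\<lambda>x. (1 + norm x) ^ k * partial_derivs bs (\<lambda>x. a * f x + b * g x) x))"
    if bs: "bs \<in> lists Basis" for k bs
  proof -
    have "bounded (range (\<lambda>x. a * ((1 + norm x) ^ k * partial_derivs bs f x)
        + b * ((1 + norm x) ^ k * partial_derivs bs g x)))"
    proof (rule bounded_plus_comp)
      have "bounded ((*) c ` range (\<lambda>x. (1 + norm x) ^ k * partial_derivs bs h x))"
        if "h \<in> schwartz_functions" for c and h :: "'a \<Rightarrow> real"
        using that bs unfolding schwartz_functions_def
        by (intro bounded_linear_image[OF _ bounded_linear_mult_right]) auto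
      from this[OF assms(1), of a] this[OF assms(2), of b]
      show "bounded (range (\<lambda>x. a * ((1 + norm x) ^ k * partial_derivs bs f x)))"
        "bounded (range (\<lambda>x. b * ((1 + norm x) ^ k * partial_derivs bs g x)))"
        by (simp_all add: image_image)
    qed
    also have "(\<lambda>x. a * ((1 + norm x) ^ k * partial_derivs bs f x)
        + b * ((1 + norm x) ^ k * partial_derivs bs g x))
      = (\<lambda>x. (1 + norm x) ^ k * partial_derivs bs (\<lambda>x. a * f x + b * g x) x)"
      unfolding partial_derivs_linear[OF sm bs] by (simp add: distrib_left mult.left_commute)
    finally show ?thesis .
  qed
  ultimately show ?thesis by (auto simp: schwartz_functions_def)
qed

lemma schwartz_functions_diff:
  assumes "f \<in> schwartz_functions" "g \<in> schwartz_functions"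
  shows "(\<lambda>x. f x - g x) \<in> schwartz_functions"
  using schwartz_functions_linear[OF assms, of 1 "-1"] by simp

lemma schwartz_functions_on_linear:
  assumes "f \<in> schwartz_functions_on U" "g \<in> schwartz_functions_on U"
  shows "(\<lambda>x. a * f x + b * g x) \<in> schwartz_functions_on U"
proof -
  have "smooth_on UNIV f" "smooth_on UNIV g"
    using assms by (auto simp: schwartz_functions_on_def schwartz_functions_smooth)
  then show ?thesis
    using assms by (auto simp: schwartz_functions_on_def schwartz_functions_linear partial_derivs_linear)
qed

lemma schwartz_seminorm_diff_triangle:
  assumes "f \<in> schwartz_functions" "g \<in> schwartz_functions" "h \<in> schwartz_functions" "bs \<in> lists Basis"
  shows "schwartz_seminorm k bs (\<lambda>x. f x - h x)
    \<le> schwartz_seminorm k bs (\<lambda>x. f x - g x) + schwartz_seminorm k bs (\<lambda>x. g x - h x)"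
proof (rule schwartz_seminorm_least)
  fix x
  have sm: "smooth_on UNIV f" "smooth_on UNIV g" "smooth_on UNIV h"
    using assms by (auto simp: schwartz_functions_smooth)
  have *: "partial_derivs bs (\<lambda>x. f x - h x) = (\<lambda>x. partial_derivs bs f x - partial_derivs bs h x)"
    if "smooth_on UNIV f" "smooth_on UNIV h" for f h :: "'a \<Rightarrow> real"
    using partial_derivs_linear[OF that assms(4), of 1 "-1"] by simp
  have "(1 + norm x) ^ k * \<bar>partial_derivs bs (\<lambda>x. f x - h x) x\<bar>
    \<le> (1 + norm x) ^ k * (\<bar>partial_derivs bs (\<lambda>x. f x - g x) x\<bar> + \<bar>partial_derivs bs (\<lambda>x. g x - h x) x\<bar>)"
    by (intro mult_left_mono) (auto simp: * sm)
  also have "\<dots> \<le> schwartz_seminorm k bs (\<lambda>x. f x - g x) + schwartz_seminorm k bs (\<lambda>x. g x - h x)"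
    unfolding distrib_left
    by (intro add_mono schwartz_seminorm_upper schwartz_functions_diff assms)
  finally show "(1 + norm x) ^ k * \<bar>partial_derivs bs (\<lambda>x. f x - h x) x\<bar> \<le> \<dots>" .
qed

text \<open>The continuity estimate of locally convex spaces, with the same \<open>M\<close> and
  \<open>F\<close> at all points of \<open>X\<close>. For a fixed \<open>s\<close> it gives
  finiteness of a supremum; its uniformity in \<open>s\<close> gives continuity of the
  pullback.\<close>

definition seminorm_dominated ::
    "'a::euclidean_space set \<Rightarrow> 'b set \<Rightarrow> (('a \<Rightarrow> real) \<Rightarrow> 'b \<Rightarrow> real) \<Rightarrow> bool"
  where "seminorm_dominated V X q \<longleftrightarrow> (\<exists>M F. finite F \<and> F \<subseteq> UNIV \<times> lists Basis \<and> 0 \<le> M \<and>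
    (\<forall>s\<in>schwartz_functions_on V. \<forall>z\<in>X. q s z \<le> M * (\<Sum>(k, bs)\<in>F. schwartz_seminorm k bs s)))"

lemma sum_schwartz_seminorm_nonneg:
  assumes "s \<in> schwartz_functions" "F \<subseteq> UNIV \<times> lists Basis"
  shows "0 \<le> (\<Sum>(k, bs)\<in>F. schwartz_seminorm k bs s)"
  using assms by (intro sum_nonneg) (auto intro!: schwartz_seminorm_nonneg)

lemma seminorm_dominated_partial_derivs:
  assumes "bs \<in> lists Basis"
  shows "seminorm_dominated V X (\<lambda>s z. (1 + norm z) ^ k * \<bar>partial_derivs bs s z\<bar>)"
  unfolding seminorm_dominated_def
  by (rule exI[where x = 1], rule exI[where x = "{(k, bs)}"])
    (use assms in \<open>auto simp: schwartz_functions_on_def schwartz_seminorm_upper\<close>)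

text \<open>The comparison point \<open>y\<close> may differ from \<open>z\<close> and lie in
  another set: \<open>y = \<phi> z\<close> carries an estimate from the target domain to the
  source.\<close>

lemma seminorm_dominated_mono:
  assumes "seminorm_dominated V X q"
    and "\<And>s z. s \<in> schwartz_functions_on V \<Longrightarrow> z \<in> Y \<Longrightarrow> \<exists>y\<in>X. p s z \<le> q s y"
  shows "seminorm_dominated V Y p"
proof -
  obtain M F where "finite F" "F \<subseteq> UNIV \<times> lists Basis" "0 \<le> M"
    "\<And>s z. s \<in> schwartz_functions_on V \<Longrightarrow> z \<in> X \<Longrightarrow> q s z \<le> M * (\<Sum>(k, bs)\<in>F. schwartz_seminorm k bs s)"
    using assms(1) unfolding seminorm_dominated_def by auto
  then show ?thesis
    unfolding seminorm_dominated_def using assms(2)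
    by (intro exI[of _ M] exI[of _ F]) (meson order_trans)
qed

lemma seminorm_dominated_cmult:
  assumes "seminorm_dominated V X q" "0 \<le> c"
  shows "seminorm_dominated V X (\<lambda>s z. c * q s z)"
proof -
  obtain M F where "finite F" "F \<subseteq> UNIV \<times> lists Basis" "0 \<le> M"
    "\<And>s z. s \<in> schwartz_functions_on V \<Longrightarrow> z \<in> X \<Longrightarrow> q s z \<le> M * (\<Sum>(k, bs)\<in>F. schwartz_seminorm k bs s)"
    using assms(1) unfolding seminorm_dominated_def by auto
  then show ?thesis
    unfolding seminorm_dominated_def using assms(2)
    by (intro exI[of _ "c * M"] exI[of _ F]) (auto simp: mult.assoc mult_left_mono)
qed

lemma seminorm_dominated_add:
  assumes "seminorm_dominated V X p" "seminorm_dominated V X q"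
  shows "seminorm_dominated V X (\<lambda>s z. p s z + q s z)"
proof -
  obtain M F where 1: "finite F" "F \<subseteq> UNIV \<times> lists Basis" "0 \<le> M"
    "\<And>s z. s \<in> schwartz_functions_on V \<Longrightarrow> z \<in> X \<Longrightarrow> p s z \<le> M * (\<Sum>(k, bs)\<in>F. schwartz_seminorm k bs s)"
    using assms(1) unfolding seminorm_dominated_def by auto
  obtain N G where 2: "finite G" "G \<subseteq> UNIV \<times> lists Basis" "0 \<le> N"
    "\<And>s z. s \<in> schwartz_functions_on V \<Longrightarrow> z \<in> X \<Longrightarrow> q s z \<le> N * (\<Sum>(k, bs)\<in>G. schwartz_seminorm k bs s)"
    using assms(2) unfolding seminorm_dominated_def by auto
  have "p s z + q s z \<le> (M + N) * (\<Sum>(k, bs)\<in>F \<union> G. schwartz_seminorm k bs s)"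
    if s: "s \<in> schwartz_functions_on V" "z \<in> X" for s z
  proof -
    have s': "s \<in> schwartz_functions" using s by (simp add: schwartz_functions_on_def)
    have "(\<Sum>(k, bs)\<in>H. schwartz_seminorm k bs s) \<le> (\<Sum>(k, bs)\<in>F \<union> G. schwartz_seminorm k bs s)"
      if "H \<subseteq> F \<union> G" for H
      using 1 2 that s' by (intro sum_mono2) (auto intro!: schwartz_seminorm_nonneg)
    from this[of F] this[of G] 1(4)[OF s] 2(4)[OF s] 1(3) 2(3) show ?thesis
      by (smt (verit) distrib_right mult_left_mono Un_upper1 Un_upper2)
  qed
  with 1 2 show ?thesis
    unfolding seminorm_dominated_def
    by (intro exI[of _ "M + N"] exI[of _ "F \<union> G"]) auto
qed

section \<open>The boundary weight and the flatness of Schwartz functions\<close>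

definition boundary_weight :: "complex set \<Rightarrow> complex \<Rightarrow> real"
  where "boundary_weight U z = (1 + norm z) * (1 + 1 / infdist z (- U))"

text \<open>The convention \<open>1 / 0 = 0\<close> makes the second factor of the weight
  \<open>1\<close> off \<open>U\<close>, so the bounds hold at every point of the plane.\<close>

lemma boundary_weight_ge:
  shows "1 \<le> boundary_weight U z" "1 + norm z \<le> boundary_weight U z"
    "1 / infdist z (- U) \<le> boundary_weight U z"
proof -
  have d: "0 \<le> 1 / infdist z (- U)" by (simp add: infdist_nonneg)
  then have "1 + norm z + 1 / infdist z (- U) \<le> boundary_weight U z"
    unfolding boundary_weight_def using mult_nonneg_nonneg[OF norm_ge_zero[of z] d]
    by (simp only: distrib_left distrib_right)
  with d show "1 \<le> boundary_weight U z" "1 + norm z \<le> boundary_weight U z"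
    "1 / infdist z (- U) \<le> boundary_weight U z"
    using norm_ge_zero[of z] by linarith+
qed

lemma infdist_compl_pos:
  assumes "open U" "U \<noteq> UNIV" "z \<in> U"
  shows "0 < infdist z (- U)"
  using assms by (metis Compl_UNIV_eq Compl_eq_Compl_iff Compl_iff closed_Compl
      double_complement in_closed_iff_infdist_zero infdist_nonneg less_eq_real_def)

text \<open>Induction on \<open>m\<close> in place of a Taylor formula of order \<open>m\<close>:
  one more power of the distance costs one derivative, by the mean value inequality on the segment
  to a nearest point of the complement. Distance at most 1 keeps \<open>1 + norm\<close> comparable
  along the segment.\<close>

lemma flat_estimate_near_boundary:
  fixes V :: "complex set"
  assumes V: "open V" "V \<noteq> UNIV" and "bs \<in> lists Basis"
  shows "seminorm_dominated V {z \<in> V. infdist z (- V) \<le> 1}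
    (\<lambda>s z. (1 + norm z) ^ k / infdist z (- V) ^ m * \<bar>partial_derivs bs s z\<bar>)"
  using \<open>bs \<in> lists Basis\<close>
proof (induction m arbitrary: bs rule: nat_induct)
  case 0
  then show ?case by (simp add: seminorm_dominated_partial_derivs)
next
  case (Suc m)
  define X where "X = {z \<in> V. infdist z (- V) \<le> 1}"
  define q where "q c s z = (1 + norm z) ^ k / infdist z (- V) ^ m * \<bar>partial_derivs (c # bs) s z\<bar>"
    for c s z
  have "seminorm_dominated V X (q 1)" "seminorm_dominated V X (q \<i>)"
    unfolding q_def X_def by (rule Suc.IH; use Suc.prems in \<open>simp add: Basis_complex_def\<close>)+
  then have "seminorm_dominated V X (\<lambda>s z. q 1 s z + q \<i> s z)"
    by (rule seminorm_dominated_add)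
  then obtain M F where MF: "finite F" "F \<subseteq> UNIV \<times> lists Basis" "0 \<le> M"
    "\<And>s z. s \<in> schwartz_functions_on V \<Longrightarrow> z \<in> X
       \<Longrightarrow> q 1 s z + q \<i> s z \<le> M * (\<Sum>(k, bs)\<in>F. schwartz_seminorm k bs s)"
    unfolding seminorm_dominated_def by auto
  have "(1 + norm w) ^ k / infdist w (- V) ^ Suc m * \<bar>partial_derivs bs s w\<bar>
      \<le> (2 ^ k * M) * (\<Sum>(k, bs)\<in>F. schwartz_seminorm k bs s)"
    if s: "s \<in> schwartz_functions_on V" and w: "w \<in> X" for s w
  proof -
    define \<sigma> where "\<sigma> = (\<Sum>(k, bs)\<in>F. schwartz_seminorm k bs s)"
    define d where "d = infdist w (- V)"
    have sm: "smooth_on UNIV s" and s': "s \<in> schwartz_functions"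
      using s by (auto simp: schwartz_functions_on_def schwartz_functions_smooth)
    have \<sigma>: "0 \<le> \<sigma>"
      unfolding \<sigma>_def using s' MF by (intro sum_schwartz_seminorm_nonneg)
    have d: "0 < d" "d \<le> 1"
      using w infdist_compl_pos[OF V] by (auto simp: X_def d_def)
    have "closed (- V)" "- V \<noteq> {}" using V by auto
    then obtain w0 where w0: "w0 \<in> - V" "d = dist w w0"
      unfolding d_def using infdist_attains_inf by metis
    \<comment> \<open>Bound for the gradient of \<open>partial_derivs bs s\<close> on the segment:
      the induction hypothesis with \<open>infdist p (- V) \<le> d\<close>, and \<open>2 ^ k\<close>
      from \<open>1 + norm w \<le> 2 * (1 + norm p)\<close>.\<close>
    define B where "B = 2 ^ k * d ^ m * M * \<sigma> / (1 + norm w) ^ k"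
    have B0: "0 \<le> B" unfolding B_def using d MF(3) \<sigma> by simp
    have pB: "\<bar>partial_derivs (1 # bs) s p\<bar> + \<bar>partial_derivs (\<i> # bs) s p\<bar> \<le> B"
      if p: "p \<in> closed_segment w0 w" for p
    proof (cases "p \<in> V")
      \<comment> \<open>Covers the endpoint \<open>w0\<close>, where all derivatives of
        \<open>s\<close> vanish.\<close>
      case False
      then show ?thesis
        using s B0 Suc.prems by (simp add: schwartz_functions_on_def Basis_complex_def del: partial_derivs_Cons)
    next
      case True
      have pd: "dist p w0 \<le> d" "dist p w \<le> d"
        using p w0(2) segment_bound[of p w0 w] segment_bound[of w0 w p]
        by (auto simp: dist_norm norm_minus_commute)
      have dp: "infdist p (- V) \<le> d"
        using infdist_le[OF w0(1), of p] pd by simp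
      have pX: "p \<in> X" using True dp d by (simp add: X_def)
      have dp0: "0 < infdist p (- V)" by (rule infdist_compl_pos[OF V True])
      have "norm w \<le> norm p + dist p w"
        by (metis dist_commute dist_norm norm_triangle_sub)
      then have "1 + norm w \<le> 2 * (1 + norm p)"
        using pd d norm_ge_zero[of p] by argo
      then have nw: "(1 + norm w) ^ k \<le> 2 ^ k * (1 + norm p) ^ k"
        by (metis power_mono power_mult_distrib add_nonneg_nonneg norm_ge_zero zero_le_one)
      let ?a = "\<bar>partial_derivs (1 # bs) s p\<bar> + \<bar>partial_derivs (\<i> # bs) s p\<bar>"
      have "(1 + norm p) ^ k / infdist p (- V) ^ m * ?a \<le> M * \<sigma>"
        using MF(4)[OF s pX] unfolding q_def \<sigma>_def by (simp only: distrib_left)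
      then have "(1 + norm p) ^ k * ?a \<le> M * \<sigma> * infdist p (- V) ^ m"
        using dp0 by (simp add: field_simps)
      also have "\<dots> \<le> M * \<sigma> * d ^ m"
        using dp dp0 MF(3) \<sigma> by (intro mult_left_mono power_mono) auto
      finally have "2 ^ k * ((1 + norm p) ^ k * ?a) \<le> 2 ^ k * (M * \<sigma> * d ^ m)"
        by simp
      moreover have "(1 + norm w) ^ k * ?a \<le> 2 ^ k * (1 + norm p) ^ k * ?a"
        using nw by (intro mult_right_mono) auto
      ultimately have "(1 + norm w) ^ k * ?a \<le> 2 ^ k * (M * \<sigma> * d ^ m)"
        by (simp only: mult.assoc)
      moreover have "0 < (1 + norm w) ^ k"
        by (intro zero_less_power add_pos_nonneg) auto
      ultimately show ?thesis
        unfolding B_def by (simp add: pos_le_divide_eq mult_ac)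
    qed
    have "norm (partial_derivs bs s w - partial_derivs bs s w0) \<le> B * norm (w - w0)"
    proof (rule differentiable_bound[OF convex_closed_segment])
      fix p assume p: "p \<in> closed_segment w0 w"
      let ?D = "\<lambda>v. Re v * partial_derivs (1 # bs) s p + Im v * partial_derivs (\<i> # bs) s p"
      show "(partial_derivs bs s has_derivative ?D) (at p within closed_segment w0 w)"
        using smooth_on_UNIV_has_derivative[OF sm Suc.prems] has_derivative_at_withinI by blast
      show "onorm ?D \<le> B"
      proof (rule onorm_le)
        fix v
        have "norm (?D v) \<le> \<bar>Re v\<bar> * \<bar>partial_derivs (1 # bs) s p\<bar> + \<bar>Im v\<bar> * \<bar>partial_derivs (\<i> # bs) s p\<bar>"
          by (simp add: abs_mult[symmetric] del: partial_derivs_Cons)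
        also have "\<dots> \<le> norm v * \<bar>partial_derivs (1 # bs) s p\<bar> + norm v * \<bar>partial_derivs (\<i> # bs) s p\<bar>"
          by (intro add_mono mult_right_mono abs_Re_le_cmod abs_Im_le_cmod) auto
        also have "\<dots> \<le> B * norm v"
          using mult_left_mono[OF pB[OF p] norm_ge_zero[of v]] by (simp only: distrib_left mult.commute[of B])
        finally show "norm (?D v) \<le> B * norm v" .
      qed
    qed auto
    moreover have "partial_derivs bs s w0 = 0"
      using s w0 Suc.prems by (auto simp: schwartz_functions_on_def)
    ultimately have "\<bar>partial_derivs bs s w\<bar> \<le> B * d"
      using w0(2) by (simp add: dist_norm)
    then have "(1 + norm w) ^ k * \<bar>partial_derivs bs s w\<bar> \<le> (1 + norm w) ^ k * (B * d)"
      by (intro mult_left_mono) auto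
    also have "\<dots> = 2 ^ k * M * \<sigma> * d ^ Suc m"
    proof -
      have "(1 + norm w) ^ k \<noteq> 0"
        by (metis add_pos_nonneg norm_ge_zero power_not_zero less_irrefl zero_less_one)
      then show ?thesis unfolding B_def by simp
    qed
    finally show ?thesis
      using d unfolding \<sigma>_def[symmetric] d_def[symmetric] by (simp add: field_simps)
  qed
  then show ?case
    unfolding seminorm_dominated_def X_def[symmetric] using MF
    by (intro exI[of _ "2 ^ k * M"] exI[of _ F]) auto
qed

text \<open>With \<open>d\<close> the distance to the complement,
  \<open>1 + 1 / d \<le> 2 / d\<close> for \<open>d \<le> 1\<close>, while
  \<open>1 + 1 / d \<le> 2\<close> otherwise, where a Schwartz seminorm suffices.\<close>

lemma flat_estimate:
  assumes V: "open V" "V \<noteq> UNIV" and bs: "bs \<in> lists Basis"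
  shows "seminorm_dominated V V (\<lambda>s z. boundary_weight V z ^ m * \<bar>partial_derivs bs s z\<bar>)"
proof -
  \<comment> \<open>Set to 0 away from the boundary, so that it can be added to the other estimate
    on all of \<open>V\<close>.\<close>
  define p where "p s z = (if infdist z (- V) \<le> 1
    then (1 + norm z) ^ m / infdist z (- V) ^ m * \<bar>partial_derivs bs s z\<bar> else 0)" for s z
  have "seminorm_dominated V V (\<lambda>s z. (1 + norm z) ^ m * \<bar>partial_derivs bs s z\<bar>)"
    by (rule seminorm_dominated_partial_derivs[OF bs])
  moreover have "seminorm_dominated V V p"
  proof -
    obtain M F where MF: "finite F" "F \<subseteq> UNIV \<times> lists Basis" "0 \<le> M"
      "\<And>s z. s \<in> schwartz_functions_on V \<Longrightarrow> z \<in> V \<Longrightarrow> infdist z (- V) \<le> 1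
         \<Longrightarrow> (1 + norm z) ^ m / infdist z (- V) ^ m * \<bar>partial_derivs bs s z\<bar>
              \<le> M * (\<Sum>(k, bs)\<in>F. schwartz_seminorm k bs s)"
      using flat_estimate_near_boundary[OF V bs, of m m] unfolding seminorm_dominated_def by auto
    moreover have "0 \<le> M * (\<Sum>(k, bs)\<in>F. schwartz_seminorm k bs s)" if "s \<in> schwartz_functions_on V" for s
      using that MF by (intro mult_nonneg_nonneg sum_schwartz_seminorm_nonneg) (auto simp: schwartz_functions_on_def)
    ultimately show ?thesis
      unfolding seminorm_dominated_def p_def by (intro exI[of _ M] exI[of _ F]) auto
  qed
  ultimately have "seminorm_dominated V V
      (\<lambda>s z. (1 + norm z) ^ m * \<bar>partial_derivs bs s z\<bar> + p s z)"
    by (rule seminorm_dominated_add)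
  then have "seminorm_dominated V V
      (\<lambda>s z. 2 ^ m * ((1 + norm z) ^ m * \<bar>partial_derivs bs s z\<bar> + p s z))"
    by (rule seminorm_dominated_cmult) simp
  then show ?thesis
  proof (rule seminorm_dominated_mono)
    fix s z assume z: "z \<in> V"
    let ?d = "infdist z (- V)"
    have d: "0 < ?d" by (rule infdist_compl_pos[OF V z])
    have "boundary_weight V z ^ m * \<bar>partial_derivs bs s z\<bar>
      \<le> 2 ^ m * ((1 + norm z) ^ m * \<bar>partial_derivs bs s z\<bar> + p s z)"
    proof (cases "?d \<le> 1")
      case True
      have "boundary_weight V z \<le> 2 * ((1 + norm z) / ?d)"
      proof -
        have "1 + 1 / ?d \<le> 2 / ?d" using d True by (simp add: field_simps)
        then have "(1 + norm z) * (1 + 1 / ?d) \<le> (1 + norm z) * (2 / ?d)"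
          by (intro mult_left_mono) auto
        then show ?thesis by (simp add: boundary_weight_def field_simps)
      qed
      then have "boundary_weight V z ^ m \<le> (2 * ((1 + norm z) / ?d)) ^ m"
        using boundary_weight_ge(1)[of V z] by (intro power_mono) auto
      also have "\<dots> = 2 ^ m * ((1 + norm z) ^ m / ?d ^ m)"
        by (simp only: power_mult_distrib power_divide)
      finally have "boundary_weight V z ^ m * \<bar>partial_derivs bs s z\<bar>
          \<le> 2 ^ m * ((1 + norm z) ^ m / ?d ^ m) * \<bar>partial_derivs bs s z\<bar>"
        by (intro mult_right_mono) auto
      also have "\<dots> = 2 ^ m * p s z" using True by (simp add: p_def)
      also have "\<dots> \<le> 2 ^ m * ((1 + norm z) ^ m * \<bar>partial_derivs bs s z\<bar> + p s z)"
        by (intro mult_left_mono) auto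
      finally show ?thesis .
    next
      case False
      then have "boundary_weight V z \<le> (1 + norm z) * 2"
        unfolding boundary_weight_def by (intro mult_left_mono) (auto simp: field_simps)
      then have "boundary_weight V z ^ m \<le> ((1 + norm z) * 2) ^ m"
        using boundary_weight_ge(1)[of V z] by (intro power_mono) auto
      then have "boundary_weight V z ^ m * \<bar>partial_derivs bs s z\<bar>
          \<le> ((1 + norm z) * 2) ^ m * \<bar>partial_derivs bs s z\<bar>"
        by (intro mult_right_mono) auto
      with False show ?thesis by (simp only: p_def power_mult_distrib) (simp add: mult_ac)
    qed
    with z show "\<exists>y\<in>V. boundary_weight V z ^ m * \<bar>partial_derivs bs s z\<bar>
      \<le> 2 ^ m * ((1 + norm y) ^ m * \<bar>partial_derivs bs s y\<bar> + p s y)" by blast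
  qed
qed

section \<open>Coefficients of moderate growth\<close>

definition moderate_on :: "complex set \<Rightarrow> (complex \<Rightarrow> 'a::real_normed_vector) \<Rightarrow> bool"
  where "moderate_on U g \<longleftrightarrow> (\<exists>C N. 0 \<le> C \<and> (\<forall>z\<in>U. norm (g z) \<le> C * boundary_weight U z ^ N))"

lemma moderate_on_mult:
  fixes f g :: "complex \<Rightarrow> 'a::real_normed_algebra"
  assumes "moderate_on U f" "moderate_on U g"
  shows "moderate_on U (\<lambda>z. f z * g z)"
proof -
  obtain C N where 1: "0 \<le> C" "\<And>z. z \<in> U \<Longrightarrow> norm (f z) \<le> C * boundary_weight U z ^ N"
    using assms(1) unfolding moderate_on_def by auto
  obtain D M where 2: "0 \<le> D" "\<And>z. z \<in> U \<Longrightarrow> norm (g z) \<le> D * boundary_weight U z ^ M"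
    using assms(2) unfolding moderate_on_def by auto
  have "norm (f z * g z) \<le> (C * D) * boundary_weight U z ^ (N + M)" if "z \<in> U" for z
  proof -
    have "norm (f z * g z) \<le> norm (f z) * norm (g z)" by (rule norm_mult_ineq)
    also have "\<dots> \<le> (C * boundary_weight U z ^ N) * (D * boundary_weight U z ^ M)"
      using 1 2 that boundary_weight_ge(1)[of U z] by (intro mult_mono) auto
    finally show ?thesis by (simp add: power_add mult_ac)
  qed
  with 1 2 show ?thesis unfolding moderate_on_def
    by (intro exI[of _ "C * D"] exI[of _ "N + M"]) auto
qed

lemma moderate_on_add:
  assumes "moderate_on U f" "moderate_on U g"
  shows "moderate_on U (\<lambda>z. f z + g z)"
proof -
  obtain C N where 1: "0 \<le> C" "\<And>z. z \<in> U \<Longrightarrow> norm (f z) \<le> C * boundary_weight U z ^ N"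
    using assms(1) unfolding moderate_on_def by auto
  obtain D M where 2: "0 \<le> D" "\<And>z. z \<in> U \<Longrightarrow> norm (g z) \<le> D * boundary_weight U z ^ M"
    using assms(2) unfolding moderate_on_def by auto
  have "norm (f z + g z) \<le> (C + D) * boundary_weight U z ^ (N + M)" if "z \<in> U" for z
  proof -
    have "norm (f z + g z) \<le> norm (f z) + norm (g z)" by (rule norm_triangle_ineq)
    also have "\<dots> \<le> C * boundary_weight U z ^ N + D * boundary_weight U z ^ M"
      using 1 2 that by (intro add_mono) auto
    also have "\<dots> \<le> C * boundary_weight U z ^ (N + M) + D * boundary_weight U z ^ (N + M)"
      using 1(1) 2(1) boundary_weight_ge(1)[of U z]
      by (intro add_mono mult_left_mono power_increasing) auto
    finally show ?thesis by (simp add: distrib_right)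
  qed
  with 1 2 show ?thesis unfolding moderate_on_def
    by (intro exI[of _ "C + D"] exI[of _ "N + M"]) auto
qed

lemma moderate_on_const: "moderate_on U (\<lambda>z. c)"
  unfolding moderate_on_def by (intro exI[of _ "norm c"] exI[of _ 0]) auto

text \<open>Cauchy's inequality on the disc about \<open>z\<close> of half the distance to the
  complement, on which the weight exceeds its value at \<open>z\<close> by at most the factor
  \<open>K\<close>.\<close>

lemma moderate_on_deriv:
  assumes U: "open U" "U \<noteq> UNIV" and g: "g holomorphic_on U" "moderate_on U g"
  shows "moderate_on U (deriv g)"
proof -
  obtain C N where C: "0 \<le> C" "\<And>z. z \<in> U \<Longrightarrow> norm (g z) \<le> C * boundary_weight U z ^ N"
    using g(2) unfolding moderate_on_def by auto
  obtain a where a: "a \<in> - U" using U by auto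
  \<comment> \<open>The factor 2 comes from halving the distance, \<open>2 + norm a\<close> from
    \<open>norm p \<le> norm z + d / 2\<close> and \<open>d \<le> norm z + norm a\<close>.\<close>
  define K where "K = 2 * (2 + norm a)"
  have K: "1 \<le> K" unfolding K_def using norm_ge_zero[of a] by simp
  have "norm (deriv g z) \<le> 2 * C * K ^ N * boundary_weight U z ^ Suc N" if z: "z \<in> U" for z
  proof -
    define d where "d = infdist z (- U)"
    have d: "0 < d" unfolding d_def by (rule infdist_compl_pos[OF U z])
    have da: "d \<le> norm z + norm a"
      unfolding d_def using infdist_le[OF a, of z]
      by (smt (verit) dist_norm norm_triangle_ineq4)
    have pd: "d / 2 \<le> infdist p (- U)" if "dist z p \<le> d / 2" for p
      using infdist_triangle[of z "- U" p] that by (simp add: d_def)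
    have pU: "p \<in> U" if "dist z p \<le> d / 2" for p
      using pd[OF that] d infdist_zero[of p "- U"] by (cases "p \<in> U") auto
    have sub: "cball z (d / 2) \<subseteq> U" using pU by auto
    have "norm ((deriv ^^ 1) g z) \<le> fact 1 * (C * (K * boundary_weight U z) ^ N) / (d / 2) ^ 1"
    proof (rule Cauchy_inequality)
      show "g holomorphic_on ball z (d / 2)"
        using sub g(1) ball_subset_cball holomorphic_on_subset by (metis order_trans)
      show "continuous_on (cball z (d / 2)) g"
        using sub g(1) holomorphic_on_imp_continuous_on continuous_on_subset by blast
      show "0 < d / 2" using d by simp
      fix p assume "norm (z - p) = d / 2"
      then have p: "dist z p \<le> d / 2" by (simp add: dist_norm)
      have "norm p \<le> norm z + dist z p"
        by (metis dist_norm dist_commute norm_triangle_sub)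
      then have "1 + norm p \<le> 1 + norm z + (norm z + norm a) / 2"
        using p da by argo
      also have "\<dots> \<le> (2 + norm a) * (1 + norm z)"
        using norm_ge_zero[of z] norm_ge_zero[of a] mult_nonneg_nonneg[OF norm_ge_zero[of a] norm_ge_zero[of z]]
        by (simp add: distrib_left distrib_right)
      finally have 1: "1 + norm p \<le> (2 + norm a) * (1 + norm z)" .
      have "1 / infdist p (- U) \<le> 1 / (d / 2)"
        using pd[OF p] d by (intro divide_left_mono) auto
      then have 2: "1 + 1 / infdist p (- U) \<le> 2 * (1 + 1 / d)" by simp
      have "boundary_weight U p \<le> ((2 + norm a) * (1 + norm z)) * (2 * (1 + 1 / d))"
        unfolding boundary_weight_def using 1 2 by (intro mult_mono) (auto simp: infdist_nonneg)
      also have "\<dots> = K * boundary_weight U z"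
        by (simp only: K_def boundary_weight_def d_def mult_ac)
      finally have "boundary_weight U p ^ N \<le> (K * boundary_weight U z) ^ N"
        using boundary_weight_ge(1)[of U p] by (intro power_mono) auto
      then show "norm (g p) \<le> C * (K * boundary_weight U z) ^ N"
        using C(2)[OF pU[OF p]] C(1) by (meson mult_left_mono order_trans)
    qed
    then have "norm (deriv g z) \<le> 2 * (C * (K * boundary_weight U z) ^ N) * (1 / d)"
      by (simp add: field_simps)
    also have "\<dots> \<le> 2 * (C * (K * boundary_weight U z) ^ N) * boundary_weight U z"
      using boundary_weight_ge(1)[of U z] boundary_weight_ge(3)[of z U] C(1) K
      by (intro mult_left_mono mult_nonneg_nonneg) (auto simp: d_def)
    finally show ?thesis by (simp add: power_mult_distrib mult_ac)
  qed
  then show ?thesis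
    unfolding moderate_on_def using C(1) K
    by (intro exI[of _ "2 * C * K ^ N"] exI[of _ "Suc N"]) auto
qed

text \<open>Holomorphic generators make this algebra closed under partial derivatives, because for
  them moderate growth passes to derivatives. Imaginary parts occur as
  \<open>Re (- \<i> * g z)\<close>.\<close>

inductive_set moderate_coeffs :: "complex set \<Rightarrow> (complex \<Rightarrow> real) set" for U where
  Re: "g holomorphic_on U \<Longrightarrow> moderate_on U g \<Longrightarrow> (\<lambda>z. Re (g z)) \<in> moderate_coeffs U"
| add: "h \<in> moderate_coeffs U \<Longrightarrow> k \<in> moderate_coeffs U \<Longrightarrow> (\<lambda>z. h z + k z) \<in> moderate_coeffs U"
| mult: "h \<in> moderate_coeffs U \<Longrightarrow> k \<in> moderate_coeffs U \<Longrightarrow> (\<lambda>z. h z * k z) \<in> moderate_coeffs U"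

lemma moderate_coeffs_moderate_on: "h \<in> moderate_coeffs U \<Longrightarrow> moderate_on U h"
proof (induction rule: moderate_coeffs.induct)
  case (Re g)
  then show ?case
    unfolding moderate_on_def real_norm_def by (meson abs_Re_le_cmod order_trans)
qed (auto intro: moderate_on_add moderate_on_mult)

text \<open>The differential of \<open>Re g\<close> is
  \<open>v \<mapsto> Re (deriv g z * v)\<close>, so its value at \<open>b\<close> is again a
  generator; sums and products follow by the Leibniz rule.\<close>

lemma moderate_coeffs_derivative:
  assumes U: "open U" "U \<noteq> UNIV" and "h \<in> moderate_coeffs U"
  shows "\<exists>k\<in>moderate_coeffs U. \<forall>z\<in>U. \<exists>D. (h has_derivative D) (at z) \<and> D b = k z"
  using assms(3)
proof (induction rule: moderate_coeffs.induct)
  case (Re g)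
  have "((\<lambda>z. Re (g z)) has_derivative (\<lambda>v. Re (deriv g z * v))) (at z)" if "z \<in> U" for z
    using holomorphic_derivI[OF Re(1) U(1) that]
    unfolding has_field_derivative_def by (rule bounded_linear.has_derivative[OF bounded_linear_Re])
  moreover have "(\<lambda>z. Re (deriv g z * b)) \<in> moderate_coeffs U"
    using Re U by (intro moderate_coeffs.Re holomorphic_intros moderate_on_mult moderate_on_deriv
        moderate_on_const) auto
  ultimately show ?case
    by (intro bexI[of _ "\<lambda>z. Re (deriv g z * b)"]) blast+
next
  case (add h k)
  then obtain h' k' where hk: "h' \<in> moderate_coeffs U" "k' \<in> moderate_coeffs U"
    "\<And>z. z \<in> U \<Longrightarrow> \<exists>D. (h has_derivative D) (at z) \<and> D b = h' z"
    "\<And>z. z \<in> U \<Longrightarrow> \<exists>D. (k has_derivative D) (at z) \<and> D b = k' z" by blast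
  have "\<exists>D. ((\<lambda>z. h z + k z) has_derivative D) (at z) \<and> D b = h' z + k' z" if z: "z \<in> U" for z
  proof -
    from hk(3,4)[OF z] obtain D E where "(h has_derivative D) (at z)" "D b = h' z"
      "(k has_derivative E) (at z)" "E b = k' z" by blast
    then show ?thesis by (intro exI[of _ "\<lambda>v. D v + E v"]) (simp add: has_derivative_add)
  qed
  then show ?case using moderate_coeffs.add[OF hk(1,2)] by (rule_tac bexI) auto
next
  case (mult h k)
  then obtain h' k' where hk: "h' \<in> moderate_coeffs U" "k' \<in> moderate_coeffs U"
    "\<And>z. z \<in> U \<Longrightarrow> \<exists>D. (h has_derivative D) (at z) \<and> D b = h' z"
    "\<And>z. z \<in> U \<Longrightarrow> \<exists>D. (k has_derivative D) (at z) \<and> D b = k' z" by blast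
  have "\<exists>D. ((\<lambda>z. h z * k z) has_derivative D) (at z) \<and> D b = h z * k' z + h' z * k z"
    if z: "z \<in> U" for z
  proof -
    from hk(3,4)[OF z] obtain D E where "(h has_derivative D) (at z)" "D b = h' z"
      "(k has_derivative E) (at z)" "E b = k' z" by blast
    then show ?thesis
      by (intro exI[of _ "\<lambda>v. h z * E v + D v * k z"]) (simp add: has_derivative_mult)
  qed
  then show ?case
    using moderate_coeffs.add[OF moderate_coeffs.mult[OF mult(1) hk(2)] moderate_coeffs.mult[OF hk(1) mult(2)]]
    by (rule_tac bexI) auto
qed

text \<open>The differential operators arising as derivatives of the pullback \<open>s \<mapsto> s \<circ> \<phi>\<close>.\<close>

inductive_set pullback_ops ::
    "complex set \<Rightarrow> (complex \<Rightarrow> complex) \<Rightarrow> ((complex \<Rightarrow> real) \<Rightarrow> (complex \<Rightarrow> real)) set"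
  for U \<phi> where
  base: "h \<in> moderate_coeffs U \<Longrightarrow> bs \<in> lists Basis \<Longrightarrow>
    (\<lambda>s z. if z \<in> U then h z * partial_derivs bs s (\<phi> z) else 0) \<in> pullback_ops U \<phi>"
| add: "P \<in> pullback_ops U \<phi> \<Longrightarrow> Q \<in> pullback_ops U \<phi> \<Longrightarrow> (\<lambda>s z. P s z + Q s z) \<in> pullback_ops U \<phi>"

lemma pullback_ops_outside: "P \<in> pullback_ops U \<phi> \<Longrightarrow> z \<notin> U \<Longrightarrow> P s z = 0"
  by (induction rule: pullback_ops.induct) auto

lemma boundary_weight_power_mono:
  assumes "0 \<le> C" "boundary_weight U z \<le> C * boundary_weight V w ^ N"
  shows "boundary_weight U z ^ m \<le> C ^ m * boundary_weight V w ^ (N * m)"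
proof -
  have "boundary_weight U z ^ m \<le> (C * boundary_weight V w ^ N) ^ m"
    using assms boundary_weight_ge(1)[of U z] by (intro power_mono) auto
  then show ?thesis by (simp add: power_mult_distrib power_mult)
qed

text \<open>A moderate coefficient only raises the exponent of the weight of \<open>U\<close>; the
  comparison of weights turns this into a power of the weight of \<open>V\<close> at
  \<open>\<phi> z\<close>, which \<open>flat_estimate\<close> absorbs.\<close>

lemma seminorm_dominated_pullback_ops:
  assumes V: "open V" "V \<noteq> UNIV" and \<phi>: "\<phi> ` U \<subseteq> V"
    and C: "0 \<le> C" "\<forall>z\<in>U. boundary_weight U z \<le> C * boundary_weight V (\<phi> z) ^ N"
    and P: "P \<in> pullback_ops U \<phi>"
  shows "seminorm_dominated V U (\<lambda>s z. boundary_weight U z ^ m * \<bar>P s z\<bar>)"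
  using P
proof (induction rule: pullback_ops.induct)
  case (base h bs)
  obtain D M where D: "0 \<le> D" "\<And>z. z \<in> U \<Longrightarrow> norm (h z) \<le> D * boundary_weight U z ^ M"
    using moderate_coeffs_moderate_on[OF base(1)] unfolding moderate_on_def by auto
  have "seminorm_dominated V V (\<lambda>s z. D * C ^ (m + M) *
      (boundary_weight V z ^ (N * (m + M)) * \<bar>partial_derivs bs s z\<bar>))"
    using C D by (intro seminorm_dominated_cmult flat_estimate V base) auto
  then show ?case
  proof (rule seminorm_dominated_mono)
    fix s :: "complex \<Rightarrow> real" and z assume z: "z \<in> U"
    let ?t = "\<bar>partial_derivs bs s (\<phi> z)\<bar>"
    have "boundary_weight U z ^ m * \<bar>h z * partial_derivs bs s (\<phi> z)\<bar>
      = boundary_weight U z ^ m * \<bar>h z\<bar> * ?t" by (simp add: abs_mult)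
    also have "\<dots> \<le> boundary_weight U z ^ m * (D * boundary_weight U z ^ M) * ?t"
      using D(2)[OF z] boundary_weight_ge(1)[of U z]
      by (intro mult_right_mono mult_left_mono) auto
    also have "\<dots> = D * boundary_weight U z ^ (m + M) * ?t" by (simp add: power_add)
    also have "\<dots> \<le> D * (C ^ (m + M) * boundary_weight V (\<phi> z) ^ (N * (m + M))) * ?t"
      using D C z by (intro mult_right_mono mult_left_mono boundary_weight_power_mono) auto
    finally show "\<exists>y\<in>V. boundary_weight U z ^ m * \<bar>if z \<in> U then h z * partial_derivs bs s (\<phi> z) else 0\<bar>
      \<le> D * C ^ (m + M) * (boundary_weight V y ^ (N * (m + M)) * \<bar>partial_derivs bs s y\<bar>)"
      using z \<phi> by (intro bexI[of _ "\<phi> z"]) (auto simp: mult_ac)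
  qed
next
  case (add P Q)
  from seminorm_dominated_add[OF add(3,4)] show ?case
  proof (rule seminorm_dominated_mono)
    fix s z assume z: "z \<in> U"
    have "boundary_weight U z ^ m * \<bar>P s z + Q s z\<bar>
        \<le> boundary_weight U z ^ m * (\<bar>P s z\<bar> + \<bar>Q s z\<bar>)"
      using boundary_weight_ge(1)[of U z] by (intro mult_left_mono) auto
    with z show "\<exists>y\<in>U. boundary_weight U z ^ m * \<bar>P s z + Q s z\<bar>
        \<le> boundary_weight U y ^ m * \<bar>P s y\<bar> + boundary_weight U y ^ m * \<bar>Q s y\<bar>"
      by (auto simp: distrib_left)
  qed
qed

text \<open>Chain rule for the coefficients and for \<open>s\<close> at \<open>\<phi> z\<close>.
  \<open>Q\<close> is chosen before \<open>s\<close>, which keeps the later bounds uniform in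
  \<open>s\<close>.\<close>

lemma pullback_ops_derivative_inside:
  assumes U: "open U" "U \<noteq> UNIV" and \<phi>: "\<phi> holomorphic_on U" "moderate_on U \<phi>"
    and P: "P \<in> pullback_ops U \<phi>" and b: "b \<in> Basis"
  shows "\<exists>Q\<in>pullback_ops U \<phi>. \<forall>s. smooth_on UNIV s \<longrightarrow>
    (\<forall>z\<in>U. P s differentiable (at z) \<and> partial_deriv b (P s) z = Q s z)"
  using P
proof (induction rule: pullback_ops.induct)
  case (base h bs)
  obtain k where k: "k \<in> moderate_coeffs U"
    "\<And>z. z \<in> U \<Longrightarrow> \<exists>D. (h has_derivative D) (at z) \<and> D b = k z"
    using moderate_coeffs_derivative[OF U base(1), of b] by auto
  define h1 where "h1 z = h z * Re (deriv \<phi> z * b)" for z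
  \<comment> \<open>The coefficient of the derivative of \<open>s\<close> along \<open>\<i>\<close>
    is \<open>Im (deriv \<phi> z * b)\<close>, written as a real part to stay among the
    generators.\<close>
  define h2 where "h2 z = h z * Re (deriv \<phi> z * (- \<i> * b))" for z
  have h12: "h1 \<in> moderate_coeffs U" "h2 \<in> moderate_coeffs U"
    unfolding h1_def[abs_def] h2_def[abs_def] using base U \<phi>
    by (intro moderate_coeffs.mult moderate_coeffs.Re holomorphic_intros moderate_on_mult
        moderate_on_deriv moderate_on_const; simp)+
  define Q where "Q = (\<lambda>s z. (if z \<in> U then h1 z * partial_derivs (1 # bs) s (\<phi> z) else 0)
    + ((if z \<in> U then h2 z * partial_derivs (\<i> # bs) s (\<phi> z) else 0)
    + (if z \<in> U then k z * partial_derivs bs s (\<phi> z) else 0)))"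
  have bs: "1 # bs \<in> lists Basis" "\<i> # bs \<in> lists Basis"
    using base(2) by (auto simp: Basis_complex_def)
  have "Q \<in> pullback_ops U \<phi>"
    unfolding Q_def by (intro pullback_ops.add pullback_ops.base h12 k bs base)
  moreover have "(\<lambda>z. if z \<in> U then h z * partial_derivs bs s (\<phi> z) else 0) differentiable (at z)
      \<and> partial_deriv b (\<lambda>z. if z \<in> U then h z * partial_derivs bs s (\<phi> z) else 0) z = Q s z"
    if s: "smooth_on UNIV s" and z: "z \<in> U" for s :: "complex \<Rightarrow> real" and z
  proof -
    let ?F = "\<lambda>z. if z \<in> U then h z * partial_derivs bs s (\<phi> z) else 0"
    let ?Ds = "\<lambda>v. Re v * partial_derivs (1 # bs) s (\<phi> z) + Im v * partial_derivs (\<i> # bs) s (\<phi> z)"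
    have "(\<phi> has_derivative (\<lambda>v. deriv \<phi> z * v)) (at z)"
      using holomorphic_derivI[OF \<phi>(1) U(1) z] by (simp add: has_field_derivative_def)
    from has_derivative_compose[OF this smooth_on_UNIV_has_derivative[OF s base(2)]]
    have "((\<lambda>z. partial_derivs bs s (\<phi> z)) has_derivative (\<lambda>v. ?Ds (deriv \<phi> z * v))) (at z)" .
    moreover obtain Dh where Dh: "(h has_derivative Dh) (at z)" "Dh b = k z"
      using k(2)[OF z] by blast
    ultimately have "((\<lambda>z. h z * partial_derivs bs s (\<phi> z)) has_derivative
        (\<lambda>v. h z * ?Ds (deriv \<phi> z * v) + Dh v * partial_derivs bs s (\<phi> z))) (at z)"
      by (intro has_derivative_mult)
    then have D: "(?F has_derivative
        (\<lambda>v. h z * ?Ds (deriv \<phi> z * v) + Dh v * partial_derivs bs s (\<phi> z))) (at z)"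
      by (rule has_derivative_transform_within_open[OF _ U(1) z]) simp
    have "partial_deriv b ?F z = h z * ?Ds (deriv \<phi> z * b) + k z * partial_derivs bs s (\<phi> z)"
      using partial_deriv_eqI[OF D, of b] Dh(2) by simp
    also have "\<dots> = Q s z"
    proof -
      have "Re (deriv \<phi> z * (- \<i> * b)) = Im (deriv \<phi> z * b)" by simp
      then show ?thesis
        using z by (simp only: Q_def h1_def h2_def if_True distrib_left mult.assoc add.assoc)
    qed
    finally show ?thesis using D differentiableI by blast
  qed
  ultimately show ?case by blast
next
  case (add P R)
  then obtain P' R' where *: "P' \<in> pullback_ops U \<phi>" "R' \<in> pullback_ops U \<phi>"
    "\<And>s z. smooth_on UNIV s \<Longrightarrow> z \<in> U \<Longrightarrow> P s differentiable (at z) \<and> partial_deriv b (P s) z = P' s z"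
    "\<And>s z. smooth_on UNIV s \<Longrightarrow> z \<in> U \<Longrightarrow> R s differentiable (at z) \<and> partial_deriv b (R s) z = R' s z"
    by blast
  have "(\<lambda>z. P s z + R s z) differentiable (at z)
      \<and> partial_deriv b (\<lambda>z. P s z + R s z) z = P' s z + R' s z"
    if "smooth_on UNIV s" "z \<in> U" for s z
  proof -
    have D: "((\<lambda>z. P s z + R s z) has_derivative
        (\<lambda>v. frechet_derivative (P s) (at z) v + frechet_derivative (R s) (at z) v)) (at z)"
      using *(3,4)[OF that] by (intro has_derivative_add) (auto simp: frechet_derivative_works)
    then show ?thesis
      using partial_deriv_eqI[OF D, of b] *(3,4)[OF that] differentiableI
      by (auto simp: partial_deriv_def)
  qed
  then show ?case using pullback_ops.add[OF *(1,2)] by (rule_tac bexI) auto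
qed

lemma has_derivative_zero_of_quadratic_bound:
  fixes f :: "'a::real_normed_vector \<Rightarrow> real"
  assumes "f z = 0" "\<And>y. \<bar>f y\<bar> \<le> B * (norm (y - z))\<^sup>2"
  shows "(f has_derivative (\<lambda>_. 0)) (at z)"
proof (rule has_derivativeI_sandwich[of 1 _ _ _ _ "\<lambda>y. B * norm (y - z)"])
  show "((\<lambda>y. B * norm (y - z)) \<longlongrightarrow> 0) (at z)"
    by (auto intro!: tendsto_eq_intros)
  fix y assume "y \<noteq> z"
  then have "\<bar>f y\<bar> / norm (y - z) \<le> B * norm (y - z)"
    using assms(2)[of y] by (simp add: divide_le_eq power2_eq_square mult.assoc)
  then show "norm (f y - f z - 0) / norm (y - z) \<le> B * norm (y - z)"
    using assms(1) by simp
qed auto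

text \<open>The second power of the weight bounds \<open>P s y\<close> by a multiple of the squared
  distance from \<open>y\<close> to the complement of \<open>U\<close>, hence of
  \<open>(norm (y - z))\<^sup>2\<close> for each \<open>z\<close> outside \<open>U\<close>. Thus the
  extension by zero is differentiable there, with derivative 0.\<close>

lemma pullback_ops_derivative:
  assumes U: "open U" "U \<noteq> UNIV" and V: "open V" "V \<noteq> UNIV"
    and \<phi>: "\<phi> holomorphic_on U" "moderate_on U \<phi>" "\<phi> ` U \<subseteq> V"
    and C: "0 \<le> C" "\<forall>z\<in>U. boundary_weight U z \<le> C * boundary_weight V (\<phi> z) ^ N"
    and P: "P \<in> pullback_ops U \<phi>" and b: "b \<in> Basis"
  shows "\<exists>Q\<in>pullback_ops U \<phi>. \<forall>s\<in>schwartz_functions_on V.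
    partial_deriv b (P s) = Q s \<and> (\<forall>z. P s differentiable (at z))"
proof -
  obtain Q where Q: "Q \<in> pullback_ops U \<phi>"
    "\<And>s z. smooth_on UNIV s \<Longrightarrow> z \<in> U \<Longrightarrow> P s differentiable (at z) \<and> partial_deriv b (P s) z = Q s z"
    using pullback_ops_derivative_inside[OF U \<phi>(1,2) P b] by blast
  obtain M F where MF: "F \<subseteq> UNIV \<times> lists Basis" "0 \<le> M"
    "\<And>s z. s \<in> schwartz_functions_on V \<Longrightarrow> z \<in> U
      \<Longrightarrow> boundary_weight U z ^ 2 * \<bar>P s z\<bar> \<le> M * (\<Sum>(k, bs)\<in>F. schwartz_seminorm k bs s)"
    using seminorm_dominated_pullback_ops[OF V \<phi>(3) C P, of 2] unfolding seminorm_dominated_def by auto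
  have "partial_deriv b (P s) z = Q s z \<and> P s differentiable (at z)"
    if s: "s \<in> schwartz_functions_on V" for s z
  proof (cases "z \<in> U")
    case True
    then show ?thesis using Q s by (auto simp: schwartz_functions_on_def schwartz_functions_smooth)
  next
    case False
    define B where "B = M * (\<Sum>(k, bs)\<in>F. schwartz_seminorm k bs s)"
    have B: "0 \<le> B"
      unfolding B_def using MF s
      by (intro mult_nonneg_nonneg sum_schwartz_seminorm_nonneg) (auto simp: schwartz_functions_on_def)
    have "\<bar>P s y\<bar> \<le> B * (norm (y - z))\<^sup>2" for y
    proof (cases "y \<in> U")
      case True
      let ?d = "infdist y (- U)"
      have d: "0 < ?d" "?d \<le> norm (y - z)"
        using infdist_compl_pos[OF U True] infdist_le[of z "- U" y] False by (auto simp: dist_norm)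
      have "(1 / ?d)\<^sup>2 \<le> boundary_weight U y ^ 2"
        using d boundary_weight_ge(3)[of y U] by (intro power_mono) auto
      then have "(1 / ?d)\<^sup>2 * \<bar>P s y\<bar> \<le> B"
        using MF(3)[OF s True] unfolding B_def by (meson abs_ge_zero mult_right_mono order_trans)
      then have "\<bar>P s y\<bar> \<le> B * ?d\<^sup>2" using d by (simp add: field_simps)
      also have "\<dots> \<le> B * (norm (y - z))\<^sup>2"
        using d B by (intro mult_left_mono power_mono) auto
      finally show ?thesis .
    qed (simp add: pullback_ops_outside[OF P] B)
    from has_derivative_zero_of_quadratic_bound[OF pullback_ops_outside[OF P False] this]
    have "(P s has_derivative (\<lambda>_. 0)) (at z)" .
    then show ?thesis
      using partial_deriv_eqI differentiableI pullback_ops_outside[OF Q(1) False] by metis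
  qed
  then show ?thesis using Q(1) by blast
qed

text \<open>One induction over \<open>bs\<close> keeps every derivative of the pullback in the class
  of operators, from which all three conclusions are read off.\<close>

lemma seminorm_dominated_pullback:
  assumes U: "open U" "U \<noteq> UNIV" and V: "open V" "V \<noteq> UNIV"
    and \<phi>: "\<phi> holomorphic_on U" "moderate_on U \<phi>" "\<phi> ` U \<subseteq> V"
    and C: "0 \<le> C" "\<forall>z\<in>U. boundary_weight U z \<le> C * boundary_weight V (\<phi> z) ^ N"
    and bs: "bs \<in> lists Basis"
  shows "seminorm_dominated V UNIV
      (\<lambda>s z. (1 + norm z) ^ k * \<bar>partial_derivs bs (schwartz_pullback U \<phi> s) z\<bar>)"
    and "s \<in> schwartz_functions_on V \<Longrightarrow>
      partial_derivs bs (schwartz_pullback U \<phi> s) differentiable (at z)"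
    and "s \<in> schwartz_functions_on V \<Longrightarrow> z \<notin> U \<Longrightarrow> partial_derivs bs (schwartz_pullback U \<phi> s) z = 0"
proof -
  note der = pullback_ops_derivative[OF U V \<phi> C]
  have "\<exists>P\<in>pullback_ops U \<phi>. \<forall>s\<in>schwartz_functions_on V.
      partial_derivs bs (schwartz_pullback U \<phi> s) = P s"
    using bs
  proof (induction bs)
    case Nil
    \<comment> \<open>The constant coefficient 1, in the form of a generator.\<close>
    have "(\<lambda>z. Re ((\<lambda>_. 1) z)) \<in> moderate_coeffs U"
      by (intro moderate_coeffs.Re holomorphic_on_const moderate_on_const)
    then have "(\<lambda>s z. if z \<in> U then Re ((\<lambda>_. 1) z) * partial_derivs [] s (\<phi> z) else 0) \<in> pullback_ops U \<phi>"
      by (rule pullback_ops.base) simp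
    then show ?case by (rule bexI[rotated]) (auto simp: schwartz_pullback_def)
  next
    case (Cons b bs)
    then obtain P where P: "P \<in> pullback_ops U \<phi>"
      "\<And>s. s \<in> schwartz_functions_on V \<Longrightarrow> partial_derivs bs (schwartz_pullback U \<phi> s) = P s" by auto
    from der[OF P(1) Cons.hyps(1)] obtain Q where "Q \<in> pullback_ops U \<phi>"
      "\<And>s. s \<in> schwartz_functions_on V \<Longrightarrow> partial_deriv b (P s) = Q s" by blast
    with P show ?case by auto
  qed
  then obtain P where P: "P \<in> pullback_ops U \<phi>"
    "\<And>s. s \<in> schwartz_functions_on V \<Longrightarrow> partial_derivs bs (schwartz_pullback U \<phi> s) = P s" by blast
  show "partial_derivs bs (schwartz_pullback U \<phi> s) differentiable (at z)"
    if "s \<in> schwartz_functions_on V"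
    using der[OF P(1), of 1] P(2)[OF that] that by (auto simp: Basis_complex_def)
  show "partial_derivs bs (schwartz_pullback U \<phi> s) z = 0"
    if "s \<in> schwartz_functions_on V" "z \<notin> U"
    using P that pullback_ops_outside by metis
  obtain M F where MF: "finite F" "F \<subseteq> UNIV \<times> lists Basis" "0 \<le> M"
    "\<And>s z. s \<in> schwartz_functions_on V \<Longrightarrow> z \<in> U
      \<Longrightarrow> boundary_weight U z ^ k * \<bar>P s z\<bar> \<le> M * (\<Sum>(k, bs)\<in>F. schwartz_seminorm k bs s)"
    using seminorm_dominated_pullback_ops[OF V \<phi>(3) C P(1), of k] unfolding seminorm_dominated_def by auto
  have "(1 + norm z) ^ k * \<bar>P s z\<bar> \<le> M * (\<Sum>(k, bs)\<in>F. schwartz_seminorm k bs s)"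
    if s: "s \<in> schwartz_functions_on V" for s z
  proof (cases "z \<in> U")
    case True
    have "(1 + norm z) ^ k * \<bar>P s z\<bar> \<le> boundary_weight U z ^ k * \<bar>P s z\<bar>"
      using boundary_weight_ge(2)[of z U] by (intro mult_right_mono power_mono) auto
    with MF(4)[OF s True] show ?thesis by linarith
  next
    case False
    have "0 \<le> (\<Sum>(k, bs)\<in>F. schwartz_seminorm k bs s)"
      using s MF by (intro sum_schwartz_seminorm_nonneg) (auto simp: schwartz_functions_on_def)
    with False MF(3) show ?thesis by (simp add: pullback_ops_outside[OF P(1)])
  qed
  with MF(1-3) P(2) show "seminorm_dominated V UNIV
      (\<lambda>s z. (1 + norm z) ^ k * \<bar>partial_derivs bs (schwartz_pullback U \<phi> s) z\<bar>)"
    unfolding seminorm_dominated_def by (intro exI[of _ M] exI[of _ F]) auto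
qed

lemma schwartz_pullback_mem:
  assumes U: "open U" "U \<noteq> UNIV" and V: "open V" "V \<noteq> UNIV"
    and \<phi>: "\<phi> holomorphic_on U" "moderate_on U \<phi>" "\<phi> ` U \<subseteq> V"
    and C: "0 \<le> C" "\<forall>z\<in>U. boundary_weight U z \<le> C * boundary_weight V (\<phi> z) ^ N"
    and s: "s \<in> schwartz_functions_on V"
  shows "schwartz_pullback U \<phi> s \<in> schwartz_functions_on U"
proof -
  note * = seminorm_dominated_pullback[OF U V \<phi> C]
  have "bounded (range (\<lambda>z. (1 + norm z) ^ k * partial_derivs bs (schwartz_pullback U \<phi> s) z))"
    if bs: "bs \<in> lists Basis" for k bs
  proof -
    obtain B where "\<And>z. (1 + norm z) ^ k * \<bar>partial_derivs bs (schwartz_pullback U \<phi> s) z\<bar> \<le> B"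
      using *(1)[OF bs, of k] s unfolding seminorm_dominated_def by blast
    then show ?thesis
      unfolding bounded_iff by (intro exI[of _ B]) (auto simp: abs_mult)
  qed
  with *(2,3) s show ?thesis
    by (auto simp: schwartz_functions_on_def schwartz_functions_def smooth_on_def differentiable_on_def)
qed

section \<open>Continuity of the pullback in the Schwartz topology\<close>

lemma topspace_schwartz_topology_on [simp]:
  "topspace (schwartz_topology_on U) = schwartz_functions_on U"
proof -
  have "f \<in> topspace schwartz_topology" if f: "f \<in> schwartz_functions" for f :: "'a \<Rightarrow> real"
  proof -
    have "partial_derivs [] (\<lambda>x. f x - f x) = (\<lambda>_. 0)" by simp
    then have "schwartz_seminorm 0 [] (\<lambda>x. f x - f x) < 1"
      by (simp add: schwartz_seminorm_def)
    with f show ?thesis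
      unfolding schwartz_topology_def topology_generated_by_topspace
      by (intro UnionI[of "{g \<in> schwartz_functions. schwartz_seminorm 0 [] (\<lambda>x. g x - f x) < 1}"])
        (force, simp)
  qed
  then show ?thesis
    by (auto simp: schwartz_topology_on_def schwartz_functions_on_def)
qed

lemma openin_schwartz_ball:
  assumes "f \<in> schwartz_functions" "bs \<in> lists Basis" "0 < e"
  shows "openin (schwartz_topology_on U)
    {g \<in> schwartz_functions_on U. schwartz_seminorm k bs (\<lambda>x. g x - f x) < e}"
proof -
  have "openin schwartz_topology {g \<in> schwartz_functions. schwartz_seminorm k bs (\<lambda>x. g x - f x) < e}"
    unfolding schwartz_topology_def
    by (rule topology_generated_by_Basis) (use assms in blast)
  then show ?thesis
    unfolding schwartz_topology_on_def openin_subtopology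
    by (intro exI[of _ "{g \<in> schwartz_functions. schwartz_seminorm k bs (\<lambda>x. g x - f x) < e}"])
      (auto simp: schwartz_functions_on_def)
qed

lemma schwartz_pullback_linear:
  "schwartz_pullback U \<phi> (\<lambda>x. a * f x + b * g x)
    = (\<lambda>x. a * schwartz_pullback U \<phi> f x + b * schwartz_pullback U \<phi> g x)"
  by (auto simp: schwartz_pullback_def)

text \<open>It suffices to treat preimages of subbasic seminorm balls; by linearity this is the
  domination estimate for the difference of \<open>s\<close> and \<open>s0\<close>.\<close>

lemma continuous_map_schwartz_pullback:
  assumes U: "open U" "U \<noteq> UNIV" and V: "open V" "V \<noteq> UNIV"
    and \<phi>: "\<phi> holomorphic_on U" "moderate_on U \<phi>" "\<phi> ` U \<subseteq> V"
    and C: "0 \<le> C" "\<forall>z\<in>U. boundary_weight U z \<le> C * boundary_weight V (\<phi> z) ^ N"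
  shows "continuous_map (schwartz_topology_on V) (schwartz_topology_on U) (schwartz_pullback U \<phi>)"
proof -
  let ?T = "schwartz_pullback U \<phi>"
  note mem = schwartz_pullback_mem[OF U V \<phi> C]
  have "continuous_map (schwartz_topology_on V) schwartz_topology ?T"
    unfolding schwartz_topology_def continuous_on_generated_topo_iff
  proof (intro conjI allI impI)
    have "?T ` topspace (schwartz_topology_on V) \<subseteq> topspace schwartz_topology"
      using mem topspace_schwartz_topology_on[of U] by (auto simp: schwartz_topology_on_def)
    then show "?T ` topspace (schwartz_topology_on V) \<subseteq>
      \<Union> {{g \<in> schwartz_functions. schwartz_seminorm k bs (\<lambda>x. g x - f x) < e} |f k bs e.
          f \<in> schwartz_functions \<and> bs \<in> lists Basis \<and> 0 < e}"
      unfolding schwartz_topology_def topology_generated_by_topspace .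
  next
    fix W :: "(complex \<Rightarrow> real) set"
    assume "W \<in> {{g \<in> schwartz_functions. schwartz_seminorm k bs (\<lambda>x. g x - f x) < e} |f k bs e.
          f \<in> schwartz_functions \<and> bs \<in> lists Basis \<and> (0::real) < e}"
    then obtain f k bs e where W: "W = {g \<in> schwartz_functions. schwartz_seminorm k bs (\<lambda>x. g x - f x) < e}"
      "f \<in> schwartz_functions" "bs \<in> lists Basis" by auto
    obtain M F where MF: "finite F" "F \<subseteq> UNIV \<times> lists Basis" "0 \<le> M"
      "\<And>s z. s \<in> schwartz_functions_on V \<Longrightarrow> (1 + norm z) ^ k * \<bar>partial_derivs bs (?T s) z\<bar>
          \<le> M * (\<Sum>(k, bs)\<in>F. schwartz_seminorm k bs s)"
      using seminorm_dominated_pullback(1)[OF U V \<phi> C W(3), of k] unfolding seminorm_dominated_def by auto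
    show "openin (schwartz_topology_on V) (?T -` W \<inter> topspace (schwartz_topology_on V))"
    proof (subst openin_subopen, intro ballI)
      fix s0 assume s0: "s0 \<in> ?T -` W \<inter> topspace (schwartz_topology_on V)"
      then have s0V: "s0 \<in> schwartz_functions_on V" by simp
      define \<delta> where "\<delta> = e - schwartz_seminorm k bs (\<lambda>x. ?T s0 x - f x)"
      \<comment> \<open>Chosen so that \<open>M * (card F * \<eta>) < \<delta>\<close>; the added
        ones keep the denominator positive for \<open>M = 0\<close> or empty \<open>F\<close> and
        the inequality strict.\<close>
      define \<eta> where "\<eta> = \<delta> / ((M + 1) * (card F + 1))"
      have \<delta>: "0 < \<delta>" using s0 by (simp add: W(1) \<delta>_def)
      then have \<eta>: "0 < \<eta>" unfolding \<eta>_def using MF(3) by (intro divide_pos_pos mult_pos_pos) auto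
      \<comment> \<open>The factor \<open>topspace\<close> covers empty \<open>F\<close>, for which
        the intersection is the set of all functions.\<close>
      define N where "N = topspace (schwartz_topology_on V) \<inter>
        (\<Inter>i\<in>F. {g \<in> schwartz_functions_on V. schwartz_seminorm (fst i) (snd i) (\<lambda>x. g x - s0 x) < \<eta>})"
      have s0S: "s0 \<in> schwartz_functions" using s0V by (simp add: schwartz_functions_on_def)
      have "openin (schwartz_topology_on V) N"
      proof -
        have "openin (schwartz_topology_on V)
            {g \<in> schwartz_functions_on V. schwartz_seminorm (fst i) (snd i) (\<lambda>x. g x - s0 x) < \<eta>}"
          if "i \<in> F" for i
          using that MF(2) s0S \<eta> by (intro openin_schwartz_ball) auto
        then show ?thesis
          unfolding N_def using MF(1) openin_topspace[of "schwartz_topology_on V"] by (cases "F = {}") (auto intro!: openin_Int openin_INT)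
      qed
      moreover have "s0 \<in> N"
      proof -
        have "schwartz_seminorm j cs (\<lambda>x. s0 x - s0 x) = 0" if "cs \<in> lists Basis" for j cs
        proof -
          have "partial_derivs cs (\<lambda>x. s0 x - s0 x) = (\<lambda>_. 0)"
            using partial_derivs_linear[of s0 s0 cs 1 "-1"] that s0S
            by (simp add: schwartz_functions_smooth)
          then show ?thesis by (simp add: schwartz_seminorm_def)
        qed
        with s0V \<eta> MF(2) show ?thesis unfolding N_def by fastforce
      qed
      moreover have "N \<subseteq> ?T -` W \<inter> topspace (schwartz_topology_on V)"
      proof
        fix s assume sN: "s \<in> N"
        then have sV: "s \<in> schwartz_functions_on V" by (simp add: N_def)
        have dV: "(\<lambda>x. s x - s0 x) \<in> schwartz_functions_on V"
          using schwartz_functions_on_linear[OF sV s0V, of 1 "-1"] by simp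
        have Teq: "?T (\<lambda>x. s x - s0 x) = (\<lambda>x. ?T s x - ?T s0 x)"
          using schwartz_pullback_linear[of U \<phi> 1 s "-1" s0] by simp
        have "(\<Sum>(k, bs)\<in>F. schwartz_seminorm k bs (\<lambda>x. s x - s0 x)) \<le> (\<Sum>i\<in>F. \<eta>)"
          using sN unfolding N_def by (intro sum_mono) (auto simp: less_imp_le split: prod.split)
        then have 1: "(\<Sum>(k, bs)\<in>F. schwartz_seminorm k bs (\<lambda>x. s x - s0 x)) \<le> card F * \<eta>" by simp
        have "schwartz_seminorm k bs (\<lambda>x. ?T s x - ?T s0 x) \<le> M * (card F * \<eta>)"
          using MF(4)[OF dV] mult_left_mono[OF 1 MF(3)] unfolding Teq
          by (intro schwartz_seminorm_least) (meson order_trans)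
        also have "\<dots> < (M + 1) * ((card F + 1) * \<eta>)"
        proof -
          have "M * (card F * \<eta>) \<le> M * ((card F + 1) * \<eta>)"
            using MF(3) \<eta> by (intro mult_left_mono mult_right_mono) auto
          moreover have "0 < (card F + 1) * \<eta>"
            using \<eta> by (intro mult_pos_pos) auto
          ultimately show ?thesis by (simp only: distrib_right[of M 1] mult_1)
        qed
        also have "\<dots> = \<delta>"
        proof -
          have "(M + 1) * (real (card F) + 1) \<noteq> 0" using MF(3) by simp
          then show ?thesis by (simp add: \<eta>_def mult.assoc[symmetric])
        qed
        finally have "schwartz_seminorm k bs (\<lambda>x. ?T s x - ?T s0 x) < \<delta>" .
        moreover have TS: "?T s \<in> schwartz_functions" "?T s0 \<in> schwartz_functions"
          using mem sV s0V by (auto simp: schwartz_functions_on_def)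
        ultimately have "schwartz_seminorm k bs (\<lambda>x. ?T s x - f x) < e"
          using schwartz_seminorm_diff_triangle[OF TS W(2,3), of k] by (simp add: \<delta>_def)
        with TS sV show "s \<in> ?T -` W \<inter> topspace (schwartz_topology_on V)"
          by (simp add: W(1))
      qed
      ultimately show "\<exists>N. openin (schwartz_topology_on V) N \<and> s0 \<in> N
          \<and> N \<subseteq> ?T -` W \<inter> topspace (schwartz_topology_on V)" by blast
    qed
  qed
  then show ?thesis
    unfolding schwartz_topology_on_def[of U]
    by (rule continuous_map_into_subtopology) (use mem in auto)
qed

text \<open>The weight inequalities are symmetric under exchange of \<open>\<phi>\<close> and
  \<open>\<psi>\<close>. As the weight dominates the modulus, they also give moderate growth of both
  maps.\<close>

lemma schwartz_equivalent_biholomorphic: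
  assumes U: "open U" "U \<noteq> UNIV" and V: "open V" "V \<noteq> UNIV"
    and hol: "\<phi> holomorphic_on U" "\<psi> holomorphic_on V"
    and inv: "\<And>z. z \<in> U \<Longrightarrow> \<phi> z \<in> V \<and> \<psi> (\<phi> z) = z" "\<And>w. w \<in> V \<Longrightarrow> \<psi> w \<in> U \<and> \<phi> (\<psi> w) = w"
    and C: "0 \<le> C" "\<And>z. z \<in> U \<Longrightarrow> boundary_weight U z \<le> C * boundary_weight V (\<phi> z) ^ N"
      "\<And>z. z \<in> U \<Longrightarrow> boundary_weight V (\<phi> z) \<le> C * boundary_weight U z ^ N"
  shows "schwartz_equivalent U V"
proof -
  have "norm (\<phi> z) \<le> C * boundary_weight U z ^ N" if "z \<in> U" for z
    using C(3)[OF that] boundary_weight_ge(2)[of "\<phi> z" V] by linarith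
  then have mod: "moderate_on U \<phi>" unfolding moderate_on_def using C(1) by blast
  have C': "boundary_weight V w \<le> C * boundary_weight U (\<psi> w) ^ N"
    "boundary_weight U (\<psi> w) \<le> C * boundary_weight V w ^ N" if "w \<in> V" for w
    using C(2,3)[of "\<psi> w"] inv(2)[OF that] by auto
  have "norm (\<psi> w) \<le> C * boundary_weight V w ^ N" if "w \<in> V" for w
    using C'(2)[OF that] boundary_weight_ge(2)[of "\<psi> w" U] by linarith
  then have mod': "moderate_on V \<psi>" unfolding moderate_on_def using C(1) by blast
  have im: "\<phi> ` U \<subseteq> V" "\<psi> ` V \<subseteq> U" using inv by auto
  have bij: "bij_betw \<phi> U V"
    by (rule bij_betw_byWitness[of _ \<psi>]) (use inv in auto)
  have "inv_into U \<phi> w = \<psi> w" if "w \<in> V" for w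
    using bij_betw_imp_inj_on[OF bij] inv(2)[OF that] by (metis inv_into_f_f)
  then have "inv_into U \<phi> holomorphic_on V"
    using hol(2) holomorphic_transform by metis
  then have "diffeomorphism_on U V \<phi>"
    unfolding diffeomorphism_on_def using bij hol U V by (auto intro: holomorphic_imp_smooth_on)
  moreover have "schwartz_isomorphism V U (schwartz_pullback U \<phi>)"
    unfolding schwartz_isomorphism_def
  proof (intro conjI ballI allI schwartz_pullback_linear)
    \<comment> \<open>Pulling back by \<open>\<phi>\<close> and \<open>\<psi>\<close> in turn yields
      an extension by zero, which equals \<open>s\<close> because \<open>s\<close> vanishes off its
      domain.\<close>
    have vanish: "s x = 0" if "s \<in> schwartz_functions_on X" "x \<notin> X" for s :: "complex \<Rightarrow> real" and x X
    proof -
      have "partial_derivs [] s x = 0"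
        using that unfolding schwartz_functions_on_def by blast
      then show ?thesis by simp
    qed
    have "homeomorphic_maps (schwartz_topology_on V) (schwartz_topology_on U)
        (schwartz_pullback U \<phi>) (schwartz_pullback V \<psi>)"
      unfolding homeomorphic_maps_def
    proof (intro conjI ballI)
      show "continuous_map (schwartz_topology_on V) (schwartz_topology_on U) (schwartz_pullback U \<phi>)"
        by (rule continuous_map_schwartz_pullback[OF U V hol(1) mod im(1) C(1)]) (use C(2) in blast)
      show "continuous_map (schwartz_topology_on U) (schwartz_topology_on V) (schwartz_pullback V \<psi>)"
        by (rule continuous_map_schwartz_pullback[OF V U hol(2) mod' im(2) C(1)]) (use C'(1) in blast)
    qed (use inv vanish in \<open>fastforce simp: schwartz_pullback_def fun_eq_iff\<close>)+
    then show "homeomorphic_map (schwartz_topology_on V) (schwartz_topology_on U) (schwartz_pullback U \<phi>)"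
      using homeomorphic_map_maps by blast
  qed
  ultimately show ?thesis
    unfolding schwartz_equivalent_def using U V by blast
qed

section \<open>Boundary decay from bounded turning\<close>

lemma Re_pos_of_norm_diff_one:
  assumes "norm (w - 1) < 1"
  shows "0 < Re w"
  using assms abs_Re_le_cmod[of "w - 1"] by auto

text \<open>The ratio \<open>(p - z) / (x - z)\<close> stays in the right half-plane, so its
  principal logarithm is continuous on \<open>S\<close>. Its discrepancy from
  \<open>f p - f x\<close> takes values in the discrete set of periods of \<open>exp\<close> and
  vanishes at \<open>x\<close>.\<close>

lemma logarithm_increment:
  fixes f :: "complex \<Rightarrow> complex"
  assumes "connected S" and f: "continuous_on S f" "\<And>p. p \<in> S \<Longrightarrow> exp (f p) = p - z"
    and xy: "x \<in> S" "y \<in> S" and near: "\<And>p. p \<in> S \<Longrightarrow> dist x p < dist x z"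
  shows "f y = f x + Ln ((y - z) / (x - z))"
proof -
  define h where "h p = f p - f x - Ln ((p - z) / (x - z))" for p
  have xz: "x - z \<noteq> 0" using near[OF xy(1)] by auto
  have Re: "0 < Re ((p - z) / (x - z))" if "p \<in> S" for p
  proof (rule Re_pos_of_norm_diff_one)
    have "(p - z) / (x - z) - 1 = (p - x) / (x - z)" using xz by (simp add: field_simps)
    moreover have "norm (p - x) < norm (x - z)"
      using near[OF that] by (simp add: dist_norm norm_minus_commute)
    ultimately show "norm ((p - z) / (x - z) - 1) < 1"
      using xz by (simp add: norm_divide)
  qed
  have "continuous_on S h"
  proof -
    have "(p - z) / (x - z) \<notin> \<real>\<^sub>\<le>\<^sub>0" if "p \<in> S" for p
      using Re[OF that] unfolding complex_nonpos_Reals_iff by linarith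
    then show ?thesis
      unfolding h_def using xz by (intro continuous_intros f) auto
  qed
  moreover have exp_h: "exp (h p) = 1" if "p \<in> S" for p
  proof -
    have "(p - z) / (x - z) \<noteq> 0" using Re[OF that] by auto
    then show ?thesis
      using f(2)[OF that] f(2)[OF xy(1)] xz by (simp add: h_def exp_diff)
  qed
  have "\<exists>e>0. \<forall>q. q \<in> S \<and> h q \<noteq> h p \<longrightarrow> e \<le> norm (h q - h p)" if "p \<in> S" for p
  proof (intro exI[of _ "2 * pi"] conjI allI impI)
    fix q assume q: "q \<in> S \<and> h q \<noteq> h p"
    then have "2 * pi \<le> \<bar>Im (h q) - Im (h p)\<bar>"
      using exp_complex_eqI[of "h q" "h p"] exp_h that by force
    also have "\<dots> \<le> norm (h q - h p)"
      using abs_Im_le_cmod[of "h q - h p"] by simp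
    finally show "2 * pi \<le> norm (h q - h p)" .
  qed simp
  ultimately have "h constant_on S"
    by (rule continuous_discrete_range_constant[OF \<open>connected S\<close>])
  then have "h y = h x" using xy unfolding constant_on_def by metis
  then show ?thesis using xz by (simp add: h_def algebra_simps)
qed

text \<open>The imaginary part of \<open>L\<close> is a continuous argument of \<open>q - z\<close>,
  so the direction map into the circle is null-homotopic; Borsuk's criterion then excludes a bounded
  component.\<close>

lemma unbounded_component_of_logarithm:
  fixes z :: complex
  assumes "compact N" "z \<notin> N" and L: "continuous_on N L" "\<And>q. q \<in> N \<Longrightarrow> exp (L q) = q - z"
  shows "\<not> bounded (connected_component_set (- N) z)"
proof -
  have "inverse (norm (q - z)) *\<^sub>R (q - z) = exp (\<i> * of_real (Im (L q)))" if "q \<in> N" for q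
  proof -
    have "exp (L q) = of_real (exp (Re (L q))) * exp (\<i> * of_real (Im (L q)))"
      by (metis exp_eq_polar cis_conv_exp)
    then have "q - z = exp (Re (L q)) *\<^sub>R exp (\<i> * of_real (Im (L q)))"
      unfolding L(2)[OF that] by (simp only: scaleR_conv_of_real)
    moreover have "norm (q - z) = exp (Re (L q))"
      using norm_exp_eq_Re[of "L q"] L(2)[OF that] by simp
    ultimately show ?thesis
      by (simp only: scaleR_scaleR left_inverse[OF exp_not_eq_zero] scaleR_one)
  qed
  moreover have "continuous_on N (\<lambda>q. Im (L q))" by (intro continuous_intros L)
  ultimately have "\<exists>a. homotopic_with_canon (\<lambda>h. True) N (sphere 0 1)
      (\<lambda>q. inverse (norm (q - z)) *\<^sub>R (q - z)) (\<lambda>t. a)"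
    unfolding inessential_eq_continuous_logarithm_circle by blast
  then show ?thesis
    unfolding Borsuk_map_essential_bounded_component[OF assms(1,2)] by blast
qed

text \<open>Bounded turning with a connected set in place of a subarc and distances from
  \<open>x\<close> in place of a diameter, the form in which \<open>logarithm_increment\<close> can
  use it.\<close>

definition connected_bounded_turning :: "'a::metric_space set \<Rightarrow> real \<Rightarrow> bool"
  where "connected_bounded_turning A K \<longleftrightarrow> (\<forall>x\<in>A. \<forall>y\<in>A. \<exists>S\<subseteq>A. connected S \<and> x \<in> S \<and> y \<in> S \<and>
    (\<forall>p\<in>S. dist x p \<le> K * dist x y))"

text \<open>A John-type condition: \<open>z\<close> can be joined to infinity along points \<open>q\<close> whose distance to \<open>A\<close>
  is comparable to their distance to \<open>z\<close>.  The logarithm of \<open>x - z\<close> extends from \<open>A\<close> to the set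
  where this fails, because nearby points of \<open>A\<close> are joined within \<open>A\<close> at the same scale; hence that
  set does not separate \<open>z\<close> from infinity.\<close>

lemma john_condition:
  fixes A :: "complex set"
  assumes A: "compact A" "contractible A" "A \<noteq> {}" and "z \<notin> A"
    and K: "1 \<le> K" "connected_bounded_turning A K"
  shows "\<not> bounded (connected_component_set {q. dist q z / (16 * K) < infdist q A} z)"
proof -
  \<comment> \<open>Let \<open>D = dist q z\<close>. Points \<open>q\<close>, \<open>r\<close> of
    \<open>N\<close> with \<open>dist q r < c * D\<close> have nearest points in \<open>A\<close> at
    distance at most \<open>4 * c * D\<close>. Bounded turning joins these within
    \<open>K * (4 * c * D) = D / 4\<close> of \<open>\<pi> q\<close>, whereas \<open>\<pi> q\<close>
    is at distance at least \<open>D / 2\<close> from \<open>z\<close>.\<close>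
  define c where "c = 1 / (16 * K)"
  have c: "0 < c" "c \<le> 1 / 16" "4 * c * K = 1 / 4" using K by (auto simp: c_def field_simps)
  obtain L0 where L0: "continuous_on A L0" "\<And>x. x \<in> A \<Longrightarrow> x - z = exp (L0 x)"
    by (rule continuous_logarithm_on_contractible[of A "\<lambda>x. x - z"])
      (use A \<open>z \<notin> A\<close> in \<open>auto intro!: continuous_intros\<close>)
  define N where "N = {q. infdist q A \<le> c * dist q z}"
  have "\<exists>x. x \<in> A \<and> infdist q A = dist q x" for q
    using infdist_attains_inf[of A q] A by (metis compact_imp_closed)
  \<comment> \<open>A mere choice of nearest points, which may jump; continuity of \<open>L\<close>
    below comes from the increment formula.\<close>
  then obtain \<pi> where \<pi>: "\<And>q. \<pi> q \<in> A" "\<And>q. infdist q A = dist q (\<pi> q)" by metis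
  have zN: "z \<notin> N"
    using A \<open>z \<notin> A\<close> \<pi>[of z] by (auto simp: N_def)
  have dN: "dist q (\<pi> q) \<le> c * dist q z" "0 < dist q z" if "q \<in> N" for q
    using that \<pi>(2)[of q] zN by (auto simp: N_def)
  have d1: "dist q z / 2 \<le> dist (\<pi> q) z" if "q \<in> N" for q
  proof -
    have "c * dist q z \<le> (1/16) * dist q z" using c dN(2)[OF that] by (intro mult_right_mono) auto
    then show ?thesis
      using dN[OF that] dist_triangle[of q z "\<pi> q"] by argo
  qed
  have ratio: "norm ((q - z) / (p - z) - 1) < 1" if "dist q p < dist p z" for q p
  proof -
    have pz: "p - z \<noteq> 0" using that by (auto simp: not_less)
    then have "(q - z) / (p - z) - 1 = (q - p) / (p - z)" by (simp add: field_simps)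
    then show ?thesis using that pz by (simp add: norm_divide dist_norm)
  qed
  define L where "L q = L0 (\<pi> q) + Ln ((q - z) / (\<pi> q - z))" for q
  have near: "dist q (\<pi> q) < dist (\<pi> q) z" if "q \<in> N" for q
  proof -
    have "c * dist q z \<le> (1/16) * dist q z" using c dN(2)[OF that] by (intro mult_right_mono) auto
    then show ?thesis using dN[OF that] d1[OF that] by argo
  qed
  have exp_L: "exp (L q) = q - z" if "q \<in> N" for q
  proof -
    have "\<pi> q - z \<noteq> 0" "q - z \<noteq> 0" using near[OF that] dN(2)[OF that] by auto
    then show ?thesis by (simp add: L_def exp_add L0(2)[OF \<pi>(1), symmetric])
  qed
  have incr: "L r = L q + Ln ((r - z) / (q - z))"
    if q: "q \<in> N" and r: "r \<in> N" and qr: "dist q r < c * dist q z" for q r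
  proof -
    define D where "D = dist q z"
    have D: "0 < D" using dN(2)[OF q] by (simp add: D_def)
    have cD: "c * D \<le> D / 16" using c D by (simp add: field_simps)
    have "dist r z \<le> 2 * D"
      using dist_triangle[of r z q] qr cD D unfolding D_def[symmetric] dist_commute[of r q] by linarith
    then have "dist r (\<pi> r) \<le> c * (2 * D)"
      using dN(1)[OF r] c by (meson mult_left_mono less_imp_le order_trans)
    moreover have "dist (\<pi> q) (\<pi> r) \<le> dist q (\<pi> q) + dist q r + dist r (\<pi> r)"
      using dist_triangle[of "\<pi> q" "\<pi> r" q] dist_triangle[of q "\<pi> r" r]
      by (simp add: dist_commute)
    ultimately have 1: "dist (\<pi> q) (\<pi> r) \<le> 4 * c * D"
      using dN(1)[OF q] qr unfolding D_def[symmetric] by linarith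
    obtain S where S: "S \<subseteq> A" "connected S" "\<pi> q \<in> S" "\<pi> r \<in> S"
      "\<And>p. p \<in> S \<Longrightarrow> dist (\<pi> q) p \<le> K * dist (\<pi> q) (\<pi> r)"
      using K(2) \<pi>(1) unfolding connected_bounded_turning_def by meson
    have S': "dist (\<pi> q) p < dist (\<pi> q) z" if "p \<in> S" for p
    proof -
      have "dist (\<pi> q) p \<le> K * (4 * c * D)"
        using S(5)[OF that] 1 K(1) by (meson mult_left_mono order_trans zero_le_one)
      also have "\<dots> = (4 * c * K) * D" by simp
      also have "\<dots> = D / 4" unfolding c(3) by simp
      finally show ?thesis using d1[OF q] D unfolding D_def[symmetric] by linarith
    qed
    have LL: "L0 (\<pi> r) = L0 (\<pi> q) + Ln ((\<pi> r - z) / (\<pi> q - z))"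
      by (rule logarithm_increment[OF S(2) continuous_on_subset[OF L0(1) S(1)] _ S(3,4) S'])
        (use L0(2) S(1) in auto)
    have nz: "\<pi> q - z \<noteq> 0" "\<pi> r - z \<noteq> 0" "q - z \<noteq> 0" "r - z \<noteq> 0"
      using near[OF q] near[OF r] dN(2)[OF q] dN(2)[OF r] by auto
    define a where "a = (\<pi> r - z) / (\<pi> q - z)"
    define b where "b = (r - z) / (\<pi> r - z)"
    define d where "d = (q - z) / (\<pi> q - z)"
    define e where "e = (r - z) / (q - z)"
    have pos: "0 < Re a" "0 < Re b" "0 < Re d" "0 < Re e"
    proof -
      show "0 < Re a" unfolding a_def
        using S'[OF S(4)] by (intro Re_pos_of_norm_diff_one ratio) (simp add: dist_commute)
      show "0 < Re b" "0 < Re d" unfolding b_def d_def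
        by (intro Re_pos_of_norm_diff_one ratio near q r)+
      show "0 < Re e" unfolding e_def
      proof (intro Re_pos_of_norm_diff_one ratio)
        show "dist r q < dist q z"
          using qr cD D unfolding D_def[symmetric] dist_commute[of r q] by linarith
      qed
    qed
    have ne: "a \<noteq> 0" "b \<noteq> 0" "d \<noteq> 0" "e \<noteq> 0" using pos by auto
    \<comment> \<open>Since \<open>a * b = d * e\<close>, the two sides can differ only by a period
      of \<open>exp\<close>; each logarithm has imaginary part below \<open>pi / 2\<close> in
      modulus, which leaves only the period 0.\<close>
    have "Ln a + Ln b = Ln d + Ln e"
    proof (rule exp_complex_eqI)
      show "\<bar>Im (Ln a + Ln b) - Im (Ln d + Ln e)\<bar> < 2 * pi"
        using Re_Ln_pos_lt[OF ne(1)] Re_Ln_pos_lt[OF ne(2)] Re_Ln_pos_lt[OF ne(3)] Re_Ln_pos_lt[OF ne(4)] pos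
        by (simp add: abs_less_iff) linarith
      show "exp (Ln a + Ln b) = exp (Ln d + Ln e)"
        using ne nz by (simp add: exp_add) (simp add: a_def b_def d_def e_def)
    qed
    then show ?thesis
      unfolding L_def LL a_def[symmetric] b_def[symmetric] d_def[symmetric] e_def[symmetric]
      by (simp add: add.assoc)
  qed
  have "continuous_on N L"
    unfolding continuous_on_eq_continuous_within
  proof
    fix q assume q: "q \<in> N"
    have nz: "q - z \<noteq> 0" using dN(2)[OF q] by auto
    show "continuous (at q within N) L"
    proof (rule continuous_transform_within)
      show "continuous (at q within N) (\<lambda>r. L q + Ln ((r - z) / (q - z)))"
        by (rule continuous_at_imp_continuous_at_within, intro continuous_intros isCont_Ln')
          (use nz in auto)
      show "0 < c * dist q z" using c dN(2)[OF q] by simp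
      show "L q + Ln ((r - z) / (q - z)) = L r" if "r \<in> N" "dist r q < c * dist q z" for r
        using incr[OF q that(1)] that(2) by (simp add: dist_commute)
    qed (rule q)
  qed
  moreover have "compact N"
    unfolding compact_eq_bounded_closed
  proof
    show "closed N" unfolding N_def by (intro closed_Collect_le continuous_intros)
    obtain M where M: "\<And>x. x \<in> A \<Longrightarrow> norm x \<le> M"
      using A(1) compact_imp_bounded bounded_iff by metis
    have "norm q \<le> 2 * M + norm z" if "q \<in> N" for q
    proof -
      have "norm q \<le> norm (\<pi> q) + dist q (\<pi> q)" by (metis dist_norm norm_triangle_sub add.commute)
      moreover have "dist q z \<le> norm q + norm z" by (simp add: dist_norm norm_triangle_ineq4)
      moreover have "c * dist q z \<le> (1/16) * dist q z" using c by (intro mult_right_mono) auto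
      ultimately show ?thesis using dN(1)[OF that] M[OF \<pi>(1)[of q]] norm_ge_zero[of z] norm_ge_zero[of q]
        by argo
    qed
    then show "bounded N" unfolding bounded_iff by blast
  qed
  ultimately have "\<not> bounded (connected_component_set (- N) z)"
    using zN exp_L by (intro unbounded_component_of_logarithm) auto
  moreover have "- N = {q. dist q z / (16 * K) < infdist q A}"
    by (auto simp: N_def c_def not_le)
  ultimately show ?thesis by simp
qed

section \<open>Harnack's inequality and chains of discs\<close>

text \<open>The Schwarz lemma is applied to the Cayley transform of \<open>1 - e f\<close>, where the unimodular \<open>e\<close>
  makes \<open>e f b\<close> nonnegative.\<close>

lemma harnack_one_minus_norm:
  fixes f :: "complex \<Rightarrow> complex"
  assumes f: "f holomorphic_on ball b r" "\<And>w. w \<in> ball b r \<Longrightarrow> norm (f w) < 1"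
    and "0 < r" and ab: "dist a b \<le> r / 2"
  shows "1 - norm (f a) \<le> 3 * (1 - norm (f b))"
proof -
  obtain e where e: "norm e = 1" "e * f b = of_real (norm (f b))"
  proof (cases "f b = 0")
    case False
    have "cnj (f b) / of_real (norm (f b)) * f b = of_real (norm (f b))"
      using False complex_norm_square[of "f b"] by (simp add: field_simps power2_eq_square)
    with False that[of "cnj (f b) / of_real (norm (f b))"] show ?thesis
      by (simp add: norm_divide)
  qed (auto intro: that[of 1])
  define \<beta> where "\<beta> = 1 - norm (f b)"
  have \<beta>: "0 < \<beta>" using f(2)[of b] \<open>0 < r\<close> by (simp add: \<beta>_def)
  define p where "p w = 1 - e * f w" for w
  have pb: "p b = of_real \<beta>" by (simp add: p_def e \<beta>_def)
  have Rep: "0 < Re (p w)" if "w \<in> ball b r" for w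
  proof -
    have "norm (e * f w) < 1" using f(2)[OF that] e(1) by (simp add: norm_mult)
    then show ?thesis using complex_Re_le_cmod[of "e * f w"] by (simp add: p_def)
  qed
  \<comment> \<open>The Cayley transform sends the right half-plane to the unit disc and the value
    \<open>\<beta>\<close> at the centre to 0.\<close>
  define G where "G w = (p (b + r * w) - \<beta>) / (p (b + r * w) + \<beta>)" for w :: complex
  have in_ball: "b + r * w \<in> ball b r" if "norm w < 1" for w :: complex
    using that \<open>0 < r\<close> by (simp add: dist_norm norm_mult)
  have nz: "p (b + r * w) + \<beta> \<noteq> 0" if "norm w < 1" for w :: complex
    using Rep[OF in_ball[OF that]] \<beta> by (metis Re_complex_of_real add_pos_pos less_irrefl plus_complex.sel(1) zero_complex.sel(1))
  have "(\<lambda>w. f (b + r * w)) holomorphic_on ball 0 1"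
    using in_ball by (intro holomorphic_on_compose_gen[OF _ f(1), unfolded o_def] holomorphic_intros) auto
  then have "G holomorphic_on ball 0 1"
    unfolding G_def[abs_def] using nz unfolding p_def by (intro holomorphic_intros) auto
  moreover have "G 0 = 0" by (simp add: G_def pb)
  moreover have "norm (G w) < 1" if "norm w < 1" for w
  proof -
    have "norm (p (b + r * w) - \<beta>) < norm (p (b + r * w) + \<beta>)"
    proof -
      have "(norm (p (b + r * w) - \<beta>))\<^sup>2 < (norm (p (b + r * w) + \<beta>))\<^sup>2"
        using mult_pos_pos[OF Rep[OF in_ball[OF that]] \<beta>]
        unfolding cmod_power2 by (simp add: power2_eq_square algebra_simps)
      then show ?thesis by (rule power_less_imp_less_base) simp
    qed
    then show ?thesis using nz[OF that] by (simp add: G_def norm_divide)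
  qed
  moreover have wa: "norm ((a - b) / r) \<le> 1 / 2"
    using ab \<open>0 < r\<close> by (simp add: norm_divide dist_norm field_simps)
  ultimately have "norm (G ((a - b) / r)) \<le> norm ((a - b) / r)"
    by (intro Schwarz_Lemma(1)) auto
  moreover have "b + r * ((a - b) / r) = a" using \<open>0 < r\<close> by simp
  ultimately have "norm (p a - \<beta>) / norm (p a + \<beta>) \<le> 1 / 2"
    using wa unfolding G_def by (simp only: norm_divide)
  moreover have "0 < norm (p a + \<beta>)"
    using nz[of "(a - b) / r"] wa \<open>b + r * ((a - b) / r) = a\<close> by simp
  ultimately have "2 * norm (p a - \<beta>) \<le> norm (p a + \<beta>)" by (simp add: divide_le_eq)
  moreover have "norm (p a) - \<beta> \<le> norm (p a - \<beta>)"
    using norm_triangle_ineq2[of "p a" "of_real \<beta>"] \<beta> by simp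
  moreover have "norm (p a + \<beta>) \<le> norm (p a) + \<beta>"
    using norm_triangle_ineq[of "p a" "of_real \<beta>"] \<beta> by simp
  ultimately have "norm (p a) \<le> 3 * \<beta>" by linarith
  moreover have "1 - norm (f a) \<le> norm (p a)"
    using norm_triangle_ineq2[of 1 "e * f a"] e(1) by (simp add: p_def norm_mult)
  ultimately show ?thesis by (simp add: \<beta>_def)
qed

text \<open>Pigeonhole instead of an ordered chain: if \<open>u\<close> rose by more than
  \<open>card I * h\<close>, connectedness would supply \<open>card I + 1\<close> points with values
  spaced by more than \<open>h\<close>, two of which would share a set \<open>B i\<close>.\<close>

lemma oscillation_le_card_cover:
  fixes u :: "'a::topological_space \<Rightarrow> real" and h :: real
  assumes "connected E" "continuous_on E u" "finite I" "E \<subseteq> (\<Union>i\<in>I. B i)"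
    and osc: "\<And>i a b. i \<in> I \<Longrightarrow> a \<in> E \<inter> B i \<Longrightarrow> b \<in> E \<inter> B i \<Longrightarrow> u a - u b \<le> h"
    and xy: "x \<in> E" "y \<in> E"
  shows "u y - u x \<le> card I * h"
proof (rule ccontr)
  assume neg: "\<not> u y - u x \<le> card I * h"
  define n where "n = card I"
  have n: "0 < n" using assms(3,4) xy by (auto simp: n_def card_gt_0_iff)
  have "0 \<le> h"
  proof -
    obtain i where "i \<in> I" "x \<in> B i" using assms(4) xy by blast
    then show ?thesis using osc[of i x x] xy by simp
  qed
  define s where "s = (u y - u x) / n"
  have s: "h < s" using neg n by (simp add: s_def n_def[symmetric] field_simps)
  have "connected (u ` E)" using assms(1,2) by (rule connected_continuous_image[rotated])
  then have sub: "{u x..u y} \<subseteq> u ` E"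
    using connected_contains_Icc xy by blast
  have "\<exists>e\<in>E. u e = u x + k * s" if "k \<le> n" for k :: nat
  proof -
    have "k * s \<le> n * s" using that s \<open>0 \<le> h\<close> by (intro mult_right_mono) auto
    also have "n * s = u y - u x" using n by (simp add: s_def)
    finally have "u x + k * s \<in> {u x..u y}" using s \<open>0 \<le> h\<close> by simp
    with sub show ?thesis by (metis imageE subsetD)
  qed
  then obtain e where e: "\<And>k. k \<le> n \<Longrightarrow> e k \<in> E \<and> u (e k) = u x + real k * s" by metis
  have "\<exists>i\<in>I. e k \<in> B i" if "k \<le> n" for k
    using e[OF that] assms(4) by blast
  then obtain i where i: "\<And>k. k \<le> n \<Longrightarrow> i k \<in> I \<and> e k \<in> B (i k)" by metis
  have "\<not> inj_on i {..n}"
  proof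
    assume "inj_on i {..n}"
    then have "card {..n} \<le> card I"
      using i by (intro card_inj_on_le[OF _ _ \<open>finite I\<close>]) auto
    then show False by (simp add: n_def)
  qed
  then obtain j k where "j \<le> n" "k \<le> n" "i j = i k" "j < k"
    by (metis (full_types) atMost_iff inj_onI linorder_neqE_nat)
  then have "u (e k) - u (e j) \<le> h"
    using i[of j] i[of k] e[of j] e[of k] by (intro osc[of "i k"]) auto
  moreover have "u (e k) - u (e j) = (real k - real j) * s"
    using e[OF \<open>j \<le> n\<close>] e[OF \<open>k \<le> n\<close>] by (simp add: algebra_simps)
  moreover have "1 * s \<le> (real k - real j) * s"
    using \<open>j < k\<close> s \<open>0 \<le> h\<close> by (intro mult_right_mono) auto
  ultimately show False using s by simp
qed

text \<open>Take the least admissible exponent; the summand 1 covers the exponent 0.\<close>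

lemma power_of_two_between:
  assumes "(0::real) < x"
  obtains J :: nat where "x \<le> 2 ^ J" "2 ^ J \<le> 2 * x + 1"
proof -
  define J where "J = (LEAST J. x \<le> 2 ^ J)"
  obtain J0 where "x \<le> 2 ^ J0"
    using real_arch_pow[of 2 x] by (auto intro: less_imp_le)
  then have 1: "x \<le> 2 ^ J" unfolding J_def by (rule LeastI)
  have "2 ^ J \<le> 2 * x + 1"
  proof (cases J)
    case (Suc j)
    then have "\<not> x \<le> 2 ^ j" using not_less_Least[of j "\<lambda>J. x \<le> 2 ^ J"] by (simp add: J_def)
    then show ?thesis using Suc by simp
  qed (use assms in simp)
  with 1 show ?thesis by (rule that)
qed

text \<open>In the application \<open>f\<close> is \<open>1 / \<phi>\<close>. With
  \<open>norm z \<le> R1\<close>, the number of dyadic scales from \<open>infdist z A\<close> up to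
  the region where \<open>far\<close> applies is bounded by a logarithm of
  \<open>1 / infdist z A\<close>, up to constants independent of \<open>z\<close>.\<close>

lemma one_minus_norm_ge_infdist_power:
  fixes A :: "complex set" and f :: "complex \<Rightarrow> complex"
  assumes A: "compact A" "contractible A" "A \<noteq> {}"
    and K: "1 \<le> K" "connected_bounded_turning A K"
    and f: "f holomorphic_on - A" "\<And>w. w \<in> - A \<Longrightarrow> norm (f w) < 1"
    and far: "\<And>w. w \<in> - A \<Longrightarrow> R0 \<le> norm w \<Longrightarrow> norm (f w) \<le> 1 / 2"
  shows "\<exists>c>0. \<exists>N. \<forall>z\<in>- A. norm z \<le> R1 \<longrightarrow> c * infdist z A ^ N \<le> 1 - norm (f z)"
proof -
  define c where "c = 1 / (16 * K)"
  have c: "0 < c" using K by (simp add: c_def)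
  \<comment> \<open>One net of the disc of radius 2 serves every dyadic annulus after rescaling, so
    each scale costs the same number \<open>n\<close> of sets.\<close>
  obtain Z where Z: "finite Z" "cball 0 2 \<subseteq> (\<Union>\<zeta>\<in>Z. ball (\<zeta>::complex) (c / 4))"
    using compact_cball[of "0::complex" 2] c unfolding compact_eq_totally_bounded
    by (meson divide_pos_pos zero_less_numeral)
  define n where "n = card Z"
  obtain a0 where a0: "a0 \<in> A" using A by auto
  define R where "R = max 1 (\<bar>R0\<bar> + \<bar>R1\<bar>)"
  \<comment> \<open>\<open>12 * R\<close> is \<open>2 * (R / \<rho>) * \<delta>\<close> for
    \<open>\<rho> = \<delta> / 6\<close>; the remaining terms bound \<open>\<delta>\<close> and
    absorb the summand 1 in the bound for \<open>2 ^ J\<close>.\<close>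
  define Q where "Q = 12 * R + (\<bar>R1\<bar> + norm a0)"
  have R: "1 \<le> R" "\<bar>R0\<bar> + \<bar>R1\<bar> \<le> R" by (auto simp: R_def)
  have Q: "0 < Q" unfolding Q_def using R norm_ge_zero[of a0] abs_ge_zero[of R1] by linarith
  have "infdist z A ^ (2 * n) / (18 * Q ^ (2 * n)) \<le> 1 - norm (f z)"
    if z: "z \<in> - A" "norm z \<le> R1" for z
  proof -
    define \<delta> where "\<delta> = infdist z A"
    have \<delta>: "0 < \<delta>"
      using z A by (metis ComplD \<delta>_def compact_imp_closed in_closed_iff_infdist_zero infdist_nonneg less_eq_real_def)
    define W where "W = connected_component_set {q. dist q z / (16 * K) < infdist q A} z"
    have "\<not> bounded W"
      unfolding W_def using john_condition[OF A _ K] z by auto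
    have W: "c * dist q z < infdist q A" if "q \<in> W" for q
      using that connected_component_subset unfolding W_def c_def by force
    have conW: "connected W" unfolding W_def by (rule connected_connected_component)
    have zW: "z \<in> W"
      unfolding W_def using \<delta> by (simp add: \<delta>_def)
    have WA: "q \<in> - A" "0 < infdist q A" if "q \<in> W" for q
    proof -
      have "0 \<le> c * dist q z" using c by simp
      with W[OF that] show "0 < infdist q A" by linarith
      then show "q \<in> - A" using infdist_zero by force
    qed
    define g where "g q = 1 - norm (f q)" for q
    have g: "0 < g q" "g q \<le> 1" if "q \<in> W" for q using f(2) WA[OF that] by (auto simp: g_def)
    have gfar: "1 / 2 \<le> g q" if "q \<in> W" "R \<le> dist q z" for q
    proof -
      have "R0 \<le> norm q"
        using that(2) z(2) R norm_triangle_ineq4[of q z] by (simp add: dist_norm)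
      then show ?thesis using far[OF WA(1)[OF that(1)]] by (simp add: g_def)
    qed
    have harnack: "g a \<le> 3 * g b" if "b \<in> W" "dist a b \<le> infdist b A / 2" for a b
    proof -
      have "ball b (infdist b A) \<subseteq> - A"
        using infdist_le[of _ A b] by (force simp: not_le[symmetric])
      then show ?thesis
        unfolding g_def using f WA(2)[OF that(1)] that(2)
        by (intro harnack_one_minus_norm[of _ b "infdist b A"]) (auto intro: holomorphic_on_subset)
    qed
    \<comment> \<open>Two points of \<open>cball z \<rho>\<close> are at distance at most
      \<open>\<delta> / 3\<close>, less than half of the distance \<open>5 * \<delta> / 6\<close>
      that each of them at least keeps from \<open>A\<close>.\<close>
    define \<rho> where "\<rho> = \<delta> / 6"
    have \<rho>: "0 < \<rho>" using \<delta> by (simp add: \<rho>_def)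
    have "0 < R / \<rho>" using R \<rho> by simp
    then obtain J where J: "R / \<rho> \<le> 2 ^ J" "2 ^ J \<le> 2 * (R / \<rho>) + 1"
      by (rule power_of_two_between)
    define T where "T j q = (q - z) / of_real (2 ^ j * \<rho>)" for j :: nat and q
    have nT: "norm (T j q) = dist q z / (2 ^ j * \<rho>)" for j q
      using \<rho> by (simp add: T_def norm_divide dist_norm norm_mult norm_power)
    \<comment> \<open>Index 0 is a disc about \<open>z\<close>, index 1 the far region, and index
      \<open>j + 2\<close> with \<open>\<zeta>\<close> the part of the \<open>j\<close>-th scale
      near one point of the net.\<close>
    define B where "B i = (case i of
        (0, _) \<Rightarrow> cball z \<rho>
      | (Suc 0, _) \<Rightarrow> {q. R \<le> dist q z}
      | (Suc (Suc j), \<zeta>) \<Rightarrow> {q. 1 \<le> norm (T j q) \<and> dist (T j q) \<zeta> < c / 4})" for i :: "nat \<times> complex"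
    define I where "I = {(0, 0), (1, 0)} \<union> (\<lambda>(j, \<zeta>). (Suc (Suc j), \<zeta>)) ` ({..<J} \<times> Z)"
    have finI: "finite I" using Z by (simp add: I_def)
    have cardI: "card I \<le> 2 + J * n"
    proof -
      have "card I \<le> card {(0::nat, 0::complex), (1, 0)} + card ((\<lambda>(j, \<zeta>). (Suc (Suc j), \<zeta>)) ` ({..<J} \<times> Z))"
        unfolding I_def by (rule card_Un_le)
      also have "\<dots> \<le> 2 + card ({..<J} \<times> Z)"
        using Z by (intro add_mono card_image_le) auto
      finally show ?thesis by (simp add: card_cartesian_product n_def)
    qed
    have cover: "W \<subseteq> (\<Union>i\<in>I. B i)"
    proof
      fix q assume "q \<in> W"
      consider "dist q z \<le> \<rho>" | "R \<le> dist q z" | "\<rho> < dist q z" "dist q z < R" by linarith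
      then show "q \<in> (\<Union>i\<in>I. B i)"
      proof cases
        case 1
        then show ?thesis by (intro UN_I[of "(0, 0)"]) (auto simp: I_def B_def dist_commute)
      next
        case 2
        then show ?thesis by (intro UN_I[of "(1, 0)"]) (auto simp: I_def B_def)
      next
        case 3
        define k where "k = (LEAST k. dist q z \<le> 2 ^ k * \<rho>)"
        have "dist q z \<le> 2 ^ J * \<rho>" using 3 J(1) \<rho> by (simp add: divide_le_eq)
        then have k: "dist q z \<le> 2 ^ k * \<rho>" "k \<le> J"
          unfolding k_def by (rule LeastI, rule Least_le)
        have "k \<noteq> 0" using k(1) 3 by (auto intro: ccontr)
        then obtain j where j: "k = Suc j" by (cases k) auto
        have "\<not> dist q z \<le> 2 ^ j * \<rho>"
          using not_less_Least[of j "\<lambda>k. dist q z \<le> 2 ^ k * \<rho>"] j by (simp add: k_def[symmetric])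
        then have T: "1 \<le> norm (T j q)" "norm (T j q) \<le> 2"
          using k(1) \<rho> j unfolding nT by (simp_all add: field_simps)
        then have "T j q \<in> cball 0 2" by simp
        then obtain \<zeta> where "\<zeta> \<in> Z" "dist (T j q) \<zeta> < c / 4"
          using Z(2) by (auto simp: dist_commute)
        with T(1) k(2) j show ?thesis
          by (intro UN_I[of "(Suc (Suc j), \<zeta>)"]) (auto simp: I_def B_def)
      qed
    qed
    have osc: "g a \<le> 3 * g b" if i: "i \<in> I" and a: "a \<in> W \<inter> B i" and b: "b \<in> W \<inter> B i" for i a b
    proof -
      from i consider "i = (0, 0)" | "i = (1, 0)" | j \<zeta> where "i = (Suc (Suc j), \<zeta>)"
        unfolding I_def by auto
      then show ?thesis
      proof cases
        case 1
        then have d: "dist z a \<le> \<rho>" "dist z b \<le> \<rho>" using a b by (auto simp: B_def)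
        have "\<delta> \<le> infdist b A + dist z b" unfolding \<delta>_def by (rule infdist_triangle)
        moreover have "dist a b \<le> dist z a + dist z b" by (metis dist_commute dist_triangle)
        ultimately show ?thesis
          using d b \<delta> unfolding \<rho>_def by (intro harnack) auto
      next
        case 2
        then show ?thesis using gfar[of b] g[of a] a b by (auto simp: B_def)
      next
        case (3 j \<zeta>)
        then have d: "1 \<le> norm (T j b)" "dist (T j a) \<zeta> < c / 4" "dist (T j b) \<zeta> < c / 4"
          using a b by (auto simp: B_def)
        define t where "t = 2 ^ j * \<rho>"
        have t: "0 < t" using \<rho> by (simp add: t_def)
        have "dist (T j a) (T j b) < c / 2"
          using d(2,3) dist_triangle2[of "T j a" "T j b" \<zeta>] by linarith
        moreover have "dist (T j a) (T j b) = dist a b / t"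
          using t unfolding T_def t_def[symmetric]
          by (simp add: dist_norm norm_divide diff_divide_distrib[symmetric])
        ultimately have "dist a b < t * c / 2" using t by (simp add: field_simps)
        \<comment> \<open>The John condition enters here: \<open>infdist b A\<close> exceeds
          \<open>c * dist b z\<close>, which is at least \<open>c * t\<close>, twice the bound on
          \<open>dist a b\<close>.\<close>
        moreover have "t \<le> dist b z" using d(1) t unfolding nT t_def[symmetric] by (simp add: field_simps)
        then have "c * t \<le> c * dist b z" using c by (intro mult_left_mono) auto
        ultimately show ?thesis
          using W[of b] b by (intro harnack) (auto simp: mult.commute)
      qed
    qed
    obtain p where p: "p \<in> W" "R \<le> dist p z"
    proof -
      have "\<not> W \<subseteq> cball z R" using \<open>\<not> bounded W\<close> bounded_cball bounded_subset by blast
      then show ?thesis using that by (force simp: dist_commute)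
    qed
    have "continuous_on W f"
      using f(1) WA(1) by (meson holomorphic_on_imp_continuous_on continuous_on_subset subsetI)
    \<comment> \<open>The logarithm turns the Harnack factor 3 of each set into the additive
      oscillation \<open>ln 3\<close>.\<close>
    then have 1: "continuous_on W (\<lambda>q. ln (g q))"
      using g unfolding g_def by (intro continuous_intros) force+
    have 2: "ln (g a) - ln (g b) \<le> ln 3" if "i \<in> I" "a \<in> W \<inter> B i" "b \<in> W \<inter> B i" for i a b
    proof -
      have "g a \<le> 3 * g b" "0 < g a" "0 < g b" using osc[OF that] g that by auto
      then have "ln (g a) \<le> ln (3 * g b)" by simp
      then show ?thesis using \<open>0 < g b\<close> by (simp add: ln_mult)
    qed
    have "ln (g p) - ln (g z) \<le> card I * ln 3"
      using oscillation_le_card_cover[OF conW 1 finI cover 2 zW p(1)] .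
    also have "\<dots> = ln (3 ^ card I)" by (simp add: ln_realpow)
    finally have "ln (g p) \<le> ln (3 ^ card I * g z)"
      using g[OF zW] by (simp add: ln_mult)
    then have "g p \<le> 3 ^ card I * g z" using g p zW by simp
    also have "\<dots> \<le> 3 ^ (2 + J * n) * g z"
      using cardI g(1)[OF zW] by (intro mult_right_mono power_increasing) auto
    also have "\<dots> = 9 * 3 ^ (J * n) * g z" by (simp add: power_add)
    also have "\<dots> \<le> 9 * (Q / \<delta>) ^ (2 * n) * g z"
    proof -
      have "\<delta> \<le> \<bar>R1\<bar> + norm a0"
        using infdist_le[OF a0, of z] z(2) norm_triangle_ineq4[of z a0] by (simp add: \<delta>_def dist_norm)
      then have "(12 * R + \<delta>) / \<delta> \<le> Q / \<delta>"
        using \<delta> by (intro divide_right_mono) (auto simp: Q_def)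
      then have "2 * (R / \<rho>) + 1 \<le> Q / \<delta>"
        using \<delta> by (simp add: \<rho>_def add_divide_distrib)
      then have "(2::real) ^ J \<le> Q / \<delta>" using J(2) by linarith
      \<comment> \<open>Replacing 3 by \<open>2 ^ 2\<close> expresses the Harnack factor through
        \<open>2 ^ J\<close> with an integral exponent.\<close>
      have "(3::real) ^ (J * n) \<le> 4 ^ (J * n)" by (intro power_mono) auto
      also have "(4::real) = 2 ^ 2" by simp
      also have "((2::real) ^ 2) ^ (J * n) = (2 ^ J) ^ (2 * n)"
        by (simp only: power_mult[symmetric] mult_ac)
      also have "\<dots> \<le> (Q / \<delta>) ^ (2 * n)" using \<open>(2::real) ^ J \<le> Q / \<delta>\<close> by (intro power_mono) auto
      finally show ?thesis using g(1)[OF zW] by (intro mult_right_mono mult_left_mono) auto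
    qed
    finally have "1 / 2 \<le> 9 * (Q / \<delta>) ^ (2 * n) * g z" using gfar[OF p] by linarith
    then have "1 / 2 * \<delta> ^ (2 * n) \<le> 9 * Q ^ (2 * n) * g z"
      using \<delta> by (simp add: power_divide field_simps)
    then show ?thesis
      using Q unfolding \<delta>_def[symmetric] g_def by (simp add: field_simps)
  qed
  then have "\<forall>z\<in>- A. norm z \<le> R1 \<longrightarrow> 1 / (18 * Q ^ (2 * n)) * infdist z A ^ (2 * n) \<le> 1 - norm (f z)"
    by simp
  moreover have "0 < 1 / (18 * Q ^ (2 * n))" using Q by simp
  ultimately show ?thesis by blast
qed

section \<open>The exterior Riemann map\<close>

text \<open>The 12 is the constant in the version of Bloch's theorem used: the image contains discs
  of every radius up to \<open>r * norm (deriv G w) / 12\<close>. A radius beyond \<open>pi\<close>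
  leaves room for two values differing by \<open>2 * pi * \<i>\<close>.\<close>

lemma norm_deriv_le_of_inj_exp:
  assumes G: "G holomorphic_on ball w r" "inj_on (\<lambda>v. exp (G v)) (ball w r)" and "0 < r"
  shows "norm (deriv G w) \<le> 12 * pi / r"
proof (rule ccontr)
  assume "\<not> ?thesis"
  then have "pi < r * norm (deriv G w) / 12" using \<open>0 < r\<close> by (simp add: field_simps)
  then obtain r' where r': "pi < r'" "r' \<le> r * norm (deriv G w) / 12" by blast
  obtain b where b: "ball b r' \<subseteq> G ` ball w r"
    using Bloch[OF G(1) \<open>0 < r\<close> r'(2)] by blast
  have "b + \<i> * pi \<in> ball b r'" "b - \<i> * pi \<in> ball b r'"
    using r'(1) by (simp_all add: dist_norm norm_mult)
  then have *: "b + \<i> * pi \<in> G ` ball w r" "b - \<i> * pi \<in> G ` ball w r"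
    using b by blast+
  obtain p where p: "b + \<i> * pi = G p" "p \<in> ball w r" using *(1) by (rule imageE)
  obtain q where q: "b - \<i> * pi = G q" "q \<in> ball w r" using *(2) by (rule imageE)
  have "exp (G p) = exp (G q)"
    unfolding p(1)[symmetric] q(1)[symmetric] by (simp add: exp_add exp_diff)
  then have "p = q" using G(2) p(2) q(2) by (meson inj_onD)
  then have "b + \<i> * pi = b - \<i> * pi" using p(1) q(1) by (simp only:)
  then show False by (simp add: complex_eq_iff)
qed

text \<open>The logarithmic derivative of \<open>\<psi> - a\<close> is at most \<open>12 \<pi> / (\<bar>w\<bar> - 1) \<le> 48 / (\<bar>w\<bar> - 1)\<close>;
  integrating along the ray from \<open>2 w / \<bar>w\<bar>\<close> to \<open>w\<close> gives the exponent \<open>48\<close>.\<close>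

lemma exterior_map_distance_lower_bound:
  fixes \<psi> :: "complex \<Rightarrow> complex"
  assumes \<psi>: "\<psi> holomorphic_on {w. 1 < norm w}" "inj_on \<psi> {w. 1 < norm w}"
    and a: "\<And>w. 1 < norm w \<Longrightarrow> \<psi> w \<noteq> a" and m: "0 < m" "\<And>w. norm w = 2 \<Longrightarrow> m \<le> dist (\<psi> w) a"
    and w: "1 < norm w" "norm w \<le> 2"
  shows "m * (norm w - 1) ^ 48 \<le> dist (\<psi> w) a"
proof -
  define \<zeta> where "\<zeta> = sgn w"
  have "w \<noteq> 0" using w by auto
  then have \<zeta>: "norm \<zeta> = 1" "w = of_real (norm w) * \<zeta>"
    by (simp_all only: \<zeta>_def norm_sgn) (simp_all add: sgn_eq)
  \<comment> \<open>The half-plane beyond the tangent to the unit circle at \<open>\<zeta>\<close>.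
    It contains the ray and the discs about its points, and, unlike the exterior of the disc, it is
    simply connected, so a logarithm of \<open>\<psi> - a\<close> exists on it.\<close>
  define H where "H = {v. 1 < Re (v * cnj \<zeta>)}"
  have H1: "1 < norm v" if "v \<in> H" for v
  proof -
    have "Re (v * cnj \<zeta>) \<le> norm (v * cnj \<zeta>)" by (rule complex_Re_le_cmod)
    also have "\<dots> = norm v" by (simp add: norm_mult \<zeta>(1))
    finally show ?thesis using that by (simp add: H_def)
  qed
  have inner: "Re (v * cnj \<zeta>) = v \<bullet> \<zeta>" for v by (simp add: inner_complex_def)
  have ballH: "ball (of_real t * \<zeta>) (t - 1) \<subseteq> H" for t
  proof
    fix v assume "v \<in> ball (of_real t * \<zeta>) (t - 1)"
    then have "norm (of_real t * \<zeta> - v) < t - 1" by (simp add: dist_norm)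
    moreover have "Re ((of_real t * \<zeta> - v) * cnj \<zeta>) \<le> norm ((of_real t * \<zeta> - v) * cnj \<zeta>)"
      by (rule complex_Re_le_cmod)
    moreover have "norm ((of_real t * \<zeta> - v) * cnj \<zeta>) = norm (of_real t * \<zeta> - v)"
      by (simp add: norm_mult \<zeta>(1))
    moreover have "(of_real t * \<zeta>) * cnj \<zeta> = of_real t"
      using \<zeta>(1) complex_norm_square[of \<zeta>] by (simp add: mult.assoc)
    ultimately show "v \<in> H" by (simp add: H_def left_diff_distrib)
  qed
  have H: "open H" "convex H"
  proof -
    have "H = {v. \<zeta> \<bullet> v > 1}" unfolding H_def inner by (simp add: inner_commute)
    then show "open H" "convex H" by (simp_all add: open_halfspace_gt convex_halfspace_gt)
  qed
  have wt: "of_real t * \<zeta> \<in> H" if "1 < t" for t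
    using ballH[of t] that by auto
  obtain G where G: "G holomorphic_on H" "\<And>v. v \<in> H \<Longrightarrow> exp (G v) = \<psi> v - a"
  proof (rule holomorphic_logarithm_exists[OF H(2,1)])
    show "(\<lambda>v. \<psi> v - a) holomorphic_on H"
      using H1 by (intro holomorphic_intros holomorphic_on_subset[OF \<psi>(1)]) auto
    show "\<psi> v - a \<noteq> 0" if "v \<in> H" for v using a H1[OF that] by simp
    show "of_real 2 * \<zeta> \<in> H" by (rule wt) simp
  qed blast
  have G': "norm (deriv G (of_real t * \<zeta>)) \<le> 48 / (t - 1)" if "1 < t" for t
  proof -
    have "norm (deriv G (of_real t * \<zeta>)) \<le> 12 * pi / (t - 1)"
    proof (rule norm_deriv_le_of_inj_exp)
      show "G holomorphic_on ball (of_real t * \<zeta>) (t - 1)"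
        using G(1) ballH holomorphic_on_subset by blast
      show "inj_on (\<lambda>v. exp (G v)) (ball (of_real t * \<zeta>) (t - 1))"
      proof (rule inj_onI)
        fix u v assume uv: "u \<in> ball (of_real t * \<zeta>) (t - 1)" "v \<in> ball (of_real t * \<zeta>) (t - 1)"
          "exp (G u) = exp (G v)"
        then have "u \<in> H" "v \<in> H" using ballH by blast+
        then show "u = v" using uv(3) G(2) \<psi>(2) H1 by (auto dest: inj_onD)
      qed
    qed (use that in simp)
    also have "\<dots> \<le> 48 / (t - 1)"
      using that pi_less_4 by (intro divide_right_mono) auto
    finally show ?thesis .
  qed
  \<comment> \<open>The comparison term vanishes at \<open>t = 2\<close>, where the lower bound
    \<open>m\<close> is available.\<close>
  define k where "k t = Re (G (of_real t * \<zeta>)) - 48 * ln (t - 1)" for t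
  have "k 2 \<le> k (norm w)"
  proof (rule DERIV_nonpos_imp_nonincreasing[OF w(2)])
    fix t assume t: "norm w \<le> t" "t \<le> 2"
    then have t1: "1 < t" using w by simp
    have "(G has_field_derivative deriv G (of_real t * \<zeta>)) (at (of_real t * \<zeta>))"
      by (rule holomorphic_derivI[OF G(1) H(1) wt[OF t1]])
    moreover have "((\<lambda>t. of_real t * \<zeta>) has_vector_derivative \<zeta>) (at t)"
      by (auto intro!: derivative_eq_intros has_vector_derivative_of_real)
    ultimately have "((\<lambda>t. G (of_real t * \<zeta>)) has_vector_derivative \<zeta> * deriv G (of_real t * \<zeta>)) (at t)"
      using field_vector_diff_chain_at[of "\<lambda>t. of_real t * \<zeta>" \<zeta> t G] by (simp add: o_def)
    then have "((\<lambda>t. Re (G (of_real t * \<zeta>))) has_vector_derivative Re (\<zeta> * deriv G (of_real t * \<zeta>))) (at t)"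
      by (rule bounded_linear.has_vector_derivative[OF bounded_linear_Re])
    then have D1: "((\<lambda>t. Re (G (of_real t * \<zeta>))) has_real_derivative Re (\<zeta> * deriv G (of_real t * \<zeta>))) (at t)"
      by (simp only: has_real_derivative_iff_has_vector_derivative)
    have D2: "((\<lambda>t. 48 * ln (t - 1)) has_real_derivative 48 * (1 / (t - 1))) (at t)"
      using t1 by (auto intro!: derivative_eq_intros)
    have "(k has_real_derivative Re (\<zeta> * deriv G (of_real t * \<zeta>)) - 48 * (1 / (t - 1))) (at t)"
      unfolding k_def[abs_def] by (rule DERIV_diff[OF D1 D2])
    moreover have "Re (\<zeta> * deriv G (of_real t * \<zeta>)) \<le> 48 / (t - 1)"
      using complex_Re_le_cmod[of "\<zeta> * deriv G (of_real t * \<zeta>)"] G'[OF t1] by (simp add: norm_mult \<zeta>(1))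
    ultimately show "\<exists>y. (k has_real_derivative y) (at t) \<and> y \<le> 0" by fastforce
  qed
  then have "Re (G (2 * \<zeta>)) + 48 * ln (norm w - 1) \<le> Re (G w)"
    using \<zeta>(2)[symmetric] by (simp add: k_def)
  then have "exp (Re (G (2 * \<zeta>)) + 48 * ln (norm w - 1)) \<le> exp (Re (G w))" by simp
  moreover have "exp (48 * ln (norm w - 1)) = (norm w - 1) ^ 48"
    using w(1) exp_of_nat_mult[of 48 "ln (norm w - 1)"] by simp
  moreover have "exp (Re (G v)) = dist (\<psi> v) a" if "v \<in> H" for v
    using G(2)[OF that] by (metis dist_norm norm_exp_eq_Re)
  moreover have "2 * \<zeta> \<in> H" "w \<in> H"
    using wt[of 2] wt[OF w(1)] \<zeta>(2) by simp_all
  ultimately have "dist (\<psi> (2 * \<zeta>)) a * (norm w - 1) ^ 48 \<le> dist (\<psi> w) a"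
    by (simp add: exp_add)
  moreover have "m * (norm w - 1) ^ 48 \<le> dist (\<psi> (2 * \<zeta>)) a * (norm w - 1) ^ 48"
    using w by (intro mult_right_mono m) (auto simp: norm_mult \<zeta>(1))
  ultimately show ?thesis by linarith
qed

text \<open>The Riemann map and its inverse both fix the origin; after inversion this bound becomes
  linear growth of \<open>\<phi>\<close> and \<open>\<psi>\<close> at infinity.\<close>

lemma holomorphic_lipschitz_at_zero:
  assumes "open S" "f holomorphic_on S" "(0::complex) \<in> S" "f 0 = 0"
  obtains L r where "0 < L" "0 < r" "\<And>u. norm u < r \<Longrightarrow> u \<in> S \<and> norm (f u) \<le> L * norm u"
proof -
  obtain D where "(f has_field_derivative D) (at 0)"
    using holomorphic_derivI[OF assms(2,1,3)] by blast
  then have "((\<lambda>h. f h / h) \<longlongrightarrow> D) (at 0)"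
    using assms(4) by (simp add: DERIV_def)
  then have "\<forall>\<^sub>F h in at 0. dist (f h / h) D < 1"
    by (rule tendstoD) simp
  then obtain r where r: "0 < r" "\<And>h. h \<noteq> 0 \<Longrightarrow> dist h 0 < r \<Longrightarrow> dist (f h / h) D < 1"
    unfolding eventually_at by auto
  obtain e where e: "0 < e" "ball 0 e \<subseteq> S" using assms(1,3) openE by blast
  have "u \<in> S \<and> norm (f u) \<le> (norm D + 1) * norm u" if "norm u < min r e" for u
  proof (cases "u = 0")
    case False
    then have "dist (f u / u) D < 1" using r(2) that by simp
    then have "norm (f u / u) \<le> norm D + 1"
      using norm_triangle_sub[of "f u / u" D] by (simp add: dist_norm)
    then have "norm (f u) \<le> (norm D + 1) * norm u" using False by (simp add: norm_divide field_simps)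
    with e that show ?thesis by auto
  qed (use assms in auto)
  moreover have "0 < norm D + 1" using norm_ge_zero[of D] by linarith
  ultimately show ?thesis using that[of "norm D + 1" "min r e"] r(1) e(1) by auto
qed

text \<open>The inversion \<open>z \<mapsto> 1 / (z - a)\<close> moves infinity to \<open>0\<close> and turns the complement of \<open>A\<close> in the
  Riemann sphere into the simply connected plane domain \<open>S\<close>.\<close>

lemma exterior_riemann_map:
  fixes A :: "complex set"
  assumes A: "compact A" "connected A" "connected (- A)" "a \<in> A" "connected (A - {a})" "A \<noteq> {a}"
  obtains f g S where "open S" "0 \<in> S" "f holomorphic_on S" "g holomorphic_on ball 0 1"
    "f 0 = 0" "g 0 = 0" "\<And>u. u \<in> S \<Longrightarrow> f u \<in> ball 0 1 \<and> g (f u) = u"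
    "\<And>v. v \<in> ball 0 1 \<Longrightarrow> g v \<in> S \<and> f (g v) = v"
    "\<And>u. u \<noteq> 0 \<Longrightarrow> u \<in> S \<longleftrightarrow> a + 1 / u \<in> - A"
proof -
  define S where "S = {u. u = 0 \<or> a + 1 / u \<in> - A}"
  obtain M where M: "0 < M" "\<And>x. x \<in> A \<Longrightarrow> norm (x - a) < M"
  proof -
    have "bounded ((\<lambda>x. x - a) ` A)"
      using A(1) by (intro compact_imp_bounded compact_continuous_image continuous_intros)
    then show ?thesis
      using that unfolding bounded_pos_less by blast
  qed
  have ball: "ball 0 (1 / M) \<subseteq> S"
  proof
    fix u :: complex assume "u \<in> ball 0 (1 / M)"
    then have u: "norm u < 1 / M" by simp
    show "u \<in> S"
    proof (cases "u = 0")
      case False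
      then have "M < norm (1 / u)" using u M(1) by (simp add: norm_divide field_simps)
      then have "a + 1 / u \<notin> A" using M(2)[of "a + 1 / u"] by auto
      then show ?thesis by (simp add: S_def)
    qed (simp add: S_def)
  qed
  have "open {u \<in> - {0}. a + 1 / u \<in> - A}"
    using A(1) by (intro continuous_open_preimage[unfolded vimage_def Int_def, simplified] continuous_intros)
      (auto simp: open_Compl compact_imp_closed)
  \<comment> \<open>The disc supplies the point 0, the image of infinity; from this union both
    openness and connectedness of \<open>S\<close> follow.\<close>
  moreover have S_eq: "S = {u \<in> - {0}. a + 1 / u \<in> - A} \<union> ball 0 (1 / M)"
    using ball M(1) by (auto simp: S_def)
  ultimately have "open S" unfolding S_eq by (intro open_Un) auto
  have inv: "{u \<in> - {0}. a + 1 / u \<in> B} = (\<lambda>z. 1 / (z - a)) ` (B - {a})" for B :: "complex set"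
  proof (intro equalityI subsetI)
    fix u assume "u \<in> {u \<in> - {0}. a + 1 / u \<in> B}"
    then show "u \<in> (\<lambda>z. 1 / (z - a)) ` (B - {a})"
      by (intro image_eqI[of _ _ "a + 1 / u"]) auto
  qed auto
  have con: "connected ((\<lambda>z. 1 / (z - a)) ` (B - {a}))" if "connected (B - {a})" for B
    using that by (intro connected_continuous_image continuous_intros) auto
  have "connected S"
    unfolding S_eq
  proof (rule connected_Un)
    have "- A - {a} = - A" using A(4) by auto
    then show "connected {u \<in> - {0}. a + 1 / u \<in> - A}" using con[of "- A"] A(3) inv[of "- A"] by simp
    have "of_real (1 / (2 * M)) \<in> {u \<in> - {0}. a + 1 / u \<in> - A} \<inter> ball 0 (1 / M)"
    proof -
      have *: "of_real (1 / (2 * M)) \<in> ball (0::complex) (1 / M)"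
        using M(1) by (simp add: norm_divide norm_mult field_simps)
      then have "of_real (1 / (2 * M)) \<in> S" using ball by blast
      with * M(1) show ?thesis by (auto simp: S_def)
    qed
    then show "{u \<in> - {0}. a + 1 / u \<in> - A} \<inter> ball 0 (1 / M) \<noteq> {}" by blast
  qed simp
  have "- S = {u \<in> - {0}. a + 1 / u \<in> A}" by (auto simp: S_def)
  then have mS: "- S = (\<lambda>z. 1 / (z - a)) ` (A - {a})" unfolding inv .
  \<comment> \<open>The inversion sends points of \<open>A\<close> near its limit point
    \<open>a\<close> to infinity. A connected unbounded complement then yields simple connectivity
    of \<open>S\<close>.\<close>
  have "\<not> bounded (- S)"
  proof
    assume "bounded (- S)"
    then obtain B where B: "0 < B" "\<And>u. u \<in> - S \<Longrightarrow> norm u \<le> B" unfolding bounded_pos by blast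
    have "a islimpt A"
      using A by (intro connected_imp_perfect) auto
    then obtain x where x: "x \<in> A" "x \<noteq> a" "dist x a < 1 / B"
      using B(1) unfolding islimpt_approachable by (meson zero_less_divide_1_iff)
    then have "norm (1 / (x - a)) \<le> B" using mS by (intro B(2)) auto
    then have "1 \<le> B * dist x a" using x(2) by (simp add: norm_divide dist_norm field_simps)
    then show False using x(3) B(1) by (simp add: field_simps)
  qed
  moreover have "connected (- S)" unfolding mS using con[of A] A(5) .
  ultimately have "\<forall>C\<in>components (- S). \<not> bounded C"
    using connected_eq_components_subset_sing by blast
  then have "simply_connected S"
    using \<open>open S\<close> \<open>connected S\<close> by (simp add: simply_connected_eq_unbounded_complement_components)
  moreover have "0 \<in> S" by (simp add: S_def)
  moreover have "S \<noteq> UNIV" using \<open>\<not> bounded (- S)\<close> by auto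
  ultimately have "\<exists>f g. f holomorphic_on S \<and> g holomorphic_on ball 0 1 \<and>
      (\<forall>z\<in>S. f z \<in> ball 0 1 \<and> g (f z) = z) \<and> (\<forall>z\<in>ball 0 1. g z \<in> S \<and> f (g z) = z)"
    using Riemann_mapping_theorem[of S] \<open>open S\<close> by blast
  then obtain f g where fg: "f holomorphic_on S" "g holomorphic_on ball 0 1"
    "\<And>z. z \<in> S \<Longrightarrow> f z \<in> ball 0 1 \<and> g (f z) = z" "\<And>z. z \<in> ball 0 1 \<Longrightarrow> g z \<in> S \<and> f (g z) = z"
    by blast
  \<comment> \<open>A disc automorphism moves \<open>f 0\<close> to the centre, which makes the
    exterior map fix infinity.\<close>
  obtain h k where hk: "h (f 0) = 0" "h holomorphic_on ball 0 1" "h ` ball 0 1 \<subseteq> ball 0 1"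
    "k holomorphic_on ball 0 1" "k ` ball 0 1 \<subseteq> ball 0 1"
    "\<And>z. z \<in> ball 0 1 \<Longrightarrow> h (k z) = z" "\<And>z. z \<in> ball 0 1 \<Longrightarrow> k (h z) = z"
    using ball_biholomorphism_exists[of "f 0"] fg(3)[OF \<open>0 \<in> S\<close>] by blast
  show ?thesis
  proof (rule that[of S "h \<circ> f" "g \<circ> k"])
    show "h \<circ> f holomorphic_on S"
      using fg(3) by (intro holomorphic_on_compose_gen[OF fg(1) hk(2)]) auto
    show "g \<circ> k holomorphic_on ball 0 1"
      by (rule holomorphic_on_compose_gen[OF hk(4) fg(2) hk(5)])
    have "k 0 = f 0" using hk(1,7) fg(3)[OF \<open>0 \<in> S\<close>] by metis
    then show "(g \<circ> k) 0 = 0" using fg(3)[OF \<open>0 \<in> S\<close>] by simp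
    show "(h \<circ> f) u \<in> ball 0 1 \<and> (g \<circ> k) ((h \<circ> f) u) = u" if "u \<in> S" for u
    proof -
      have "f u \<in> ball 0 1" using fg(3)[OF that] by blast
      then have "h (f u) \<in> ball 0 1" "k (h (f u)) = f u" using hk(3,7) by blast+
      then show ?thesis using fg(3)[OF that] by simp
    qed
    show "(g \<circ> k) v \<in> S \<and> (h \<circ> f) ((g \<circ> k) v) = v" if "v \<in> ball 0 1" for v
    proof -
      have "k v \<in> ball 0 1" using hk(5) that by blast
      then show ?thesis using fg(4) hk(6)[OF that] by auto
    qed
    show "u \<in> S \<longleftrightarrow> a + 1 / u \<in> - A" if "u \<noteq> 0" for u using that by (simp add: S_def)
  qed (use \<open>open S\<close> \<open>0 \<in> S\<close> hk(1) in auto)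
qed

section \<open>Comparison of the boundary weights along the exterior map\<close>

lemma infdist_cball:
  fixes w :: "'a::real_normed_vector"
  assumes "0 \<le> r" "r \<le> norm w"
  shows "infdist w (cball 0 r) = norm w - r"
proof (rule antisym)
  show "infdist w (cball 0 r) \<le> norm w - r"
  proof (cases "w = 0")
    case False
    have "infdist w (cball 0 r) \<le> dist w ((r / norm w) *\<^sub>R w)"
      using assms False by (intro infdist_le) auto
    also have "w - (r / norm w) *\<^sub>R w = (1 - r / norm w) *\<^sub>R w" by (simp add: scaleR_left_diff_distrib)
    then have "dist w ((r / norm w) *\<^sub>R w) = \<bar>1 - r / norm w\<bar> * norm w" by (simp add: dist_norm)
    also have "\<dots> = norm w - r"
      using assms False by (simp add: abs_of_nonneg field_simps)
    finally show ?thesis .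
  qed (use assms in auto)
  have "cball (0::'a) r \<noteq> {}" using assms by simp
  then show "norm w - r \<le> infdist w (cball 0 r)"
    unfolding infdist_notempty[OF \<open>cball (0::'a) r \<noteq> {}\<close>]
  proof (rule cINF_greatest)
    fix x :: 'a assume "x \<in> cball 0 r"
    then show "norm w - r \<le> dist w x"
      using norm_triangle_ineq2[of w x] by (simp add: dist_norm)
  qed
qed

text \<open>The factors of the weights are compared separately: \<open>1 + norm\<close> by linear
  growth at infinity, the boundary factors by one distance estimate in each direction.\<close>

lemma schwartz_equivalent_complement:
  fixes A :: "complex set"
  assumes A: "compact A" "contractible A" "connected A" "connected (- A)"
      "a \<in> A" "connected (A - {a})" "A \<noteq> {a}"
    and K: "1 \<le> K" "connected_bounded_turning A K"
  shows "schwartz_equivalent (- A) (- cball 0 1)"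
proof -
  obtain f g S where S: "open S" "0 \<in> S" and hol: "f holomorphic_on S" "g holomorphic_on ball 0 1"
    and f0: "f 0 = 0" and g0: "g 0 = 0"
    and fg: "\<And>u. u \<in> S \<Longrightarrow> f u \<in> ball 0 1 \<and> g (f u) = u"
    and gf: "\<And>v. v \<in> ball 0 1 \<Longrightarrow> g v \<in> S \<and> f (g v) = v"
    and SA: "\<And>u. u \<noteq> 0 \<Longrightarrow> u \<in> S \<longleftrightarrow> a + 1 / u \<in> - A"
    by (rule exterior_riemann_map[OF A(1,3-7)]) (rule that)
  define h where "h z = f (1 / (z - a))" for z
  define \<phi> where "\<phi> z = 1 / h z" for z
  define \<psi> where "\<psi> w = a + 1 / g (1 / w)" for w
  let ?V = "- cball (0::complex) 1"
  have V: "w \<in> ?V \<longleftrightarrow> 1 < norm w" for w by auto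
  have VU: "?V \<noteq> UNIV" using V[of 0] by (metis UNIV_I norm_zero not_one_less_zero)
  have za: "z - a \<noteq> 0" "1 / (z - a) \<in> S" if "z \<in> - A" for z
    using that A(5) SA[of "1 / (z - a)"] by auto
  have h: "h z \<noteq> 0" "norm (h z) < 1" "g (h z) = 1 / (z - a)" if "z \<in> - A" for z
    using fg[OF za(2)[OF that]] za(1)[OF that] g0 by (auto simp: h_def)
  have w: "1 / w \<in> ball 0 1" "g (1 / w) \<noteq> 0" "f (g (1 / w)) = 1 / w" if "w \<in> ?V" for w
  proof -
    have "1 < norm w" using that by simp
    then show 1: "1 / w \<in> ball 0 1" by (simp add: norm_divide divide_less_eq)
    then show 2: "f (g (1 / w)) = 1 / w" using gf by blast
    show "g (1 / w) \<noteq> 0" using 2 f0 that by auto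
  qed
  have \<phi>V: "\<phi> z \<in> ?V \<and> \<psi> (\<phi> z) = z" if "z \<in> - A" for z
  proof -
    have "1 < norm (\<phi> z)" using h[OF that] by (simp add: \<phi>_def norm_divide)
    then show ?thesis using h(3)[OF that] za(1)[OF that] by (simp add: \<psi>_def \<phi>_def)
  qed
  have \<psi>U: "\<psi> w \<in> - A \<and> \<phi> (\<psi> w) = w" if "w \<in> ?V" for w
    using SA[OF w(2)[OF that]] gf[OF w(1)[OF that]] w(3)[OF that]
    by (simp add: \<psi>_def \<phi>_def h_def)
  have holh: "h holomorphic_on - A"
    unfolding h_def[abs_def] using za
    by (intro holomorphic_on_compose_gen[OF _ hol(1), unfolded o_def] holomorphic_intros) auto
  then have hol\<phi>: "\<phi> holomorphic_on - A"
    unfolding \<phi>_def[abs_def] using h(1) by (intro holomorphic_intros) auto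
  have "(\<lambda>w. g (1 / w)) holomorphic_on ?V"
    using w(1) by (intro holomorphic_on_compose_gen[OF _ hol(2), unfolded o_def] holomorphic_intros) auto
  then have hol\<psi>: "\<psi> holomorphic_on ?V"
    unfolding \<psi>_def[abs_def] using w(2) by (intro holomorphic_intros) auto
  have inj\<psi>: "inj_on \<psi> ?V" using \<psi>U by (metis inj_onI)
  have A0: "A \<noteq> {}" "closed A" using A by (auto intro: compact_imp_closed)
  obtain L r where L: "0 < L" "0 < r" "\<And>u. norm u < r \<Longrightarrow> u \<in> S \<and> norm (f u) \<le> L * norm u"
    by (rule holomorphic_lipschitz_at_zero[OF S(1) hol(1) S(2) f0]) (rule that)
  obtain L' r' where L': "0 < L'" "0 < r'" "\<And>u. norm u < r' \<Longrightarrow> u \<in> ball 0 1 \<and> norm (g u) \<le> L' * norm u"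
    by (rule holomorphic_lipschitz_at_zero[OF open_ball hol(2) _ g0]) (simp, rule that)
  \<comment> \<open>Two regimes: for \<open>norm (h z) < r'\<close> the Lipschitz bound on
    \<open>g\<close> gives \<open>norm (\<phi> z) \<le> L' * norm (z - a)\<close>, otherwise
    \<open>norm (\<phi> z) \<le> 1 / r'\<close>.\<close>
  define C1 where "C1 = 1 + 1 / r' + L' * (1 + norm a)"
  have C1: "1 \<le> C1" unfolding C1_def using L' by (simp add: add_nonneg_nonneg)
  have growth\<phi>: "1 + norm (\<phi> z) \<le> C1 * (1 + norm z)" if z: "z \<in> - A" for z
  proof -
    have "norm (\<phi> z) \<le> 1 / r' + L' * (norm z + norm a)"
    proof (cases "norm (h z) < r'")
      case True
      then have "norm (1 / (z - a)) \<le> L' * norm (h z)" using L'(3) h(3)[OF z] by metis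
      then have "norm (\<phi> z) \<le> L' * norm (z - a)"
        using h(1)[OF z] za(1)[OF z] by (simp add: \<phi>_def norm_divide field_simps)
      also have "\<dots> \<le> L' * (norm z + norm a)"
        using L'(1) by (intro mult_left_mono norm_triangle_ineq4) auto
      finally show ?thesis using L'(2) by (simp add: add_increasing)
    next
      case False
      then have "norm (\<phi> z) \<le> 1 / r'"
        using L'(2) unfolding \<phi>_def norm_divide norm_one by (intro divide_left_mono mult_pos_pos) linarith+
      then show ?thesis using L'(1) by (simp add: add_increasing2)
    qed
    moreover have "1 + (1 / r' + L' * (norm z + norm a)) \<le> C1 * (1 + norm z)"
      using L'(1,2) by (simp add: C1_def algebra_simps)
    ultimately show ?thesis by linarith
  qed
  define C2 where "C2 = 1 + norm a + 1 / r + L"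
  have C2: "1 \<le> C2" unfolding C2_def using L by (simp add: add_nonneg_nonneg)
  have growth\<psi>: "1 + norm (\<psi> w) \<le> C2 * (1 + norm w)" if wV: "w \<in> ?V" for w
  proof -
    have w0: "w \<noteq> 0" using wV by auto
    let ?u = "g (1 / w)"
    have "norm (1 / ?u) \<le> 1 / r + L * norm w"
    proof (cases "norm ?u < r")
      case True
      then have "norm (1 / w) \<le> L * norm ?u" using L(3) w(3)[OF wV] by metis
      then have "norm (1 / ?u) \<le> L * norm w"
        using w(2)[OF wV] w0 by (simp add: norm_divide field_simps)
      then show ?thesis using L(2) by (simp add: add_increasing)
    next
      case False
      then have "norm (1 / ?u) \<le> 1 / r"
        using L(2) unfolding norm_divide norm_one by (intro divide_left_mono mult_pos_pos) linarith+
      then show ?thesis using L(1) by (simp add: add_increasing2)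
    qed
    moreover have "norm (\<psi> w) \<le> norm a + norm (1 / ?u)"
      unfolding \<psi>_def by (rule norm_triangle_ineq)
    moreover have "1 + (norm a + (1 / r + L * norm w)) \<le> C2 * (1 + norm w)"
      using L(1,2) by (simp add: C2_def algebra_simps)
    ultimately show ?thesis by linarith
  qed
  obtain M where M: "\<And>x. x \<in> A \<Longrightarrow> norm x \<le> M"
    using A(1) compact_imp_bounded bounded_iff by metis
  \<comment> \<open>Compactness handles a closed annulus; beyond it, linear growth of
    \<open>\<phi>\<close> forces \<open>\<psi> w\<close> to be at distance at least 1 from
    \<open>A\<close>.\<close>
  obtain m where m: "0 < m" "m \<le> 1" "\<And>w. 2 \<le> norm w \<Longrightarrow> m \<le> infdist (\<psi> w) A"
  proof -
    define E where "E = cball (0::complex) (C1 * (2 + M)) - ball 0 2"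
    have "compact E" unfolding E_def by (intro compact_diff) auto
    have EV: "E \<subseteq> ?V" by (auto simp: E_def)
    have cont: "continuous_on E (\<lambda>w. infdist (\<psi> w) A)"
      using holomorphic_on_imp_continuous_on[OF hol\<psi>] EV
      by (intro continuous_intros) (rule continuous_on_subset)
    have pos: "0 < infdist (\<psi> w) A" if "w \<in> ?V" for w
      using infdist_compl_pos[of "- A" "\<psi> w"] \<psi>U[OF that] A0 by auto
    obtain m0 where m0: "0 < m0" "\<And>w. w \<in> E \<Longrightarrow> m0 \<le> infdist (\<psi> w) A"
    proof (cases "E = {}")
      case True
      then show ?thesis using that[of 1] by simp
    next
      case False
      then obtain w0 where "w0 \<in> E" "\<And>w. w \<in> E \<Longrightarrow> infdist (\<psi> w0) A \<le> infdist (\<psi> w) A"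
        using continuous_attains_inf[OF \<open>compact E\<close> _ cont] by blast
      then show ?thesis using that[of "infdist (\<psi> w0) A"] pos EV by blast
    qed
    have "min m0 1 \<le> infdist (\<psi> w) A" if w2: "2 \<le> norm w" for w
    proof (cases "norm w \<le> C1 * (2 + M)")
      case True
      then have "w \<in> E" using w2 by (simp add: E_def)
      then show ?thesis using m0(2) by fastforce
    next
      case False
      have wV: "w \<in> ?V" using w2 by auto
      have "1 + norm w \<le> C1 * (1 + norm (\<psi> w))"
        using growth\<phi>[of "\<psi> w"] \<psi>U[OF wV] by simp
      then have "C1 * (2 + M) < C1 * (1 + norm (\<psi> w))" using False by linarith
      then have "2 + M < 1 + norm (\<psi> w)" using C1 by simp
      obtain x where "x \<in> A" "infdist (\<psi> w) A = dist (\<psi> w) x"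
        using infdist_attains_inf[OF A0(2,1)] by metis
      then show ?thesis
        using M[of x] norm_triangle_ineq2[of "\<psi> w" x] \<open>2 + M < 1 + norm (\<psi> w)\<close>
        by (simp add: dist_norm)
    qed
    then show ?thesis using that[of "min m0 1"] m0(1) by simp
  qed
  have lower\<psi>: "m * (norm w - 1) ^ 48 \<le> infdist (\<psi> w) A" if "1 < norm w" "norm w \<le> 2" for w
  proof -
    obtain x where x: "x \<in> A" "infdist (\<psi> w) A = dist (\<psi> w) x"
      using infdist_attains_inf[OF A0(2,1)] by metis
    have V': "{w. 1 < norm w} = ?V" by auto
    have "m * (norm w - 1) ^ 48 \<le> dist (\<psi> w) x"
    proof (rule exterior_map_distance_lower_bound[OF _ _ _ m(1) _ that])
      show "\<psi> holomorphic_on {w. 1 < norm w}" "inj_on \<psi> {w. 1 < norm w}"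
        unfolding V' by (rule hol\<psi>, rule inj\<psi>)
      show "\<psi> w \<noteq> x" if "1 < norm w" for w using \<psi>U[of w] that x(1) by auto
      show "m \<le> dist (\<psi> w) x" if "norm w = 2" for w
        using m(3)[of w] that infdist_le[OF x(1), of "\<psi> w"] by linarith
    qed
    then show ?thesis using x(2) by simp
  qed
  have "isCont f 0"
    using hol(1) S by (meson continuous_on_eq_continuous_at holomorphic_on_imp_continuous_on)
  then obtain s where s: "0 < s" "\<And>u. norm u < s \<Longrightarrow> norm (f u) < 1 / 2"
    unfolding continuous_at_eps_delta using f0
    by (metis dist_0_norm dist_commute half_gt_zero zero_less_one)
  have far: "norm (h z) \<le> 1 / 2" if "z \<in> - A" "norm a + 1 / s + 1 \<le> norm z" for z
  proof -
    have "1 / s < norm (z - a)" using that(2) norm_triangle_ineq2[of z a] by linarith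
    then have "norm (1 / (z - a)) < s"
      using s(1) za(1)[OF that(1)] by (simp add: norm_divide field_simps)
    then show ?thesis using s(2) by (simp add: h_def less_imp_le)
  qed
  \<comment> \<open>By linear growth of \<open>\<psi>\<close>, \<open>C2 * 3\<close> bounds
    \<open>norm z\<close> whenever \<open>norm (\<phi> z) < 2\<close>.\<close>
  obtain c N where c: "0 < c"
    and cN: "\<And>z. z \<in> - A \<Longrightarrow> norm z \<le> C2 * 3 \<Longrightarrow> c * infdist z A ^ N \<le> 1 - norm (h z)"
  proof -
    have "\<exists>c>0. \<exists>N. \<forall>z\<in>- A. norm z \<le> C2 * 3 \<longrightarrow> c * infdist z A ^ N \<le> 1 - norm (h z)"
      by (rule one_minus_norm_ge_infdist_power[OF A(1,2) A0(1) K holh h(2) far])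
    then show ?thesis using that by blast
  qed
  \<comment> \<open>The exponent 49 is 48 from the distance estimate and 1 from the factor
    \<open>1 + norm z\<close>.\<close>
  have wt1: "boundary_weight (- A) z \<le> (C2 * (1 + 1 / m)) * boundary_weight ?V (\<phi> z) ^ 49"
    if z: "z \<in> - A" for z
  proof -
    define b where "b = boundary_weight ?V (\<phi> z)"
    have b: "1 \<le> b" "1 + norm (\<phi> z) \<le> b" unfolding b_def by (rule boundary_weight_ge)+
    have wz: "1 < norm (\<phi> z)" "\<psi> (\<phi> z) = z" using \<phi>V[OF z] by auto
    have b3: "1 / (norm (\<phi> z) - 1) \<le> b"
      using boundary_weight_ge(3)[of "\<phi> z" ?V] wz(1) by (simp add: b_def infdist_cball)
    have d: "0 < infdist z A" using infdist_compl_pos[of "- A" z] z A0 by auto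
    have "1 \<le> infdist z A / m * b ^ 48"
    proof (cases "2 \<le> norm (\<phi> z)")
      case True
      then have "1 \<le> infdist z A / m" using m(1) m(3)[of "\<phi> z"] wz(2) by (simp add: field_simps)
      moreover have "1 \<le> b ^ 48" using b(1) by simp
      ultimately show ?thesis using mult_mono[of 1 "infdist z A / m" 1 "b ^ 48"] by simp
    next
      case False
      then have "m * (norm (\<phi> z) - 1) ^ 48 \<le> infdist z A" using lower\<psi>[of "\<phi> z"] wz by simp
      then have 1: "(norm (\<phi> z) - 1) ^ 48 \<le> infdist z A / m" using m(1) by (simp add: field_simps)
      have "1 \<le> (norm (\<phi> z) - 1) * b" using b3 wz(1) by (simp add: field_simps)
      then have "1 \<le> ((norm (\<phi> z) - 1) * b) ^ 48" by (rule one_le_power)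
      also have "\<dots> \<le> infdist z A / m * b ^ 48"
        unfolding power_mult_distrib using b(1) by (intro mult_right_mono 1) auto
      finally show ?thesis .
    qed
    then have "1 / infdist z A \<le> 1 / m * b ^ 48" using d m(1) by (simp add: field_simps)
    moreover have "1 \<le> b ^ 48" using b(1) by simp
    ultimately have "1 + 1 / infdist z A \<le> (1 + 1 / m) * b ^ 48" by (simp add: distrib_right)
    moreover have "1 + norm z \<le> C2 * b"
      using growth\<psi>[of "\<phi> z"] \<phi>V[OF z] b(2) C2 by (smt (verit) mult_left_mono)
    ultimately have "(1 + norm z) * (1 + 1 / infdist z A) \<le> (C2 * b) * ((1 + 1 / m) * b ^ 48)"
      using C2 b(1) d by (intro mult_mono) auto
    also have "\<dots> = (C2 * (1 + 1 / m)) * b ^ Suc 48" by (simp only: power_Suc mult_ac)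
    finally show ?thesis by (simp add: boundary_weight_def b_def)
  qed
  have wt2: "boundary_weight ?V (\<phi> z) \<le> (C1 * (2 + 1 / c)) * boundary_weight (- A) z ^ Suc N"
    if z: "z \<in> - A" for z
  proof -
    define b where "b = boundary_weight (- A) z"
    have b: "1 \<le> b" "1 + norm z \<le> b" "1 / infdist z A \<le> b"
      unfolding b_def using boundary_weight_ge(1)[of "- A" z] boundary_weight_ge(2,3)[of z "- A"] by simp_all
    have wz: "1 < norm (\<phi> z)" "\<psi> (\<phi> z) = z" using \<phi>V[OF z] by auto
    have d: "0 < infdist z A" using infdist_compl_pos[of "- A" z] z A0 by auto
    have bN: "1 \<le> b ^ N" using b(1) by simp
    have "1 / (norm (\<phi> z) - 1) \<le> (1 + 1 / c) * b ^ N"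
    proof (cases "2 \<le> norm (\<phi> z)")
      case True
      then have "1 / (norm (\<phi> z) - 1) \<le> 1" by simp
      also have "1 \<le> (1 + 1 / c) * b ^ N"
        using mult_mono[of 1 "1 + 1 / c" 1 "b ^ N"] c bN by simp
      finally show ?thesis .
    next
      case False
      have "1 + norm z \<le> C2 * (1 + norm (\<phi> z))" using growth\<psi>[of "\<phi> z"] \<phi>V[OF z] by simp
      also have "\<dots> \<le> C2 * 3" using False C2 by (intro mult_left_mono) auto
      finally have "c * infdist z A ^ N \<le> 1 - norm (h z)" using cN[OF z] by simp
      also have "norm (h z) = 1 / norm (\<phi> z)" by (simp add: \<phi>_def norm_divide)
      \<comment> \<open>This is \<open>(x - 1)\<^sup>2 \<ge> 0\<close> divided by
        \<open>x = norm (\<phi> z)\<close>; it passes from \<open>1 - 1 / x\<close> to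
        \<open>x - 1\<close>.\<close>
      also have "1 - 1 / norm (\<phi> z) \<le> norm (\<phi> z) - 1"
      proof -
        have "(2 - norm (\<phi> z)) * norm (\<phi> z) \<le> 1"
          using mult_nonneg_nonneg[of "norm (\<phi> z) - 1" "norm (\<phi> z) - 1"] wz(1) by (simp add: algebra_simps)
        then have "2 - norm (\<phi> z) \<le> 1 / norm (\<phi> z)"
          using wz(1) by (subst pos_le_divide_eq) auto
        then show ?thesis by simp
      qed
      finally have "1 / (norm (\<phi> z) - 1) \<le> 1 / (c * infdist z A ^ N)"
        using c d by (intro divide_left_mono mult_pos_pos zero_less_power) (use wz in auto)
      also have "\<dots> = 1 / c * (1 / infdist z A) ^ N" by (simp add: power_divide)
      also have "\<dots> \<le> 1 / c * b ^ N" using c d b(3) by (intro mult_left_mono power_mono) auto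
      also have "\<dots> \<le> (1 + 1 / c) * b ^ N" using b(1) by (intro mult_right_mono) auto
      finally show ?thesis .
    qed
    then have "1 + 1 / (norm (\<phi> z) - 1) \<le> (2 + 1 / c) * b ^ N"
      using bN by (simp add: distrib_right)
    moreover have "1 + norm (\<phi> z) \<le> C1 * b"
      using growth\<phi>[OF z] b(2) C1 by (smt (verit) mult_left_mono)
    ultimately have "(1 + norm (\<phi> z)) * (1 + 1 / (norm (\<phi> z) - 1)) \<le> (C1 * b) * ((2 + 1 / c) * b ^ N)"
      using C1 b(1) wz(1) by (intro mult_mono) auto
    also have "\<dots> = (C1 * (2 + 1 / c)) * b ^ Suc N" by (simp only: power_Suc mult_ac)
    finally show ?thesis using wz(1) by (simp add: boundary_weight_def b_def infdist_cball)
  qed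
  define C where "C = max (C2 * (1 + 1 / m)) (C1 * (2 + 1 / c))"
  show ?thesis
  proof (rule schwartz_equivalent_biholomorphic[OF _ _ _ _ hol\<phi> hol\<psi> \<phi>V \<psi>U])
    show "0 \<le> C" unfolding C_def using C2 m(1) by (intro max.coboundedI1 mult_nonneg_nonneg) auto
    have up: "D * b ^ k \<le> C * b ^ max 49 (Suc N)" if "0 \<le> D" "D \<le> C" "1 \<le> b" "k \<le> max 49 (Suc N)" for D b k
      using that by (intro mult_mono power_increasing) auto
    show "boundary_weight (- A) z \<le> C * boundary_weight ?V (\<phi> z) ^ max 49 (Suc N)" if "z \<in> - A" for z
      by (rule order_trans[OF wt1[OF that] up]) (use C2 m(1) boundary_weight_ge(1) in \<open>auto simp: C_def\<close>)
    show "boundary_weight ?V (\<phi> z) \<le> C * boundary_weight (- A) z ^ max 49 (Suc N)" if "z \<in> - A" for z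
      by (rule order_trans[OF wt2[OF that] up]) (use C1 c boundary_weight_ge(1) in \<open>auto simp: C_def\<close>)
  qed (use A0 VU in auto)
qed

section \<open>Quasiarcs\<close>

lemma homeomorphic_space_top_of_set_imp_homeomorphic:
  assumes "top_of_set S homeomorphic_space top_of_set T"
  shows "S homeomorphic T"
proof -
  obtain f g where "homeomorphic_maps (top_of_set S) (top_of_set T) f g"
    using assms unfolding homeomorphic_space_def by blast
  then have "homeomorphism S T f g"
    unfolding homeomorphic_maps_def continuous_map_in_subtopology
    by (intro homeomorphismI) (auto simp: image_subset_iff)
  then show ?thesis unfolding homeomorphic_def by blast
qed

lemma homeomorphic_map_Some_riemann_sphere:
  "homeomorphic_map (top_of_set S) (subtopology riemann_sphere (Some ` S)) Some"
proof -
  have "homeomorphic_map euclidean (subtopology riemann_sphere (range Some)) (Some :: complex \<Rightarrow> _)"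
    using embedding_map_Some[of "euclidean :: complex topology"]
    by (simp add: embedding_map_def riemann_sphere_def)
  then have "homeomorphic_map (top_of_set S)
      (subtopology (subtopology riemann_sphere (range Some)) (Some ` S)) Some"
    by (rule homeomorphic_map_subtopologies) (auto simp: riemann_sphere_def)
  moreover have "range Some \<inter> Some ` S = Some ` S" by auto
  ultimately show ?thesis by (simp add: subtopology_subtopology)
qed

lemma sphere_closure_compact:
  assumes "compact A"
  shows "sphere_closure A = Some ` A"
  unfolding sphere_closure_def riemann_sphere_def
  by (rule closure_of_closedin) (use assms in \<open>simp add: compact_imp_closed\<close>)

text \<open>Were infinity missing, the copy of \<open>J\<close> in the sphere would be closed there,
  which happens only for compact \<open>J\<close>.\<close>

lemma sphere_closure_unbounded:
  assumes "closed J" "\<not> bounded J"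
  shows "sphere_closure J = insert None (Some ` J)"
proof
  let ?C = "sphere_closure J"
  have cl: "closedin riemann_sphere ?C"
    unfolding sphere_closure_def by simp
  have sub: "Some ` J \<subseteq> ?C"
    unfolding sphere_closure_def by (rule closure_of_subset) (auto simp: riemann_sphere_def)
  have "closedin riemann_sphere (topspace riemann_sphere - Some ` (- J))"
    using assms(1) by (intro closedin_diff closedin_topspace) (simp add: riemann_sphere_def open_Compl)
  moreover have "topspace riemann_sphere - Some ` (- J) = insert None (Some ` J)"
    by (auto simp: riemann_sphere_def)
  ultimately show "?C \<subseteq> insert None (Some ` J)"
    unfolding sphere_closure_def by (intro closure_of_minimal) auto
  have "None \<in> ?C"
  proof (rule ccontr)
    assume "None \<notin> ?C"
    then have "?C = Some ` J" using sub \<open>?C \<subseteq> insert None (Some ` J)\<close> by auto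
    then have "compact J" using cl by (simp add: riemann_sphere_def)
    then show False using assms(2) compact_imp_bounded by blast
  qed
  with sub show "insert None (Some ` J) \<subseteq> ?C" by simp
qed

lemma compact_homeomorphic_of_sphere_closure:
  assumes "compact A" "subtopology riemann_sphere (sphere_closure A) homeomorphic_space top_of_set T"
  shows "A homeomorphic T"
proof (rule homeomorphic_space_top_of_set_imp_homeomorphic)
  have "top_of_set A homeomorphic_space subtopology riemann_sphere (Some ` A)"
    using homeomorphic_map_Some_riemann_sphere homeomorphic_space by blast
  with assms(2) show "top_of_set A homeomorphic_space top_of_set T"
    unfolding sphere_closure_compact[OF assms(1)] using homeomorphic_space_trans by blast
qed

lemma punctured_circle_homeomorphic_line:
  assumes "b \<in> sphere (0::complex) 1"
  shows "sphere 0 1 - {b} homeomorphic (UNIV :: real set)"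
  by (rule homeomorphic_punctured_sphere_affine) (use assms in auto)

text \<open>Deleting infinity from the Jordan curve leaves a punctured circle, hence a line.\<close>

lemma unbounded_homeomorphic_line_of_sphere_closure:
  assumes "closed J" "\<not> bounded J"
    and hom: "subtopology riemann_sphere (sphere_closure J) homeomorphic_space top_of_set (sphere (0::complex) 1)"
  shows "J homeomorphic (UNIV :: real set)"
proof -
  have eq: "sphere_closure J = insert None (Some ` J)" by (rule sphere_closure_unbounded[OF assms(1,2)])
  have top: "topspace (subtopology riemann_sphere (sphere_closure J)) = insert None (Some ` J)"
    by (auto simp: eq riemann_sphere_def)
  obtain H where H: "homeomorphic_map (subtopology riemann_sphere (sphere_closure J))
      (top_of_set (sphere (0::complex) 1)) H"
    using hom homeomorphic_space by blast
  have im: "H ` insert None (Some ` J) = sphere 0 1" and inj: "inj_on H (insert None (Some ` J))"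
    using H top homeomorphic_imp_surjective_map homeomorphic_imp_injective_map by (metis topspace_euclidean_subtopology)+
  have b: "H None \<in> sphere 0 1" using im by blast
  have "homeomorphic_map (subtopology (subtopology riemann_sphere (sphere_closure J)) (Some ` J))
      (subtopology (top_of_set (sphere (0::complex) 1)) (sphere 0 1 - {H None})) H"
  proof (rule homeomorphic_map_subtopologies[OF H])
    have "H ` Some ` J = H ` (insert None (Some ` J) - {None})" by (rule arg_cong[where f = "image H"]) auto
    also have "\<dots> = sphere 0 1 - {H None}"
      using inj im by (subst inj_on_image_set_diff[OF inj]) auto
    finally show "H ` (topspace (subtopology riemann_sphere (sphere_closure J)) \<inter> Some ` J)
        = topspace (top_of_set (sphere 0 1)) \<inter> (sphere 0 1 - {H None})"
      unfolding top by (simp add: Int_absorb1 subset_insertI Int_absorb2)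
  qed
  moreover have "sphere_closure J \<inter> Some ` J = Some ` J" "sphere 0 1 \<inter> (sphere 0 1 - {H None}) = sphere 0 1 - {H None}"
    unfolding eq by auto
  ultimately have "homeomorphic_map (subtopology riemann_sphere (Some ` J)) (top_of_set (sphere 0 1 - {H None})) H"
    by (simp only: subtopology_subtopology)
  then have "top_of_set J homeomorphic_space top_of_set (sphere 0 1 - {H None})"
    by (rule homeomorphic_space_trans[OF homeomorphic_map_imp_homeomorphic_space[OF
          homeomorphic_map_Some_riemann_sphere] homeomorphic_map_imp_homeomorphic_space])
  then have "J homeomorphic (sphere 0 1 - {H None})"
    by (rule homeomorphic_space_top_of_set_imp_homeomorphic)
  then show ?thesis
    using punctured_circle_homeomorphic_line[OF b] homeomorphic_trans by blast
qed

text \<open>Applied to an unbounded quasicircle itself and to a bounded one with a point removed.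
  \<open>k\<close> is the parametrisation, so subarcs are images of intervals.\<close>

context
  fixes X :: "complex set" and h :: "complex \<Rightarrow> real" and k :: "real \<Rightarrow> complex"
  assumes hom: "homeomorphism X UNIV h k"
begin

lemma line_chart:
  "continuous_on T k" "k t \<in> X" "h (k t) = t" "q \<in> X \<Longrightarrow> k (h q) = q" "h ` k ` T = T" "connected (k ` I) \<longleftrightarrow> connected I"
proof -
  show cont: "continuous_on T k" for T
    using hom continuous_on_subset by (auto simp: homeomorphism_def)
  show X: "k t \<in> X" "h (k t) = t" for t using hom by (auto simp: homeomorphism_def)
  show "q \<in> X \<Longrightarrow> k (h q) = q" using hom by (auto simp: homeomorphism_def)
  show im: "h ` k ` T = T" for T using X by (auto simp: image_image)
  have "continuous_on (k ` I) h"
    using hom X by (auto simp: homeomorphism_def intro: continuous_on_subset)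
  then show "connected (k ` I) \<longleftrightarrow> connected I"
    using cont[of I] im[of I] connected_continuous_image by metis
qed

lemma line_chart_closure: "k ` closure T \<subseteq> closure (k ` T)"
  by (rule continuous_image_closure_subset[OF line_chart(1)[of UNIV]]) simp

lemma line_chart_not_compact:
  assumes "\<not> compact T"
  shows "\<not> compact (k ` T)"
proof
  assume "compact (k ` T)"
  moreover have "continuous_on (k ` T) h"
    using hom line_chart(2) by (auto simp: homeomorphism_def intro: continuous_on_subset)
  ultimately have "compact (h ` k ` T)" using compact_continuous_image by blast
  then show False using assms by (simp add: line_chart(5))
qed

lemma line_chart_closedin:
  assumes "closed T"
  shows "closedin (top_of_set X) (k ` T)"
proof -
  have "k ` T = X \<inter> h -` T"
    using line_chart(2,3,4) by (auto intro: image_eqI[rotated])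
  moreover have "continuous_on X h" using hom by (simp add: homeomorphism_def)
  ultimately show ?thesis using assms continuous_closedin_preimage by metis
qed

text \<open>\<open>Y\<close> stands for the whole curve and \<open>X\<close> for the part covered by
  the chart; for a bounded quasicircle they differ by one point.\<close>

lemma line_chart_image_subset_component:
  assumes K: "K \<in> components (Y - {k a, k b})" and X: "X \<subseteq> Y"
    and I: "connected I" "a \<notin> I" "b \<notin> I" "h q \<in> I" and q: "q \<in> K" "q \<in> X"
  shows "k ` I \<subseteq> K"
proof (rule components_maximal[OF K])
  show "connected (k ` I)" using I(1) by (simp add: line_chart(6))
  have "k t = k s \<longleftrightarrow> t = s" for s t using line_chart(3) by metis
  then show "k ` I \<subseteq> Y - {k a, k b}" using I X line_chart(2) by auto
  show "K \<inter> k ` I \<noteq> {}" using q I(4) line_chart(4) by force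
qed

end

section \<open>Diameters of subarcs of a quasicircle\<close>

lemma not_compact_half_lines: "\<not> compact {..a::real}" "\<not> compact {a::real..}"
proof -
  have "\<not> bounded {..a}"
  proof
    assume "bounded {..a}"
    then obtain B where "\<And>x. x \<le> a \<Longrightarrow> \<bar>x\<bar> \<le> B" unfolding bounded_iff by auto
    from this[of a] this[of "min a (- B - 1)"] show False by (auto simp: min_def abs_le_iff split: if_splits)
  qed
  moreover have "\<not> bounded {a..}"
  proof
    assume "bounded {a..}"
    then obtain B where "\<And>x. a \<le> x \<Longrightarrow> \<bar>x\<bar> \<le> B" unfolding bounded_iff by auto
    from this[of a] this[of "max a (B + 1)"] show False by (auto simp: max_def abs_le_iff split: if_splits)
  qed
  ultimately show "\<not> compact {..a}" "\<not> compact {a..}" by (auto dest: compact_imp_bounded)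
qed

text \<open>The two points cut the curve into an arc and two rays. A closed ray is closed in the
  plane but not compact, hence unbounded; so the bounded \<open>K\<close> contains the open arc, and
  its closure the closed arc.\<close>

lemma arc_diameter_closed_line:
  fixes J :: "complex set" and h :: "complex \<Rightarrow> real"
  assumes hom: "homeomorphism J UNIV h k" and "closed J" "a < b"
    and K: "K \<in> components (J - {k a, k b})" "bounded K" and pq: "p \<in> k ` {a..b}" "q \<in> k ` {a..b}"
  shows "dist p q \<le> diameter K"
proof -
  note chart = line_chart[OF hom]
  obtain z where z: "z \<in> K" using in_components_nonempty[OF K(1)] by blast
  then have zJ: "z \<in> J" "z \<noteq> k a" "z \<noteq> k b" using in_components_subset[OF K(1)] by auto
  then have hz: "h z \<noteq> a" "h z \<noteq> b" using chart(4) by metis+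
  note sub = line_chart_image_subset_component[OF hom K(1) subset_refl _ _ _ _ z zJ(1)]
  have not: "\<not> k ` T \<subseteq> insert (k c) K" if "closed T" "\<not> compact T" for T c
  proof
    assume "k ` T \<subseteq> insert (k c) K"
    then have "bounded (k ` T)" using K(2) by (meson bounded_insert bounded_subset)
    moreover have "closed (k ` T)"
      using line_chart_closedin[OF hom that(1)] \<open>closed J\<close> closedin_closed_trans by blast
    ultimately show False using line_chart_not_compact[OF hom that(2)] compact_eq_bounded_closed by blast
  qed
  have "\<not> h z < a"
  proof
    assume "h z < a"
    then have "k ` {..<a} \<subseteq> K" using \<open>a < b\<close> by (intro sub) auto
    moreover have "k ` {..a} = insert (k a) (k ` {..<a})"
      unfolding image_insert[symmetric] by (rule arg_cong[where f = "image k"]) auto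
    ultimately have "k ` {..a} \<subseteq> insert (k a) K" by blast
    then show False using not[OF _ not_compact_half_lines(1), of a a] by simp
  qed
  moreover have "\<not> b < h z"
  proof
    assume "b < h z"
    then have "k ` {b<..} \<subseteq> K" using \<open>a < b\<close> by (intro sub) auto
    moreover have "k ` {b..} = insert (k b) (k ` {b<..})"
      unfolding image_insert[symmetric] by (rule arg_cong[where f = "image k"]) auto
    ultimately have "k ` {b..} \<subseteq> insert (k b) K" by blast
    then show False using not[OF _ not_compact_half_lines(2), of b b] by simp
  qed
  ultimately have "k ` {a<..<b} \<subseteq> K" using hz by (intro sub) auto
  then have "k ` {a..b} \<subseteq> closure K"
    using line_chart_closure[OF hom, of "{a<..<b}"] closure_mono \<open>a < b\<close>
    by (metis closure_greaterThanLessThan order_trans)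
  then have "dist p q \<le> diameter (closure K)"
    using pq K(2) by (intro diameter_bounded_bound) auto
  then show ?thesis using K(2) by (simp add: diameter_closure)
qed

text \<open>The two points cut the closed curve into the open arc between them and a rest containing
  \<open>p0\<close>. If \<open>K\<close> is the rest, its closure contains both \<open>p0\<close>
  and \<open>k a\<close>.\<close>

lemma arc_diameter_punctured_curve:
  fixes J :: "complex set" and h :: "complex \<Rightarrow> real"
  assumes hom: "homeomorphism (J - {p0}) UNIV h k" and "compact J" "p0 \<in> J" "a < b"
    and K: "K \<in> components (J - {k a, k b})"
  shows "dist p0 (k a) \<le> diameter K \<or> (\<forall>p\<in>k ` {a..b}. \<forall>q\<in>k ` {a..b}. dist p q \<le> diameter K)"
proof -
  note chart = line_chart[OF hom]
  have bK: "bounded K"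
    using in_components_subset[OF K] \<open>compact J\<close> by (meson Diff_subset bounded_subset compact_imp_bounded)
  obtain z where z: "z \<in> K" using in_components_nonempty[OF K] by blast
  have zJ: "z \<in> J" "z \<noteq> k a" "z \<noteq> k b" using in_components_subset[OF K] z by auto
  have p0: "p0 \<noteq> k t" for t using chart(2)[of t] by auto
  have sub: "k ` I \<subseteq> K" if "connected I" "a \<notin> I" "b \<notin> I" "h q \<in> I" "q \<in> K" "q \<noteq> p0" for I q
    by (rule line_chart_image_subset_component[OF hom K _ that(1-5)])
      (use that in_components_subset[OF K] in auto)
  \<comment> \<open>Both ends of the line run to \<open>p0\<close>: the image of a closed half-line
    is closed in \<open>J - {p0}\<close> but not compact, so its closure in the compact set
    \<open>J\<close> must contain \<open>p0\<close>.\<close>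
  have limit: "p0 \<in> closure (k ` T)" if nc: "\<not> compact (insert c T)" and cl: "closed (insert c T)" for T c
  proof (rule ccontr)
    assume "p0 \<notin> closure (k ` T)"
    then have n: "p0 \<notin> closure (k ` insert c T)" using p0 by (simp add: closure_insert)
    have JX: "closure (k ` insert c T) \<subseteq> J"
      using chart(2) \<open>compact J\<close> by (intro closure_minimal compact_imp_closed) auto
    obtain T0 where T0: "closed T0" "k ` insert c T = (J - {p0}) \<inter> T0"
      using line_chart_closedin[OF hom cl] unfolding closedin_closed by blast
    then have "closure (k ` insert c T) \<subseteq> T0" by (intro closure_minimal) auto
    then have "closure (k ` insert c T) = k ` insert c T"
      using n JX T0(2) closure_subset[of "k ` insert c T"] by blast
    moreover have "bounded (k ` insert c T)"
      using JX closure_subset \<open>compact J\<close> by (meson bounded_subset compact_imp_bounded)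
    ultimately have "compact (k ` insert c T)"
      using compact_closure by metis
    then show False using line_chart_not_compact[OF hom nc] by blast
  qed
  have limits: "p0 \<in> closure (k ` {..<a})" "p0 \<in> closure (k ` {b<..})"
  proof -
    have "insert a {..<a} = {..a}" "insert b {b<..} = {b..}" by auto
    then show "p0 \<in> closure (k ` {..<a})" "p0 \<in> closure (k ` {b<..})"
      using limit[of a "{..<a}"] limit[of b "{b<..}"] not_compact_half_lines by auto
  qed
  have con: "connected (insert p0 (k ` T))" if "p0 \<in> closure (k ` T)" "connected T" for T
  proof (rule connected_intermediate_closure)
    show "connected (k ` T)" using that(2) by (simp add: chart(6))
    show "insert p0 (k ` T) \<subseteq> closure (k ` T)" using that(1) closure_subset[of "k ` T"] by blast
  qed auto
  have max: "insert p0 (k ` T) \<subseteq> K"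
    if "p0 \<in> closure (k ` T)" "connected T" "a \<notin> T" "b \<notin> T" "K \<inter> insert p0 (k ` T) \<noteq> {}" for T
  proof (rule components_maximal[OF K con[OF that(1,2)] _ that(5)])
    have "k t = k s \<longleftrightarrow> t = s" for s t using chart(3) by metis
    then show "insert p0 (k ` T) \<subseteq> J - {k a, k b}"
      using that(3,4) p0 \<open>p0 \<in> J\<close> chart(2) by auto
  qed
  have far: "dist p0 (k a) \<le> diameter K" if "p0 \<in> K"
  proof -
    have "insert p0 (k ` {..<a}) \<subseteq> K" using that \<open>a < b\<close> by (intro max limits) auto
    then have "closure (k ` {..<a}) \<subseteq> closure K" by (intro closure_mono) auto
    then have "k a \<in> closure K"
      using line_chart_closure[OF hom, of "{..<a}"] by auto
    then have "dist p0 (k a) \<le> diameter (closure K)"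
      using that bK closure_subset by (intro diameter_bounded_bound) auto
    then show ?thesis using bK by (simp add: diameter_closure)
  qed
  show ?thesis
  proof (cases "p0 \<in> K")
    case False
    then have "z \<noteq> p0" using z by auto
    then have zX: "k (h z) = z" using zJ chart(4) by auto
    then have hz: "h z \<noteq> a" "h z \<noteq> b" using zJ by metis+
    have "\<not> h z < a"
    proof
      assume "h z < a"
      then have "insert p0 (k ` {..<a}) \<subseteq> K"
        using \<open>a < b\<close> z zX by (intro max limits) (auto intro!: exI[of _ z] image_eqI[of _ _ "h z"])
      then show False using False by auto
    qed
    moreover have "\<not> b < h z"
    proof
      assume "b < h z"
      then have "insert p0 (k ` {b<..}) \<subseteq> K"
        using \<open>a < b\<close> z zX by (intro max limits) (auto intro!: exI[of _ z] image_eqI[of _ _ "h z"])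
      then show False using False by auto
    qed
    ultimately have "k ` {a<..<b} \<subseteq> K" using hz z \<open>z \<noteq> p0\<close> by (intro sub[of _ z]) auto
    then have "k ` {a..b} \<subseteq> closure K"
      using line_chart_closure[OF hom, of "{a<..<b}"] closure_mono \<open>a < b\<close>
      by (metis closure_greaterThanLessThan order_trans)
    then have "\<forall>p\<in>k ` {a..b}. \<forall>q\<in>k ` {a..b}. dist p q \<le> diameter (closure K)"
      using bK by (auto intro!: diameter_bounded_bound)
    then show ?thesis using bK by (simp add: diameter_closure)
  qed (use far in blast)
qed

text \<open>The image of \<open>A\<close> under \<open>h\<close> is an interval, so the subarc
  between two points of \<open>A\<close> lies in \<open>A\<close> and serves as \<open>S\<close>.
  Premise \<open>arc\<close> has \<open>p\<close> and \<open>q\<close> in \<open>A\<close>, which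
  permits bounds by \<open>diameter A\<close>.\<close>

lemma connected_bounded_turning_of_line_chart:
  fixes X :: "complex set" and h :: "complex \<Rightarrow> real"
  assumes hom: "homeomorphism X UNIV h k" and A: "A \<subseteq> X" "connected A" and "1 \<le> C"
    and arc: "\<And>a b p q. k a \<in> A \<Longrightarrow> k b \<in> A \<Longrightarrow> a < b \<Longrightarrow> p \<in> k ` {a..b} \<Longrightarrow> q \<in> k ` {a..b}
      \<Longrightarrow> p \<in> A \<Longrightarrow> q \<in> A \<Longrightarrow> dist p q \<le> C * dist (k a) (k b)"
  shows "connected_bounded_turning A C"
  unfolding connected_bounded_turning_def
proof (intro ballI)
  note chart = line_chart[OF hom]
  fix x y assume xy: "x \<in> A" "y \<in> A"
  define a where "a = min (h x) (h y)"
  define b where "b = max (h x) (h y)"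
  have kxy: "k (h x) = x" "k (h y) = y" using xy A chart(4) by auto
  have "continuous_on A h"
    using hom A(1) continuous_on_subset by (auto simp: homeomorphism_def)
  then have "connected (h ` A)" using A(2) connected_continuous_image by blast
  then have "{a..b} \<subseteq> h ` A"
    using connected_contains_Icc[of "h ` A" a b] xy by (auto simp: a_def b_def min_def max_def)
  then have SA: "k ` {a..b} \<subseteq> A" using chart(4) A(1) by force
  have S: "x \<in> k ` {a..b}" "y \<in> k ` {a..b}"
    using kxy by (auto simp: a_def b_def intro!: image_eqI[of x k "h x"] image_eqI[of y k "h y"])
  have "dist x p \<le> C * dist x y" if p: "p \<in> k ` {a..b}" for p
  proof (cases "x = y")
    case True
    then have "p = x" using p kxy by (auto simp: a_def b_def)
    with True show ?thesis by simp
  next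
    case False
    then have "h x \<noteq> h y" using kxy by metis
    then have "a < b" by (auto simp: a_def b_def)
    have "dist (k a) (k b) = dist x y"
      using kxy by (auto simp: a_def b_def min_def max_def dist_commute)
    moreover have "k a \<in> A" "k b \<in> A" using SA \<open>a < b\<close> by auto
    ultimately show ?thesis using arc[of a b x p] \<open>a < b\<close> p S SA by auto
  qed
  moreover have "connected (k ` {a..b})" by (simp add: chart(6))
  ultimately show "\<exists>S\<subseteq>A. connected S \<and> x \<in> S \<and> y \<in> S \<and> (\<forall>p\<in>S. dist x p \<le> C * dist x y)"
    using SA S by blast
qed

text \<open>The component of \<open>J - {x, y}\<close> of controlled diameter need not lie in \<open>A\<close>; if it does not, it
  contains a fixed point of \<open>J - A\<close>, and then \<open>dist x y\<close> is bounded below.\<close>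

lemma quasiarc_connected_bounded_turning:
  assumes A: "compact A" "A \<noteq> {}" "connected A" "connected (- A)" and J: "quasicircle J" "A \<subseteq> J"
  obtains C where "1 \<le> C" "connected_bounded_turning A C"
proof -
  obtain C where "0 < C" and C: "\<And>x y. x \<in> J \<Longrightarrow> y \<in> J \<Longrightarrow> x \<noteq> y
      \<Longrightarrow> \<exists>K\<in>components (J - {x, y}). bounded K \<and> diameter K \<le> C * dist x y"
    using J(1) unfolding quasicircle_def by blast
  have "closed J" and sph: "subtopology riemann_sphere (sphere_closure J) homeomorphic_space
      top_of_set (sphere (0::complex) 1)"
    using J(1) unfolding quasicircle_def by auto
  show ?thesis
  proof (cases "bounded J")
    case False
    then obtain h k where hom: "homeomorphism J (UNIV::real set) h k"
      using unbounded_homeomorphic_line_of_sphere_closure[OF \<open>closed J\<close> _ sph] homeomorphic_def by blast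
    have "connected_bounded_turning A (max 1 C)"
    proof (rule connected_bounded_turning_of_line_chart[OF hom J(2) A(3)])
      fix a b p q assume ab: "k a \<in> A" "k b \<in> A" "a < b" and pq: "p \<in> k ` {a..b}" "q \<in> k ` {a..b}"
      have "k a \<noteq> k b" using line_chart(3)[OF hom] ab(3) by (metis less_irrefl)
      then obtain K where K: "K \<in> components (J - {k a, k b})" "bounded K" "diameter K \<le> C * dist (k a) (k b)"
        using C ab J(2) by blast
      have "dist p q \<le> diameter K"
        by (rule arc_diameter_closed_line[OF hom \<open>closed J\<close> ab(3) K(1,2) pq])
      also have "\<dots> \<le> max 1 C * dist (k a) (k b)"
        using K(3) by (meson max.cobounded2 mult_right_mono order_trans zero_le_dist)
      finally show "dist p q \<le> max 1 C * dist (k a) (k b)" .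
    qed simp
    then show ?thesis by (intro that) auto
  next
    case True
    then have "compact J" using \<open>closed J\<close> by (simp add: compact_eq_bounded_closed)
    then have circ: "J homeomorphic sphere (0::complex) 1"
      using compact_homeomorphic_of_sphere_closure sph by blast
    \<comment> \<open>A Jordan curve separates the plane and \<open>A\<close> does not, so
      \<open>J\<close> has a point outside \<open>A\<close>.\<close>
    then have "\<not> connected (- J)" by (rule Jordan_Brouwer_separation) simp
    then have "J \<noteq> A" using A(4) by auto
    then obtain p0 where p0: "p0 \<in> J" "p0 \<notin> A" using J(2) by blast
    obtain H H' where HH: "homeomorphism J (sphere (0::complex) 1) H H'"
      using circ homeomorphic_def by blast
    have "inj_on H J" "H ` J = sphere 0 1"
      using HH by (auto simp: homeomorphism_def intro: inj_on_inverseI)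
    then have "H ` (J - {p0}) = sphere 0 1 - {H p0}"
      using p0(1) inj_on_image_set_diff[of H J J "{p0}"] by auto
    then have "homeomorphism (J - {p0}) (sphere 0 1 - {H p0}) H H'"
      by (intro homeomorphism_of_subsets[OF HH _ subset_refl]) auto
    then have "J - {p0} homeomorphic (sphere 0 1 - {H p0})" using homeomorphic_def by blast
    moreover have "H p0 \<in> sphere 0 1" using HH p0(1) by (auto simp: homeomorphism_def)
    ultimately have "J - {p0} homeomorphic (UNIV::real set)"
      using punctured_circle_homeomorphic_line homeomorphic_trans by blast
    then obtain h k where hom: "homeomorphism (J - {p0}) (UNIV::real set) h k"
      using homeomorphic_def by blast
    define e where "e = infdist p0 A"
    have e: "0 < e"
      using A p0(2) by (metis compact_imp_closed e_def in_closed_iff_infdist_zero infdist_nonneg less_eq_real_def)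
    \<comment> \<open>\<open>C\<close> serves the case that \<open>K\<close> is the subarc.
      Otherwise \<open>e \<le> C * dist (k a) (k b)\<close>, so \<open>diameter A\<close> is at most
      \<open>diameter A / e\<close> times the right-hand side. The 1 secures
      \<open>1 \<le> M\<close>.\<close>
    define M where "M = 1 + C + diameter A / e * C"
    have D: "0 \<le> diameter A" using A(1) compact_imp_bounded diameter_ge_0 by blast
    then have D': "0 \<le> diameter A / e * C" using e \<open>0 < C\<close> by simp
    have "connected_bounded_turning A M"
    proof (rule connected_bounded_turning_of_line_chart[OF hom _ A(3)])
      show "A \<subseteq> J - {p0}" using J(2) p0(2) by auto
      show "1 \<le> M" unfolding M_def using D' \<open>0 < C\<close> by simp
      fix a b p q assume ab: "k a \<in> A" "k b \<in> A" "a < b" and pq: "p \<in> k ` {a..b}" "q \<in> k ` {a..b}"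
        and pqA: "p \<in> A" "q \<in> A"
      have "k a \<noteq> k b" using line_chart(3)[OF hom] ab(3) by (metis less_irrefl)
      then obtain K where K: "K \<in> components (J - {k a, k b})" "diameter K \<le> C * dist (k a) (k b)"
        using C ab J(2) by blast
      have "C * dist (k a) (k b) \<le> M * dist (k a) (k b)"
        using D' unfolding M_def by (intro mult_right_mono) auto
      moreover have "dist p q \<le> diameter A / e * C * dist (k a) (k b)" if "dist p0 (k a) \<le> diameter K"
      proof -
        have "e \<le> C * dist (k a) (k b)"
          using infdist_le[OF ab(1), of p0] that K(2) by (simp add: e_def)
        then have "1 \<le> C * dist (k a) (k b) / e" using e by simp
        then have "diameter A * 1 \<le> diameter A * (C * dist (k a) (k b) / e)"
          using D by (intro mult_left_mono)
        moreover have "dist p q \<le> diameter A"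
          using pqA A(1) compact_imp_bounded by (intro diameter_bounded_bound) auto
        ultimately show ?thesis by (simp add: mult_ac)
      qed
      moreover have "diameter A / e * C * dist (k a) (k b) \<le> M * dist (k a) (k b)"
        using \<open>0 < C\<close> unfolding M_def by (intro mult_right_mono) auto
      ultimately show "dist p q \<le> M * dist (k a) (k b)"
        using arc_diameter_punctured_curve[OF hom \<open>compact J\<close> p0(1) ab(3) K(1)] pq K(2)
        by (meson order_trans)
    qed
    then show ?thesis
      by (rule that[rotated]) (use D' \<open>0 < C\<close> in \<open>simp add: M_def\<close>)
  qed
qed

text \<open>\<open>a\<close> is an endpoint of the arc: its removal leaves a half-open arc, still
  connected, as the inversion at \<open>a\<close> requires.\<close>

lemma quasiarc_topology:
  assumes "quasiarc A" "compact A"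
  obtains a where "a \<in> A" "A \<noteq> {a}" "connected (A - {a})" "connected A" "contractible A" "connected (- A)"
proof -
  have "A homeomorphic {0..1::real}"
    using assms compact_homeomorphic_of_sphere_closure unfolding quasiarc_def by blast
  then have "{0..1::real} homeomorphic A" using homeomorphic_sym by blast
  then obtain \<gamma> \<gamma>' where hom: "homeomorphism {0..1::real} A \<gamma> \<gamma>'" using homeomorphic_def by blast
  have \<gamma>: "continuous_on {0..1} \<gamma>" "\<gamma> ` {0..1} = A" "inj_on \<gamma> {0..1}"
    using hom by (auto simp: homeomorphism_def intro: inj_on_inverseI)
  then have "arc \<gamma>" "path_image \<gamma> = A" by (auto simp: arc_def path_def path_image_def)
  show ?thesis
  proof (rule that[of "\<gamma> 0"])
    show "\<gamma> 0 \<in> A" using \<gamma>(2) by auto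
    have "\<gamma> 1 \<noteq> \<gamma> 0" using \<gamma>(3) by (auto dest: inj_onD)
    moreover have "\<gamma> 1 \<in> A" using \<gamma>(2) by auto
    ultimately show "A \<noteq> {\<gamma> 0}" by auto
    have "A - {\<gamma> 0} = \<gamma> ` ({0..1} - {0})"
      using \<gamma>(2) inj_on_image_set_diff[OF \<gamma>(3), of "{0..1}" "{0}"] by auto
    also have "{0..1} - {0} = {0<..1::real}" by auto
    finally show "connected (A - {\<gamma> 0})"
      using connected_continuous_image[OF continuous_on_subset[OF \<gamma>(1)] connected_Ioc[of 0 1]]
      by (simp add: subset_eq)
    show "connected A" using \<gamma> by (metis connected_Icc connected_continuous_image)
    show "contractible A"
      using \<open>{0..1} homeomorphic A\<close> convex_imp_contractible homeomorphic_contractible by blast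
    show "connected (- A)"
      using connected_arc_complement[OF \<open>arc \<gamma>\<close>] \<open>path_image \<gamma> = A\<close> by simp
  qed
qed

text \<open>A connected set that meets \<open>U\<close> and misses its frontier lies in
  \<open>U\<close>; here that set is the complement of the frontier.\<close>

lemma open_connected_eq_compl_frontier:
  assumes "open U" "frontier U \<noteq> {}" "connected (- frontier U)"
  shows "U = - frontier U"
proof -
  have "U \<noteq> {}" using assms(2) by auto
  moreover have sub: "U \<subseteq> - frontier U" using assms(1) by (auto simp: frontier_def interior_open)
  ultimately have "- frontier U \<inter> U \<noteq> {}" by blast
  then have "- frontier U - U = {}"
    using connected_Int_frontier[OF assms(3)] by blast
  with sub show ?thesis by blast
qed

theorem theorem5p5:
  fixes U :: "complex set"
  assumes "open U" and "connected U"
    and "quasiarc (frontier U)" and "bounded (frontier U)"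
  shows "schwartz_equivalent U (- closure (ball (0::complex) 1))"
proof -
  define A where "A = frontier U"
  have A: "compact A" "quasiarc A"
    using assms(3,4) by (simp_all add: A_def compact_eq_bounded_closed)
  obtain a where a: "a \<in> A" "A \<noteq> {a}" "connected (A - {a})" "connected A" "contractible A"
      "connected (- A)"
    using quasiarc_topology[OF A(2,1)] by blast
  have "A \<noteq> {}" using a(1) by blast
  obtain J where "quasicircle J" "A \<subseteq> J" using A(2) unfolding quasiarc_def by blast
  then obtain K where K: "1 \<le> K" "connected_bounded_turning A K"
    using quasiarc_connected_bounded_turning[OF A(1) \<open>A \<noteq> {}\<close> a(4,6)] by blast
  have "U = - A"
    using open_connected_eq_compl_frontier[OF assms(1)] \<open>A \<noteq> {}\<close> a(6) by (simp add: A_def)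
  moreover have "schwartz_equivalent (- A) (- cball 0 1)"
    by (rule schwartz_equivalent_complement[OF A(1) a(5,4,6,1,3,2) K])
  ultimately show ?thesis by simp
qed

end
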